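(* Let $p\in[1,\infty)$, let $X,Y$ be complex Banach spaces and $f\in\mathcal{H}L_0(B_X,Y)$. The following assertions are equivalent: (i) $f\in\mathcal{H}L_0^{\mathcal{K}_p}(B_X,Y)$. (ii) $T_f\in\mathcal{K}_p(\mathcal{G}_0(B_X),Y)$. (iii) $(T_f)^*\in\mathcal{QN}_p(Y^*,\mathcal{G}_0(B_X)^* )$. (iv) $f^t\in\mathcal{QN}_p(Y^*,\mathcal{H}L_0(B_X))$. In such a case, $\|f\|_{\mathcal{H}L_0^{\mathcal{K}_p}}=\|T_f\|_{\mathcal{K}_p}=\|(T_f)^*\|_{\mathcal{QN}_p}=\|f^t\|_{\mathcal{QN}_p}$.
   Context: $B_X$, $\overline{B}_X$ are the open and closed unit balls. $\mathcal{H}L_0(B_X,Y)$ is the Banach space of all holomorphic Lipschitz maps $f:B_X\to Y$ with $f(0)=0$, with norm $L(f)=\sup\{\|f(x)-f(y)\|/\|x-y\|: x\ne y\}$; $\mathcal{H}L_0(B_X)=\mathcal{H}L_0(B_X,\mathbb{C})$. The Lipschitz image of $f$ is $\mathrm{Im}_L(f)=\{(f(x)-f(y))/\|x-y\|:x,y\in B_X,\ x\neq y\}$. The transpose $f^t\in\mathcal{L}(Y^*,\mathcal{H}L_0(B_X))$ is $f^t(y^* )=y^*\circ f$. $\delta_X(x)(g)=g(x)$ for $x\in B_X$, $g\in\mathcal{H}L_0(B_X)$, and $\mathcal{G}_0(B_X)=\overline{\mathrm{lin}}(\delta_X(B_X))\subseteq\mathcal{H}L_0(B_X)^*$. $T_f\in\mathcal{L}(\mathcal{G}_0(B_X),Y)$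 is the unique bounded operator with $T_f\circ\delta_X=f$; it is known that $f\mapsto T_f$ is an isometric isomorphism from $\mathcal{H}L_0(B_X,Y)$ onto $\mathcal{L}(\mathcal{G}_0(B_X),Y)$. A set $K\subseteq Y$ is relatively $p$-compact if there is $(y_n)\in\ell_p(Y)$ (i.e. $\|(y_n)\|_p=(\sum\|y_n\|^p)^{1/p}<\infty$) with $K\subseteq\{\sum_n a_ny_n:(a_n)\in\overline{B}_{\ell_{p^*}}\}$, where $1/p+1/p^*=1$ and $\ell_{p^*}$ is replaced by $c_0$ if $p=1$; $m_p(K)=\inf\|(y_n)\|_p$ over all such sequences. (These are exactly the relatively $\mathcal{N}_p$-compact sets for the ideal $\mathcal{N}_p$ of right $p$-nuclear operators, with the same measure.) $\mathcal{K}_p(X,Y)$ is the set of $p$-compact operators $T\in\mathcal{L}(X,Y)$, i.e. with $T(\overline{B}_X)$ relatively $p$-compact, and $\|T\|_{\mathcal{K}_p}=m_p(T(\overline{B}_X))$. $\mathcal{H}L_0^{\mathcal{K}_p}(B_X,Y)$ is the set of $f\in\mathcal{H}L_0(B_X,Y)$ with $\mathrm{Im}_L(f)$ relatively $p$-compact, and $\|f\|_{\mathcal{H}L_0^{\mathcal{K}_p}}=m_p(\mathrm{Im}_L(f))$. $\mathcal{QN}_p(X,Y)$ is the set of quasi $p$-nuclear operators: $T\in\mathcal{L}(X,Y)$ such that there is $(x_n^* )\in\ell_p(X^* )$ with $\|Tx\|\le(\sum_n|x_n^*(x)|^p)^{1/p}$ for all $x\in X$; $\|T\|_{\mathcal{QN}_p}=\inf\|(x_n^*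 )\|_p$ over all such sequences. *)

theory Defs
  imports "HOL-Analysis.Analysis"
begin

section \<open>Complex normed and Banach spaces\<close>

class scaleC =
  fixes scaleC :: "complex \<Rightarrow> 'a \<Rightarrow> 'a"  (infixr "*\<^sub>C" 75)

class complex_vector = real_vector + scaleC +
  assumes scaleC_add_right: "c *\<^sub>C (x + y) = c *\<^sub>C x + c *\<^sub>C y"
    and scaleC_add_left: "(c + d) *\<^sub>C x = c *\<^sub>C x + d *\<^sub>C x"
    and scaleC_scaleC: "c *\<^sub>C d *\<^sub>C x = (c * d) *\<^sub>C x"
    and scaleC_one: "1 *\<^sub>C x = x"
    and scaleR_scaleC: "r *\<^sub>R x = complex_of_real r *\<^sub>C x"

class complex_normed_vector = complex_vector + real_normed_vector +
  assumes norm_scaleC: "norm (c *\<^sub>C x) = norm c * norm x"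

class cbanach = complex_normed_vector + banach

interpretation complex_vector: vector_space
  "scaleC :: complex \<Rightarrow> 'a \<Rightarrow> 'a::complex_vector"
  by unfold_locales
    (rule scaleC_add_right scaleC_add_left scaleC_scaleC scaleC_one)+

instantiation complex :: cbanach
begin

definition scaleC_complex :: "complex \<Rightarrow> complex \<Rightarrow> complex"
  where "scaleC_complex c z = c * z"

instance
proof
  fix c d z w :: complex and r :: real
  show "c *\<^sub>C (z + w) = c *\<^sub>C z + c *\<^sub>C w"
    by (simp only: scaleC_complex_def distrib_left)
  show "(c + d) *\<^sub>C z = c *\<^sub>C z + d *\<^sub>C z"
    by (simp only: scaleC_complex_def distrib_right)
  show "c *\<^sub>C d *\<^sub>C z = (c * d) *\<^sub>C z"
    by (simp only: scaleC_complex_def mult.assoc)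
  show "1 *\<^sub>C z = z"
    by (simp only: scaleC_complex_def mult_1_left)
  show "r *\<^sub>R z = complex_of_real r *\<^sub>C z"
    by (simp only: scaleC_complex_def scaleR_conv_of_real)
  show "norm (c *\<^sub>C z) = norm c * norm z"
    by (simp only: scaleC_complex_def norm_mult)
qed

end


section \<open>Bounded complex-linear operators and dual spaces\<close>

definition bounded_clinear :: "('a::complex_normed_vector \<Rightarrow> 'b::complex_normed_vector) \<Rightarrow> bool"
  where "bounded_clinear T \<longleftrightarrow> bounded_linear T \<and> (\<forall>c x. T (c *\<^sub>C x) = c *\<^sub>C T x)"

lemma bounded_clinear_imp_bounded_linear: "bounded_clinear T \<Longrightarrow> bounded_linear T"
  by (simp add: bounded_clinear_def)

lemma bounded_clinear_scaleC: "bounded_clinear T \<Longrightarrow> T (c *\<^sub>C x) = c *\<^sub>C T x"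
  by (simp add: bounded_clinear_def)

lemma bounded_linear_scaleC_right:
  "bounded_linear (\<lambda>x::'a::complex_normed_vector. c *\<^sub>C x)"
  by (rule bounded_linear_intro[where K = "norm c"])
    (simp_all add: scaleC_add_right scaleR_scaleC scaleC_scaleC norm_scaleC mult.commute)

lemma bounded_clinear_zero: "bounded_clinear (\<lambda>x. 0)"
  by (simp add: bounded_clinear_def)

lemma bounded_clinear_add:
  "bounded_clinear S \<Longrightarrow> bounded_clinear T \<Longrightarrow> bounded_clinear (\<lambda>x. S x + T x)"
  by (simp add: bounded_clinear_def bounded_linear_add scaleC_add_right)

lemma bounded_clinear_uminus: "bounded_clinear T \<Longrightarrow> bounded_clinear (\<lambda>x. - T x)"
  by (simp add: bounded_clinear_def bounded_linear_minus)

lemma bounded_clinear_diff: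
  "bounded_clinear S \<Longrightarrow> bounded_clinear T \<Longrightarrow> bounded_clinear (\<lambda>x. S x - T x)"
  by (simp add: bounded_clinear_def bounded_linear_sub complex_vector.scale_right_diff_distrib)

lemma bounded_clinear_cmult: "bounded_clinear T \<Longrightarrow> bounded_clinear (\<lambda>x. c *\<^sub>C T x)"
  by (auto simp: bounded_clinear_def complex_vector.scale_left_commute
      intro: bounded_linear_compose[OF bounded_linear_scaleC_right])

lemma bounded_clinear_scaleR: "bounded_clinear T \<Longrightarrow> bounded_clinear (\<lambda>x. r *\<^sub>R T x)"
  by (simp add: scaleR_scaleC bounded_clinear_cmult)

lemma bounded_clinear_compose:
  "bounded_clinear S \<Longrightarrow> bounded_clinear T \<Longrightarrow> bounded_clinear (\<lambda>x. S (T x))"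
  by (simp add: bounded_clinear_def bounded_linear_compose)

typedef (overloaded) ('a, 'b) cblinfun ("(_ \<Rightarrow>\<^sub>C\<^sub>L /_)" [22, 21] 21)
    = "{T :: 'a::complex_normed_vector \<Rightarrow> 'b::complex_normed_vector. bounded_clinear T}"
  morphisms cblinfun_apply CBlinfun
  by (blast intro: bounded_clinear_zero)

setup_lifting type_definition_cblinfun

declare [[coercion "cblinfun_apply :: ('a::complex_normed_vector \<Rightarrow>\<^sub>C\<^sub>L 'b::complex_normed_vector) \<Rightarrow> 'a \<Rightarrow> 'b"]]

type_synonym 'a cdual = "'a \<Rightarrow>\<^sub>C\<^sub>L complex"

instantiation cblinfun :: (complex_normed_vector, complex_normed_vector) complex_normed_vector
begin

lift_definition norm_cblinfun :: "'a \<Rightarrow>\<^sub>C\<^sub>L 'b \<Rightarrow> real" is onorm .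

lift_definition zero_cblinfun :: "'a \<Rightarrow>\<^sub>C\<^sub>L 'b" is "\<lambda>x. 0"
  by (rule bounded_clinear_zero)

lift_definition plus_cblinfun :: "'a \<Rightarrow>\<^sub>C\<^sub>L 'b \<Rightarrow> 'a \<Rightarrow>\<^sub>C\<^sub>L 'b \<Rightarrow> 'a \<Rightarrow>\<^sub>C\<^sub>L 'b"
  is "\<lambda>S T x. S x + T x" by (rule bounded_clinear_add)

lift_definition uminus_cblinfun :: "'a \<Rightarrow>\<^sub>C\<^sub>L 'b \<Rightarrow> 'a \<Rightarrow>\<^sub>C\<^sub>L 'b"
  is "\<lambda>T x. - T x" by (rule bounded_clinear_uminus)

lift_definition minus_cblinfun :: "'a \<Rightarrow>\<^sub>C\<^sub>L 'b \<Rightarrow> 'a \<Rightarrow>\<^sub>C\<^sub>L 'b \<Rightarrow> 'a \<Rightarrow>\<^sub>C\<^sub>L 'b"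
  is "\<lambda>S T x. S x - T x" by (rule bounded_clinear_diff)

lift_definition scaleC_cblinfun :: "complex \<Rightarrow> 'a \<Rightarrow>\<^sub>C\<^sub>L 'b \<Rightarrow> 'a \<Rightarrow>\<^sub>C\<^sub>L 'b"
  is "\<lambda>c T x. c *\<^sub>C T x" by (rule bounded_clinear_cmult)

lift_definition scaleR_cblinfun :: "real \<Rightarrow> 'a \<Rightarrow>\<^sub>C\<^sub>L 'b \<Rightarrow> 'a \<Rightarrow>\<^sub>C\<^sub>L 'b"
  is "\<lambda>r T x. r *\<^sub>R T x" by (rule bounded_clinear_scaleR)

definition sgn_cblinfun :: "'a \<Rightarrow>\<^sub>C\<^sub>L 'b \<Rightarrow> 'a \<Rightarrow>\<^sub>C\<^sub>L 'b"
  where "sgn_cblinfun T = inverse (norm T) *\<^sub>R T"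

definition dist_cblinfun :: "'a \<Rightarrow>\<^sub>C\<^sub>L 'b \<Rightarrow> 'a \<Rightarrow>\<^sub>C\<^sub>L 'b \<Rightarrow> real"
  where "dist_cblinfun S T = norm (S - T)"

definition uniformity_cblinfun :: "(('a \<Rightarrow>\<^sub>C\<^sub>L 'b) \<times> ('a \<Rightarrow>\<^sub>C\<^sub>L 'b)) filter"
  where [code del]: "uniformity_cblinfun = (INF e\<in>{0<..}. principal {(S, T). dist S T < e})"

definition open_cblinfun :: "('a \<Rightarrow>\<^sub>C\<^sub>L 'b) set \<Rightarrow> bool"
  where [code del]: "open_cblinfun U \<longleftrightarrow> (\<forall>S\<in>U. \<forall>\<^sub>F (S', T) in uniformity. S' = S \<longrightarrow> T \<in> U)"

lemma onorm_scaleC: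
  assumes "bounded_clinear T"
  shows "onorm (\<lambda>x. c *\<^sub>C T x) = norm c * onorm T"
proof -
  have "onorm (\<lambda>x. c *\<^sub>C T x) = onorm (\<lambda>x. norm c *\<^sub>R T x)"
    by (simp add: onorm_def norm_scaleC)
  then show ?thesis
    using assms by (simp add: onorm_scaleR bounded_clinear_imp_bounded_linear)
qed

instance
proof
  fix S T U :: "'a \<Rightarrow>\<^sub>C\<^sub>L 'b" and r s :: real and c d :: complex
  show "dist S T = norm (S - T)" by (rule dist_cblinfun_def)
  show "sgn S = inverse (norm S) *\<^sub>R S" by (rule sgn_cblinfun_def)
  show "(uniformity :: (('a \<Rightarrow>\<^sub>C\<^sub>L 'b) \<times> ('a \<Rightarrow>\<^sub>C\<^sub>L 'b)) filter) = (INF e\<in>{0<..}. principal {(S, T). dist S T < e})"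
    by (rule uniformity_cblinfun_def)
  show "open V \<longleftrightarrow> (\<forall>S\<in>V. \<forall>\<^sub>F (S', T) in uniformity. S' = S \<longrightarrow> T \<in> V)"
    for V :: "('a \<Rightarrow>\<^sub>C\<^sub>L 'b) set"
    by (rule open_cblinfun_def)
  show "norm (S + T) \<le> norm S + norm T"
    by transfer (simp add: onorm_triangle bounded_clinear_imp_bounded_linear)
  show "norm S = 0 \<longleftrightarrow> S = 0"
    by transfer (simp add: onorm_eq_0 bounded_clinear_imp_bounded_linear fun_eq_iff)
  show "norm (r *\<^sub>R S) = \<bar>r\<bar> * norm S"
    by transfer (simp add: onorm_scaleR bounded_clinear_imp_bounded_linear)
  show "norm (c *\<^sub>C S) = norm c * norm S"
    by transfer (rule onorm_scaleC)
qed (transfer; simp add: algebra_simps scaleC_add_right scaleC_add_left scaleC_scaleC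
      scaleC_one scaleR_scaleC[symmetric]; simp add: scaleR_scaleC)+

end

lemma norm_cblinfun_apply_le:
  fixes T :: "'a::complex_normed_vector \<Rightarrow>\<^sub>C\<^sub>L 'b::complex_normed_vector"
  shows "norm (T x) \<le> norm T * norm x"
  by transfer (simp add: onorm bounded_clinear_imp_bounded_linear)

lemma norm_cblinfun_le:
  fixes T :: "'a::complex_normed_vector \<Rightarrow>\<^sub>C\<^sub>L 'b::complex_normed_vector"
  assumes "0 \<le> C" and "\<And>x. norm (T x) \<le> C * norm x"
  shows "norm T \<le> C"
  using assms by transfer (simp add: onorm_bound)

lift_definition cblinfun_compose ::
    "'b::complex_normed_vector \<Rightarrow>\<^sub>C\<^sub>L 'c::complex_normed_vector \<Rightarrow>
      'a::complex_normed_vector \<Rightarrow>\<^sub>C\<^sub>L 'b \<Rightarrow> 'a \<Rightarrow>\<^sub>C\<^sub>L 'c"  (infixl "o\<^sub>C\<^sub>L" 55)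
  is "\<lambda>S T x. S (T x)" by (rule bounded_clinear_compose)

lemma bounded_clinear_intro:
  assumes "\<And>x y. T (x + y) = T x + T y" and "\<And>c x. T (c *\<^sub>C x) = c *\<^sub>C T x"
    and "\<And>x. norm (T x) \<le> norm x * K"
  shows "bounded_clinear T"
  unfolding bounded_clinear_def
proof (intro conjI allI)
  show "bounded_linear T"
    by (rule bounded_linear_intro[where K = K]) (simp_all only: assms scaleR_scaleC)
qed (rule assms)

lift_definition cadjoint ::
    "'a::complex_normed_vector \<Rightarrow>\<^sub>C\<^sub>L 'b::complex_normed_vector \<Rightarrow> 'b cdual \<Rightarrow>\<^sub>C\<^sub>L 'a cdual"
  is "\<lambda>T \<phi>. \<phi> o\<^sub>C\<^sub>L T"
proof (rule bounded_clinear_intro)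
  fix T :: "'a \<Rightarrow>\<^sub>C\<^sub>L 'b" and \<phi> \<psi> :: "'b cdual" and c
  show "(\<phi> + \<psi>) o\<^sub>C\<^sub>L T = (\<phi> o\<^sub>C\<^sub>L T) + (\<psi> o\<^sub>C\<^sub>L T)" by transfer simp
  show "(c *\<^sub>C \<phi>) o\<^sub>C\<^sub>L T = c *\<^sub>C (\<phi> o\<^sub>C\<^sub>L T)" by transfer simp
  show "norm (\<phi> o\<^sub>C\<^sub>L T) \<le> norm \<phi> * norm T"
    by transfer (rule onorm_compose[unfolded o_def]; rule bounded_clinear_imp_bounded_linear)
qed


section \<open>Holomorphic Lipschitz maps on the unit ball\<close>

text \<open>Holomorphy between complex normed spaces is complex Frechet differentiability at every
  point; the derivative \<open>D\<close> must be complex-linear.\<close>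

definition cholomorphic_on ::
    "('a::complex_normed_vector \<Rightarrow> 'b::complex_normed_vector) \<Rightarrow> 'a set \<Rightarrow> bool"
  where "cholomorphic_on f U \<longleftrightarrow>
    (\<forall>x\<in>U. \<exists>D. bounded_clinear D \<and> (f has_derivative D) (at x))"

text \<open>A map on the open unit ball is represented by its extension by 0 to the whole space.\<close>

definition hol_lip0 :: "('a::complex_normed_vector \<Rightarrow> 'b::complex_normed_vector) set"
  where "hol_lip0 = {f. cholomorphic_on f (ball 0 1) \<and> (\<exists>C. C-lipschitz_on (ball 0 1) f) \<and>
    f 0 = 0 \<and> (\<forall>x. x \<notin> ball 0 1 \<longrightarrow> f x = 0)}"

text \<open>The pairs with \<open>x = y\<close> contribute \<open>0 / 0 = 0\<close>; they only serve to make the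
  supremum 0 when the domain is the zero space.\<close>

definition Lip :: "('a::complex_normed_vector \<Rightarrow> 'b::complex_normed_vector) \<Rightarrow> real"
  where "Lip f = (SUP (x, y)\<in>ball 0 1 \<times> ball 0 1. norm (f x - f y) / norm (x - y))"

lemma cholomorphic_on_zero: "cholomorphic_on (\<lambda>x. 0) U"
  unfolding cholomorphic_on_def by (blast intro: bounded_clinear_zero has_derivative_const)

lemma cholomorphic_on_add:
  "cholomorphic_on f U \<Longrightarrow> cholomorphic_on g U \<Longrightarrow> cholomorphic_on (\<lambda>x. f x + g x) U"
  unfolding cholomorphic_on_def by (blast intro: bounded_clinear_add has_derivative_add)

lemma cholomorphic_on_compose:
  "bounded_clinear T \<Longrightarrow> cholomorphic_on f U \<Longrightarrow> cholomorphic_on (\<lambda>x. T (f x)) U"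
  unfolding cholomorphic_on_def
  by (blast intro: bounded_clinear_compose
      bounded_linear.has_derivative[OF bounded_clinear_imp_bounded_linear])

lemma Lip_bdd_above:
  fixes f :: "'a::complex_normed_vector \<Rightarrow> 'b::complex_normed_vector"
  assumes "C-lipschitz_on (ball 0 1) f"
  shows "bdd_above ((\<lambda>(x, y). norm (f x - f y) / norm (x - y)) ` (ball 0 1 \<times> ball 0 1))"
proof (rule bdd_aboveI2[where M = C], clarify)
  fix x y :: 'a
  assume "x \<in> ball 0 1" "y \<in> ball 0 1"
  then have "norm (f x - f y) \<le> C * norm (x - y)"
    using lipschitz_on_normD[OF assms] by blast
  then show "norm (f x - f y) / norm (x - y) \<le> C"
    using lipschitz_on_nonneg[OF assms]
    by (cases "x = y") (simp_all add: divide_le_eq)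
qed

lemma Lip_bound:
  fixes f :: "'a::complex_normed_vector \<Rightarrow> 'b::complex_normed_vector"
  assumes "f \<in> hol_lip0" "x \<in> ball 0 1" "y \<in> ball 0 1"
  shows "norm (f x - f y) \<le> Lip f * norm (x - y)"
proof -
  obtain C where C: "C-lipschitz_on (ball 0 1) f"
    using assms(1) by (auto simp: hol_lip0_def)
  have "norm (f x - f y) / norm (x - y) \<le> Lip f"
    unfolding Lip_def using cSUP_upper[OF _ Lip_bdd_above[OF C], of "(x, y)"] assms(2,3) by simp
  then show ?thesis
    by (cases "x = y") (simp_all add: divide_le_eq)
qed

lemma Lip_le:
  fixes f :: "'a::complex_normed_vector \<Rightarrow> 'b::complex_normed_vector"
  assumes "0 \<le> C"
    and "\<And>x y. x \<in> ball 0 1 \<Longrightarrow> y \<in> ball 0 1 \<Longrightarrow> norm (f x - f y) \<le> C * norm (x - y)"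
  shows "Lip f \<le> C"
  unfolding Lip_def
proof (rule cSUP_least)
  show "ball 0 1 \<times> ball 0 1 \<noteq> ({} :: ('a \<times> 'a) set)" by auto
  fix z :: "'a \<times> 'a"
  assume "z \<in> ball 0 1 \<times> ball 0 1"
  then show "(case z of (x, y) \<Rightarrow> norm (f x - f y) / norm (x - y)) \<le> C"
    using assms by (cases z, cases "fst z = snd z") (auto simp: divide_le_eq)
qed

lemma Lip_nonneg:
  fixes f :: "'a::complex_normed_vector \<Rightarrow> 'b::complex_normed_vector"
  assumes "f \<in> hol_lip0"
  shows "0 \<le> Lip f"
proof -
  obtain C where C: "C-lipschitz_on (ball 0 1) f"
    using assms by (auto simp: hol_lip0_def)
  show ?thesis
    unfolding Lip_def
    using cSUP_upper[OF _ Lip_bdd_above[OF C], of "(0, 0)"] by simp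
qed

lemma hol_lip0_zero: "(\<lambda>x. 0) \<in> hol_lip0"
  by (auto simp: hol_lip0_def cholomorphic_on_zero intro: lipschitz_on_constant)

lemma hol_lip0_add: "f \<in> hol_lip0 \<Longrightarrow> g \<in> hol_lip0 \<Longrightarrow> (\<lambda>x. f x + g x) \<in> hol_lip0"
  by (auto simp: hol_lip0_def cholomorphic_on_add intro: lipschitz_on_add)

lemma hol_lip0_compose:
  assumes "bounded_clinear T" "f \<in> hol_lip0"
  shows "(\<lambda>x. T (f x)) \<in> hol_lip0"
proof -
  interpret bounded_linear T by (rule bounded_clinear_imp_bounded_linear[OF assms(1)])
  obtain C where "C-lipschitz_on (ball 0 1) f"
    using assms(2) by (auto simp: hol_lip0_def)
  moreover obtain K where "K-lipschitz_on (f ` ball 0 1) T"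
    using lipschitz_boundE[of "f ` ball 0 1"] by blast
  ultimately have "(K * C)-lipschitz_on (ball 0 1) (\<lambda>x. T (f x))"
    using lipschitz_on_compose2[of C "ball 0 1" f K T] by simp
  then show ?thesis
    using assms by (auto simp: hol_lip0_def zero intro: cholomorphic_on_compose)
qed

lemma bounded_clinear_scaleC_right: "bounded_clinear ((*\<^sub>C) c)"
  by (simp add: bounded_clinear_def bounded_linear_scaleC_right complex_vector.scale_left_commute)

lemma hol_lip0_scaleC: "f \<in> hol_lip0 \<Longrightarrow> (\<lambda>x. c *\<^sub>C f x) \<in> hol_lip0"
  by (rule hol_lip0_compose[OF bounded_clinear_scaleC_right])

lemma hol_lip0_scaleR: "f \<in> hol_lip0 \<Longrightarrow> (\<lambda>x. r *\<^sub>R f x) \<in> hol_lip0"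
  by (simp add: scaleR_scaleC hol_lip0_scaleC)

lemma hol_lip0_uminus: "f \<in> hol_lip0 \<Longrightarrow> (\<lambda>x. - f x) \<in> hol_lip0"
  using hol_lip0_scaleR[of f "-1"] by simp

lemma hol_lip0_diff: "f \<in> hol_lip0 \<Longrightarrow> g \<in> hol_lip0 \<Longrightarrow> (\<lambda>x. f x - g x) \<in> hol_lip0"
  using hol_lip0_add[of f "\<lambda>x. - g x"] by (simp add: hol_lip0_uminus)

lemma Lip_add:
  fixes f g :: "'a::complex_normed_vector \<Rightarrow> 'b::complex_normed_vector"
  assumes "f \<in> hol_lip0" "g \<in> hol_lip0"
  shows "Lip (\<lambda>x. f x + g x) \<le> Lip f + Lip g"
proof (rule Lip_le)
  show "0 \<le> Lip f + Lip g" using assms by (simp add: Lip_nonneg)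
  fix x y :: 'a assume xy: "x \<in> ball 0 1" "y \<in> ball 0 1"
  have "norm (f x + g x - (f y + g y)) \<le> norm (f x - f y) + norm (g x - g y)"
    using norm_triangle_ineq[of "f x - f y" "g x - g y"] by (simp add: algebra_simps)
  also have "\<dots> \<le> Lip f * norm (x - y) + Lip g * norm (x - y)"
    using xy assms by (intro add_mono Lip_bound)
  finally show "norm (f x + g x - (f y + g y)) \<le> (Lip f + Lip g) * norm (x - y)"
    by (simp add: algebra_simps)
qed

lemma Lip_scaleC_le:
  fixes f :: "'a::complex_normed_vector \<Rightarrow> 'b::complex_normed_vector"
  assumes "f \<in> hol_lip0"
  shows "Lip (\<lambda>x. c *\<^sub>C f x) \<le> norm c * Lip f"
proof (rule Lip_le)
  show "0 \<le> norm c * Lip f" using assms by (simp add: Lip_nonneg)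
  fix x y :: 'a assume xy: "x \<in> ball 0 1" "y \<in> ball 0 1"
  have "norm (c *\<^sub>C f x - c *\<^sub>C f y) = norm c * norm (f x - f y)"
    by (metis complex_vector.scale_right_diff_distrib norm_scaleC)
  then show "norm (c *\<^sub>C f x - c *\<^sub>C f y) \<le> norm c * Lip f * norm (x - y)"
    using Lip_bound[OF assms xy] by (simp add: mult.assoc mult_left_mono)
qed

lemma Lip_scaleC:
  assumes "f \<in> hol_lip0"
  shows "Lip (\<lambda>x. c *\<^sub>C f x) = norm c * Lip f"
proof (cases "c = 0")
  case True
  with Lip_scaleC_le[OF assms, of 0] Lip_nonneg[OF hol_lip0_scaleC[OF assms, of 0]]
  show ?thesis by simp
next
  case False
  then have "(\<lambda>x. inverse c *\<^sub>C c *\<^sub>C f x) = f"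
    by (simp add: fun_eq_iff)
  then have "Lip f \<le> norm (inverse c) * Lip (\<lambda>x. c *\<^sub>C f x)"
    using Lip_scaleC_le[OF hol_lip0_scaleC[OF assms], of "inverse c"] by metis
  then have "norm c * Lip f \<le> Lip (\<lambda>x. c *\<^sub>C f x)"
    using False by (simp add: norm_divide field_simps)
  with Lip_scaleC_le[OF assms] show ?thesis by (simp add: antisym)
qed

lemma Lip_eq_0:
  assumes "f \<in> hol_lip0"
  shows "Lip f = 0 \<longleftrightarrow> f = (\<lambda>x. 0)"
proof
  assume "Lip f = 0"
  then have "f x = f 0" if "x \<in> ball 0 1" for x
    using Lip_bound[OF assms that, of 0] by simp
  moreover have "f 0 = 0" "f x = 0" if "x \<notin> ball 0 1" for x
    using assms that unfolding hol_lip0_def by blast+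
  ultimately show "f = (\<lambda>x. 0)"
    using assms unfolding hol_lip0_def by (metis (mono_tags, lifting) mem_Collect_eq)
next
  assume "f = (\<lambda>x. 0)"
  then show "Lip f = 0"
    using Lip_scaleC[OF hol_lip0_zero, of 0] by simp
qed

typedef (overloaded) ('a, 'b) HL0
    = "hol_lip0 :: ('a::complex_normed_vector \<Rightarrow> 'b::complex_normed_vector) set"
  morphisms HL0_apply Abs_HL0
  by (blast intro: hol_lip0_zero)

setup_lifting type_definition_HL0

declare [[coercion "HL0_apply :: ('a::complex_normed_vector, 'b::complex_normed_vector) HL0 \<Rightarrow> 'a \<Rightarrow> 'b"]]

instantiation HL0 :: (complex_normed_vector, complex_normed_vector) complex_normed_vector
begin

lift_definition norm_HL0 :: "('a, 'b) HL0 \<Rightarrow> real" is Lip .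

lift_definition zero_HL0 :: "('a, 'b) HL0" is "\<lambda>x. 0"
  by (rule hol_lip0_zero)

lift_definition plus_HL0 :: "('a, 'b) HL0 \<Rightarrow> ('a, 'b) HL0 \<Rightarrow> ('a, 'b) HL0"
  is "\<lambda>f g x. f x + g x" by (rule hol_lip0_add)

lift_definition uminus_HL0 :: "('a, 'b) HL0 \<Rightarrow> ('a, 'b) HL0"
  is "\<lambda>f x. - f x" by (rule hol_lip0_uminus)

lift_definition minus_HL0 :: "('a, 'b) HL0 \<Rightarrow> ('a, 'b) HL0 \<Rightarrow> ('a, 'b) HL0"
  is "\<lambda>f g x. f x - g x" by (rule hol_lip0_diff)

lift_definition scaleC_HL0 :: "complex \<Rightarrow> ('a, 'b) HL0 \<Rightarrow> ('a, 'b) HL0"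
  is "\<lambda>c f x. c *\<^sub>C f x" by (rule hol_lip0_scaleC)

lift_definition scaleR_HL0 :: "real \<Rightarrow> ('a, 'b) HL0 \<Rightarrow> ('a, 'b) HL0"
  is "\<lambda>r f x. r *\<^sub>R f x" by (rule hol_lip0_scaleR)

definition sgn_HL0 :: "('a, 'b) HL0 \<Rightarrow> ('a, 'b) HL0"
  where "sgn_HL0 f = inverse (norm f) *\<^sub>R f"

definition dist_HL0 :: "('a, 'b) HL0 \<Rightarrow> ('a, 'b) HL0 \<Rightarrow> real"
  where "dist_HL0 f g = norm (f - g)"

definition uniformity_HL0 :: "(('a, 'b) HL0 \<times> ('a, 'b) HL0) filter"
  where [code del]: "uniformity_HL0 = (INF e\<in>{0<..}. principal {(f, g). dist f g < e})"

definition open_HL0 :: "('a, 'b) HL0 set \<Rightarrow> bool"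
  where [code del]: "open_HL0 U \<longleftrightarrow> (\<forall>f\<in>U. \<forall>\<^sub>F (f', g) in uniformity. f' = f \<longrightarrow> g \<in> U)"

instance
proof
  fix f g h :: "('a, 'b) HL0" and r s :: real and c d :: complex
  show "dist f g = norm (f - g)" by (rule dist_HL0_def)
  show "sgn f = inverse (norm f) *\<^sub>R f" by (rule sgn_HL0_def)
  show "(uniformity :: (('a, 'b) HL0 \<times> ('a, 'b) HL0) filter) = (INF e\<in>{0<..}. principal {(f, g). dist f g < e})"
    by (rule uniformity_HL0_def)
  show "open V \<longleftrightarrow> (\<forall>f\<in>V. \<forall>\<^sub>F (f', g) in uniformity. f' = f \<longrightarrow> g \<in> V)"
    for V :: "('a, 'b) HL0 set"
    by (rule open_HL0_def)
  show "norm (f + g) \<le> norm f + norm g"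
    by transfer (rule Lip_add)
  show "norm f = 0 \<longleftrightarrow> f = 0"
    by transfer (rule Lip_eq_0)
  show "norm (r *\<^sub>R f) = \<bar>r\<bar> * norm f"
    by transfer (simp add: scaleR_scaleC Lip_scaleC)
  show "norm (c *\<^sub>C f) = norm c * norm f"
    by transfer (rule Lip_scaleC)
qed (transfer; simp add: algebra_simps scaleC_add_right scaleC_add_left scaleC_scaleC
      scaleC_one scaleR_scaleC[symmetric]; simp add: scaleR_scaleC)+

end

definition Lip_image :: "('a::complex_normed_vector, 'b::complex_normed_vector) HL0 \<Rightarrow> 'b set"
  where "Lip_image f =
    {(f x - f y) /\<^sub>R norm (x - y) | x y. x \<in> ball 0 1 \<and> y \<in> ball 0 1 \<and> x \<noteq> y}"

lift_definition HL0_compose ::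
    "'b::complex_normed_vector \<Rightarrow>\<^sub>C\<^sub>L 'c::complex_normed_vector \<Rightarrow>
      ('a::complex_normed_vector, 'b) HL0 \<Rightarrow> ('a, 'c) HL0"
  is "\<lambda>T f x. T (f x)" by (rule hol_lip0_compose)

lift_definition HL0_transpose ::
    "('a::complex_normed_vector, 'b::complex_normed_vector) HL0 \<Rightarrow> 'b cdual \<Rightarrow>\<^sub>C\<^sub>L ('a, complex) HL0"
  is "\<lambda>f \<phi>. HL0_compose \<phi> f"
proof (rule bounded_clinear_intro)
  fix f :: "('a, 'b) HL0" and \<phi> \<psi> :: "'b cdual" and c
  show "HL0_compose (\<phi> + \<psi>) f = HL0_compose \<phi> f + HL0_compose \<psi> f" by transfer simp
  show "HL0_compose (c *\<^sub>C \<phi>) f = c *\<^sub>C HL0_compose \<phi> f" by transfer simp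
  show "norm (HL0_compose \<phi> f) \<le> norm \<phi> * norm f"
  proof (transfer, rule Lip_le)
    fix \<phi> :: "'b \<Rightarrow> complex" and f :: "'a \<Rightarrow> 'b"
    assume \<phi>: "bounded_clinear \<phi>" and f: "f \<in> hol_lip0"
    interpret bounded_linear \<phi> by (rule bounded_clinear_imp_bounded_linear[OF \<phi>])
    have nn: "0 \<le> onorm \<phi>" by (rule onorm_pos_le) (rule bounded_linear_axioms)
    then show "0 \<le> onorm \<phi> * Lip f" by (simp add: Lip_nonneg f)
    fix x y :: 'a assume xy: "x \<in> ball 0 1" "y \<in> ball 0 1"
    have "norm (\<phi> (f x) - \<phi> (f y)) \<le> onorm \<phi> * norm (f x - f y)"
      using onorm[OF bounded_linear_axioms, of "f x - f y"] by (simp add: diff)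
    also have "\<dots> \<le> onorm \<phi> * (Lip f * norm (x - y))"
      by (intro mult_left_mono Lip_bound f xy nn)
    finally show "norm (\<phi> (f x) - \<phi> (f y)) \<le> onorm \<phi> * Lip f * norm (x - y)"
      by (simp add: mult.assoc)
  qed
qed


section \<open>The predual \<open>G0\<close> and linearization\<close>

text \<open>Off the open unit ball \<open>eval x\<close> is the zero functional, by the convention
  on \<^const>\<open>hol_lip0\<close>.\<close>

lift_definition eval :: "'a::complex_normed_vector \<Rightarrow> ('a, complex) HL0 cdual"
  is "\<lambda>x g. HL0_apply g x"
proof (rule bounded_clinear_intro)
  fix x :: 'a and g h :: "('a, complex) HL0" and c
  show "HL0_apply (g + h) x = HL0_apply g x + HL0_apply h x" by transfer simp
  show "HL0_apply (c *\<^sub>C g) x = c *\<^sub>C HL0_apply g x" by transfer simp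
  show "norm (HL0_apply g x) \<le> norm g * norm x"
  proof (transfer fixing: x)
    fix g :: "'a \<Rightarrow> complex" assume g: "g \<in> hol_lip0"
    show "norm (g x) \<le> Lip g * norm x"
    proof (cases "x \<in> ball 0 1")
      case True
      then show ?thesis
        using Lip_bound[OF g, of x 0] g by (simp add: hol_lip0_def)
    next
      case False
      then show ?thesis
        using g Lip_nonneg[OF g] by (auto simp: hol_lip0_def)
    qed
  qed
qed

definition G0_space :: "('a::complex_normed_vector, complex) HL0 cdual set"
  where "G0_space = closure (complex_vector.span (eval ` ball 0 1))"

lemma G0_space_zero: "0 \<in> G0_space"
  unfolding G0_space_def using closure_subset complex_vector.span_zero by blast

lemma G0_space_add:
  assumes "u \<in> G0_space" "v \<in> G0_space"
  shows "u + v \<in> G0_space"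
proof -
  obtain a b where ab: "\<And>n. a n \<in> complex_vector.span (eval ` ball 0 1)" "a \<longlonglongrightarrow> u"
      "\<And>n. b n \<in> complex_vector.span (eval ` ball 0 1)" "b \<longlonglongrightarrow> v"
    using assms unfolding G0_space_def closure_sequential by blast
  then have "(\<lambda>n. a n + b n) \<longlonglongrightarrow> u + v"
    by (intro tendsto_add)
  moreover have "a n + b n \<in> complex_vector.span (eval ` ball 0 1)" for n
    using ab by (simp add: complex_vector.span_add)
  ultimately show ?thesis
    unfolding G0_space_def closure_sequential by (intro exI[of _ "\<lambda>n. a n + b n"] conjI allI)
qed

lemma G0_space_scaleC:
  assumes "u \<in> G0_space"
  shows "c *\<^sub>C u \<in> G0_space"
proof -
  obtain a where a: "\<And>n. a n \<in> complex_vector.span (eval ` ball 0 1)" "a \<longlonglongrightarrow> u"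
    using assms unfolding G0_space_def closure_sequential by blast
  then have "(\<lambda>n. c *\<^sub>C a n) \<longlonglongrightarrow> c *\<^sub>C u"
    by (intro bounded_linear.tendsto[OF bounded_linear_scaleC_right])
  moreover have "c *\<^sub>C a n \<in> complex_vector.span (eval ` ball 0 1)" for n
    using a by (simp add: complex_vector.span_scale)
  ultimately show ?thesis
    unfolding G0_space_def closure_sequential by (intro exI[of _ "\<lambda>n. c *\<^sub>C a n"] conjI allI)
qed

lemma G0_space_scaleR: "u \<in> G0_space \<Longrightarrow> r *\<^sub>R u \<in> G0_space"
  by (simp add: scaleR_scaleC G0_space_scaleC)

lemma G0_space_uminus: "u \<in> G0_space \<Longrightarrow> - u \<in> G0_space"
  using G0_space_scaleR[of u "-1"] by simp

lemma G0_space_diff: "u \<in> G0_space \<Longrightarrow> v \<in> G0_space \<Longrightarrow> u - v \<in> G0_space"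
  using G0_space_add[of u "- v"] by (simp add: G0_space_uminus)

lemma HL0_apply_outside: "x \<notin> ball 0 1 \<Longrightarrow> HL0_apply g x = 0"
  using HL0_apply[of g] unfolding hol_lip0_def by blast

lemma eval_in_G0_space: "eval x \<in> G0_space"
proof (cases "x \<in> ball 0 1")
  case True
  then show ?thesis
    unfolding G0_space_def by (meson closure_subset complex_vector.span_base imageI subsetD)
next
  case False
  then have "eval x = 0"
    by transfer (simp add: HL0_apply_outside)
  then show ?thesis by (simp add: G0_space_zero)
qed

typedef (overloaded) 'a G0
    = "G0_space :: ('a::complex_normed_vector, complex) HL0 cdual set"
  by (blast intro: G0_space_zero)

setup_lifting type_definition_G0

instantiation G0 :: (complex_normed_vector) complex_normed_vector
begin

lift_definition norm_G0 :: "'a G0 \<Rightarrow> real" is norm .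

lift_definition zero_G0 :: "'a G0" is 0 by (rule G0_space_zero)

lift_definition plus_G0 :: "'a G0 \<Rightarrow> 'a G0 \<Rightarrow> 'a G0" is "(+)" by (rule G0_space_add)

lift_definition uminus_G0 :: "'a G0 \<Rightarrow> 'a G0" is uminus by (rule G0_space_uminus)

lift_definition minus_G0 :: "'a G0 \<Rightarrow> 'a G0 \<Rightarrow> 'a G0" is "(-)" by (rule G0_space_diff)

lift_definition scaleC_G0 :: "complex \<Rightarrow> 'a G0 \<Rightarrow> 'a G0" is "(*\<^sub>C)" by (rule G0_space_scaleC)

lift_definition scaleR_G0 :: "real \<Rightarrow> 'a G0 \<Rightarrow> 'a G0" is "(*\<^sub>R)" by (rule G0_space_scaleR)

definition sgn_G0 :: "'a G0 \<Rightarrow> 'a G0"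
  where "sgn_G0 u = inverse (norm u) *\<^sub>R u"

definition dist_G0 :: "'a G0 \<Rightarrow> 'a G0 \<Rightarrow> real"
  where "dist_G0 u v = norm (u - v)"

definition uniformity_G0 :: "('a G0 \<times> 'a G0) filter"
  where [code del]: "uniformity_G0 = (INF e\<in>{0<..}. principal {(u, v). dist u v < e})"

definition open_G0 :: "'a G0 set \<Rightarrow> bool"
  where [code del]: "open_G0 U \<longleftrightarrow> (\<forall>u\<in>U. \<forall>\<^sub>F (u', v) in uniformity. u' = u \<longrightarrow> v \<in> U)"

instance
proof
  fix u v w :: "'a G0" and r s :: real and c d :: complex
  show "dist u v = norm (u - v)" by (rule dist_G0_def)
  show "sgn u = inverse (norm u) *\<^sub>R u" by (rule sgn_G0_def)
  show "(uniformity :: ('a G0 \<times> 'a G0) filter) = (INF e\<in>{0<..}. principal {(u, v). dist u v < e})"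
    by (rule uniformity_G0_def)
  show "open V \<longleftrightarrow> (\<forall>u\<in>V. \<forall>\<^sub>F (u', v) in uniformity. u' = u \<longrightarrow> v \<in> V)" for V :: "'a G0 set"
    by (rule open_G0_def)
  show "norm (u + v) \<le> norm u + norm v"
    by transfer (rule norm_triangle_ineq)
  show "norm (c *\<^sub>C u) = norm c * norm u"
    by transfer (rule norm_scaleC)
  show "norm (r *\<^sub>R u) = \<bar>r\<bar> * norm u"
    by transfer (rule norm_scaleR)
  show "norm u = 0 \<longleftrightarrow> u = 0"
    by transfer (rule norm_eq_zero)
  show "c *\<^sub>C (u + v) = c *\<^sub>C u + c *\<^sub>C v"
    by transfer (rule scaleC_add_right)
  show "(c + d) *\<^sub>C u = c *\<^sub>C u + d *\<^sub>C u"
    by transfer (rule scaleC_add_left)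
  show "c *\<^sub>C d *\<^sub>C u = (c * d) *\<^sub>C u"
    by transfer (rule scaleC_scaleC)
  show "1 *\<^sub>C u = u"
    by transfer (rule scaleC_one)
  show "r *\<^sub>R u = complex_of_real r *\<^sub>C u"
    by transfer (rule scaleR_scaleC)
  show "u + v + w = u + (v + w)"
    by transfer (rule add.assoc)
  show "u + v = v + u"
    by transfer (rule add.commute)
  show "0 + u = u"
    by transfer (rule add_0_left)
  show "- u + u = 0"
    by transfer (rule left_minus)
  show "u - v = u + - v"
    by transfer (rule diff_conv_add_uminus)
  show "r *\<^sub>R (u + v) = r *\<^sub>R u + r *\<^sub>R v"
    by transfer (rule scaleR_add_right)
  show "(r + s) *\<^sub>R u = r *\<^sub>R u + s *\<^sub>R u"
    by transfer (rule scaleR_add_left)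
  show "r *\<^sub>R s *\<^sub>R u = (r * s) *\<^sub>R u"
    by transfer (rule scaleR_scaleR)
  show "1 *\<^sub>R u = u"
    by transfer (rule scaleR_one)
qed

end

lift_definition \<delta> :: "'a::complex_normed_vector \<Rightarrow> 'a G0" is eval
  by (rule eval_in_G0_space)

definition linearization ::
    "('a::complex_normed_vector, 'b::complex_normed_vector) HL0 \<Rightarrow> 'a G0 \<Rightarrow>\<^sub>C\<^sub>L 'b"
  where "linearization f = (THE T :: 'a G0 \<Rightarrow>\<^sub>C\<^sub>L 'b. \<forall>x\<in>ball 0 1. T (\<delta> x) = f x)"


section \<open>Relatively p-compact sets, p-compact and quasi p-nuclear operators\<close>

definition lp_seq :: "real \<Rightarrow> (nat \<Rightarrow> 'a::real_normed_vector) set"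
  where "lp_seq p = {y. summable (\<lambda>n. norm (y n) powr p)}"

definition lp_norm :: "real \<Rightarrow> (nat \<Rightarrow> 'a::real_normed_vector) \<Rightarrow> real"
  where "lp_norm p y = (\<Sum>n. norm (y n) powr p) powr (1 / p)"

text \<open>The closed unit ball of \<open>\<ell>\<^sub>q\<close> with \<open>1/p + 1/q = 1\<close>, that is \<open>q = p / (p - 1)\<close>;
  for \<open>p = 1\<close> the closed unit ball of \<open>c\<^sub>0\<close>.\<close>

definition conjugate_ball :: "real \<Rightarrow> (nat \<Rightarrow> complex) set"
  where "conjugate_ball p =
    (if p = 1 then {a. a \<longlonglongrightarrow> 0 \<and> (\<forall>n. norm (a n) \<le> 1)}
     else {a \<in> lp_seq (p / (p - 1)). lp_norm (p / (p - 1)) a \<le> 1})"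

definition p_hull :: "real \<Rightarrow> (nat \<Rightarrow> 'a::cbanach) \<Rightarrow> 'a set"
  where "p_hull p y = {\<Sum>n. a n *\<^sub>C y n | a. a \<in> conjugate_ball p}"

definition rel_p_compact :: "real \<Rightarrow> 'a::cbanach set \<Rightarrow> bool"
  where "rel_p_compact p K \<longleftrightarrow> (\<exists>y\<in>lp_seq p. K \<subseteq> p_hull p y)"

definition m_p :: "real \<Rightarrow> 'a::cbanach set \<Rightarrow> real"
  where "m_p p K = Inf {lp_norm p y | y. y \<in> lp_seq p \<and> K \<subseteq> p_hull p y}"

definition p_compact_op :: "real \<Rightarrow> ('a::complex_normed_vector \<Rightarrow>\<^sub>C\<^sub>L 'b::cbanach) set"
  where "p_compact_op p = {T :: 'a \<Rightarrow>\<^sub>C\<^sub>L 'b. rel_p_compact p (T ` cball 0 1)}"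

definition p_compact_op_norm :: "real \<Rightarrow> ('a::complex_normed_vector \<Rightarrow>\<^sub>C\<^sub>L 'b::cbanach) \<Rightarrow> real"
  where "p_compact_op_norm p T = m_p p (T ` cball 0 1)"

definition HL0_p_compact :: "real \<Rightarrow> ('a::complex_normed_vector, 'b::cbanach) HL0 set"
  where "HL0_p_compact p = {f. rel_p_compact p (Lip_image f)}"

definition HL0_p_compact_norm :: "real \<Rightarrow> ('a::complex_normed_vector, 'b::cbanach) HL0 \<Rightarrow> real"
  where "HL0_p_compact_norm p f = m_p p (Lip_image f)"

definition QN_dominated ::
    "real \<Rightarrow> ('a::complex_normed_vector \<Rightarrow>\<^sub>C\<^sub>L 'b::complex_normed_vector) \<Rightarrow> (nat \<Rightarrow> 'a cdual) \<Rightarrow> bool"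
  where "QN_dominated p T \<phi> \<longleftrightarrow> \<phi> \<in> lp_seq p \<and> (\<forall>x. norm (T x) \<le> lp_norm p (\<lambda>n. \<phi> n x))"

definition quasi_p_nuclear ::
    "real \<Rightarrow> ('a::complex_normed_vector \<Rightarrow>\<^sub>C\<^sub>L 'b::complex_normed_vector) set"
  where "quasi_p_nuclear p = {T. \<exists>\<phi>. QN_dominated p T \<phi>}"

definition quasi_p_nuclear_norm ::
    "real \<Rightarrow> ('a::complex_normed_vector \<Rightarrow>\<^sub>C\<^sub>L 'b::complex_normed_vector) \<Rightarrow> real"
  where "quasi_p_nuclear_norm p T = Inf {lp_norm p \<phi> | \<phi>. QN_dominated p T \<phi>}"

end

theory Submission
  imports Defs "HOL-Library.Function_Algebras"
begin

text \<open>
  Put \<open>\<parallel>x\<parallel>\<^sub>p\<close> for the \<open>\<ell>\<^sub>p\<close> norm. The four conditions are all statements about one seminorm on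
  the dual of \<open>Y\<close>. If \<open>K\<close> is a subset of \<open>Y\<close> and \<open>S\<close> an operator on \<open>Y\<^sup>*\<close> with
  \<open>\<parallel>S \<phi>\<parallel> = sup {|\<phi> k| : k \<in> K}\<close>, then \<open>K\<close> is relatively \<open>p\<close>-compact if and only if \<open>S\<close> is quasi
  \<open>p\<close>-nuclear, and \<open>m\<^sub>p(K)\<close> is the quasi \<open>p\<close>-nuclear norm of \<open>S\<close>: this is
  \<open>p_compact_iff_quasi_p_nuclear\<close>. It is used for \<open>K = Im\<^sub>L(f)\<close> with \<open>S = f\<^sup>t\<close>, and for the image
  \<open>K\<close> of the unit ball under \<open>T\<^sub>f\<close> with \<open>S = T\<^sub>f\<^sup>*\<close>. The two operators \<open>S\<close> are dominated by the
  same sequences, because \<open>T\<^sub>f\<^sup>* \<phi>\<close> is evaluation at \<open>\<phi> \<circ> f\<close> and the normalized differences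
  \<open>(\<delta> x - \<delta> y) / \<parallel>x - y\<parallel>\<close> in the unit ball of \<open>G\<^sub>0\<close> already compute the Lipschitz norm
  (\<open>norm_adjoint_linearization\<close>).

  One half of the equivalence is Hoelder's inequality: if \<open>k = \<Sum> a\<^sub>n y\<^sub>n\<close> with \<open>a\<close> in the unit ball
  of the conjugate space, then \<open>|\<phi> k| \<le> \<parallel>(\<phi> y\<^sub>n)\<parallel>\<^sub>p\<close>. The other half is the heart of the matter. A
  quasi \<open>p\<close>-nuclear bound gives \<open>|\<phi> k| \<le> \<parallel>(z\<^sub>n \<phi>)\<parallel>\<^sub>p\<close> for all \<open>k \<in> K\<close> with functionals \<open>z\<^sub>n\<close> in the
  bidual \<open>Y\<^sup>*\<^sup>*\<close>, whereas \<open>p\<close>-compactness asks for vectors of \<open>Y\<close> itself, and for the equality of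
  norms they must not be larger than the \<open>z\<^sub>n\<close>, up to an arbitrary \<open>\<epsilon>\<close>. The passage from the
  bidual down to \<open>Y\<close> has three ingredients.

  \<^item> The Hahn-Banach theorem on \<open>\<ell>\<^sub>p\<close> turns domination into coefficients:
    \<open>\<phi> k = \<Sum> a\<^sub>n z\<^sub>n(\<phi>)\<close> with \<open>a\<close> in the dual ball (\<open>dominated_coefficients\<close>).
  \<^item> For finitely many points \<open>k\<^sub>j\<close> with such coefficients \<open>A\<^sub>j\<close>, the system
    \<open>k\<^sub>j = \<Sum> A\<^sub>j\<^sub>n y\<^sub>n\<close> can be solved in \<open>Y\<close> up to a small error with
    \<open>\<parallel>y\<parallel>\<^sub>p \<le> \<parallel>z\<parallel>\<^sub>p + \<epsilon>\<close>. The cost of the best approximate solution is a seminorm of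
    \<open>(k\<^sub>j)\<close>, and a norming functional of that seminorm can be evaluated on \<open>z\<close> just as on sequences
    in \<open>Y\<close> (\<open>finite_approximation\<close>).
  \<^item> Up to small errors, finitely many points suffice: a tail of \<open>z\<close> is small, and the first
    coefficients of all points of \<open>K\<close> form a totally bounded set. What remains is dominated by a
    sequence of small norm in the bidual (\<open>domination_step\<close>).

  Iterating the last step with errors \<open>\<epsilon>\<^sub>i\<close> exhausts every \<open>k \<in> K\<close> and bounds \<open>|\<phi> k|\<close> by a sum
  \<open>\<Sum>\<^sub>i \<parallel>(\<phi> (y\<^sub>i\<^sub>n))\<^sub>n\<parallel>\<^sub>p\<close> of seminorms coming from sequences in \<open>Y\<close>. Such a sum is again below a
  single seminorm of this kind, with no loss in the norm, by convexity of \<open>t\<^sup>p\<close>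
  (\<open>combine_lp_seminorms\<close>).
\<close>

section \<open>The Hahn-Banach theorem\<close>

text \<open>
  A linear functional on a subspace is represented by its graph \<open>G\<close> in the product with the reals.
  The value \<open>c\<close> at a new vector \<open>v\<close> must satisfy \<open>r - q (x - v) \<le> c \<le> q (y + v) - s\<close> for all
  \<open>(x, r)\<close> and \<open>(y, s)\<close> in \<open>G\<close>; subadditivity of \<open>q\<close> makes these bounds compatible, and
  homogeneity reduces every multiple \<open>t v\<close> to \<open>t = 1\<close> or \<open>t = - 1\<close>.
\<close>

lemma hahn_banach_one_step:
  fixes q :: "'v::real_vector \<Rightarrow> real"
  assumes q_add: "\<And>x y. x \<in> E \<Longrightarrow> y \<in> E \<Longrightarrow> q (x + y) \<le> q x + q y"
    and q_scale: "\<And>r x. 0 < r \<Longrightarrow> x \<in> E \<Longrightarrow> q (r *\<^sub>R x) = r * q x"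
    and E: "subspace E" and G: "subspace G" "fst ` G \<subseteq> E" "\<And>x r. (x, r) \<in> G \<Longrightarrow> r \<le> q x"
    and "v \<in> E"
  obtains c where "\<And>x r t. (x, r) \<in> G \<Longrightarrow> r + t * c \<le> q (x + t *\<^sub>R v)"
proof -
  have inE: "x \<in> E" if "(x, r) \<in> G" for x r
    using G(2) that by force
  have key: "r - q (x - v) \<le> q (y + v) - s" if "(x, r) \<in> G" "(y, s) \<in> G" for x r y s
  proof -
    have "(x, r) + (y, s) \<in> G"
      using that G(1) subspace_add by blast
    then have "r + s \<le> q ((x - v) + (y + v))"
      using G(3) by simp
    also have "\<dots> \<le> q (x - v) + q (y + v)"
      using that inE E \<open>v \<in> E\<close> by (intro q_add) (auto intro: subspace_add subspace_diff)
    finally show ?thesis by simp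
  qed
  have G0: "(0, 0) \<in> G"
    using subspace_0[OF G(1)] by (simp add: zero_prod_def)
  define L where "L = {r - q (x - v) | x r. (x, r) \<in> G}"
  define c where "c = Sup L"
  have lower: "r - q (x - v) \<le> c" if "(x, r) \<in> G" for x r
    unfolding c_def using that key[OF _ G0] by (intro cSup_upper bdd_aboveI) (auto simp: L_def)
  have upper: "c \<le> q (y + v) - s" if "(y, s) \<in> G" for y s
    unfolding c_def using that key G0 by (intro cSup_least) (auto simp: L_def)
  have "r + t * c \<le> q (x + t *\<^sub>R v)" if xr: "(x, r) \<in> G" for x r t
  proof -
    have scaled: "((1 / s) *\<^sub>R x, r / s) \<in> G" for s
      using subspace_scale[OF G(1) xr, of "1 / s"] by simp
    consider "t = 0" | "t > 0" | "t < 0" by linarith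
    then show ?thesis
    proof cases
      case 1
      then show ?thesis using G(3)[OF xr] by simp
    next
      case 2
      have "t * (r / t + c) \<le> t * q ((1 / t) *\<^sub>R x + v)"
        using upper[OF scaled[of t]] 2 by (intro mult_left_mono) auto
      also have "\<dots> = q (t *\<^sub>R ((1 / t) *\<^sub>R x + v))"
        using 2 inE[OF scaled[of t]] E \<open>v \<in> E\<close> by (intro q_scale[symmetric] subspace_add)
      finally show ?thesis using 2 by (simp add: algebra_simps)
    next
      case 3
      define s where "s = - t"
      have "s > 0" using 3 by (simp add: s_def)
      have "s * (r / s - c) \<le> s * q ((1 / s) *\<^sub>R x - v)"
        using lower[OF scaled[of s]] \<open>s > 0\<close> by (intro mult_left_mono) auto
      also have "\<dots> = q (s *\<^sub>R ((1 / s) *\<^sub>R x - v))"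
        using \<open>s > 0\<close> inE[OF scaled[of s]] E \<open>v \<in> E\<close> by (intro q_scale[symmetric] subspace_diff)
      finally show ?thesis using \<open>s > 0\<close> by (simp add: algebra_simps s_def)
    qed
  qed
  then show thesis by (rule that)
qed

text \<open>
  Working with graphs saves the well-definedness checks: a subspace of \<open>E \<times> \<real>\<close> that lies below \<open>q\<close>
  is automatically the graph of a function, since \<open>(0, r)\<close> and \<open>(0, - r)\<close> in it force \<open>r = 0\<close>. The
  carrier \<open>E\<close> is explicit because \<open>q\<close> will be the \<open>\<ell>\<^sub>p\<close> norm, which is a seminorm only on part of
  the type of all sequences.
\<close>

theorem hahn_banach_real:
  fixes q :: "'v::real_vector \<Rightarrow> real"
  assumes q_add: "\<And>x y. x \<in> E \<Longrightarrow> y \<in> E \<Longrightarrow> q (x + y) \<le> q x + q y"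
    and q_scale: "\<And>r x. 0 < r \<Longrightarrow> x \<in> E \<Longrightarrow> q (r *\<^sub>R x) = r * q x"
    and E: "subspace E" and M: "subspace M" "fst ` M \<subseteq> E" "\<And>x r. (x, r) \<in> M \<Longrightarrow> r \<le> q x"
  obtains g where "\<And>x y. x \<in> E \<Longrightarrow> y \<in> E \<Longrightarrow> g (x + y) = g x + g y"
    "\<And>r x. x \<in> E \<Longrightarrow> g (r *\<^sub>R x) = r * g x"
    "\<And>x r. (x, r) \<in> M \<Longrightarrow> g x = r"
    "\<And>x. x \<in> E \<Longrightarrow> g x \<le> q x"
proof -
  define A where "A = {G. subspace G \<and> fst ` G \<subseteq> E \<and> (\<forall>(x, r)\<in>G. r \<le> q x) \<and> M \<subseteq> G}"
  have "\<exists>G\<in>A. \<forall>H\<in>A. G \<subseteq> H \<longrightarrow> H = G"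
  proof (rule subset_Zorn_nonempty)
    show "A \<noteq> {}" using M by (auto simp: A_def)
    fix C assume C: "C \<noteq> {}" "subset.chain A C"
    have CA: "subspace G" "fst ` G \<subseteq> E" "\<forall>(x, r)\<in>G. r \<le> q x" "M \<subseteq> G" if "G \<in> C" for G
    proof -
      have "G \<in> A" using C(2) that unfolding subset.chain_def by blast
      then show "subspace G" "fst ` G \<subseteq> E" "\<forall>(x, r)\<in>G. r \<le> q x" "M \<subseteq> G"
        unfolding A_def by simp_all
    qed
    have dir: "\<exists>G\<in>C. u \<in> G \<and> v \<in> G" if "u \<in> \<Union>C" "v \<in> \<Union>C" for u v
      using that C(2) unfolding subset.chain_def by blast
    have "subspace (\<Union>C)"
    proof (rule subspaceI)
      show "0 \<in> \<Union>C"
        using C(1) subspace_0[OF CA(1)] by blast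
      show "u + v \<in> \<Union>C" if "u \<in> \<Union>C" "v \<in> \<Union>C" for u v
        using dir[OF that] subspace_add[OF CA(1)] by blast
      show "c *\<^sub>R u \<in> \<Union>C" if "u \<in> \<Union>C" for u c
        using that subspace_scale[OF CA(1)] by blast
    qed
    moreover have "fst ` (\<Union>C) \<subseteq> E"
      using CA(2) by blast
    moreover have "\<forall>(x, r)\<in>\<Union>C. r \<le> q x"
      using CA(3) by blast
    moreover have "M \<subseteq> \<Union>C"
      using C(1) CA(4) by blast
    ultimately show "\<Union>C \<in> A" by (simp add: A_def)
  qed
  then obtain G where "G \<in> A" and maximal: "\<And>H. H \<in> A \<Longrightarrow> G \<subseteq> H \<Longrightarrow> H = G"
    by blast
  then have G: "subspace G" "fst ` G \<subseteq> E" "\<And>x r. (x, r) \<in> G \<Longrightarrow> r \<le> q x" "M \<subseteq> G"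
    by (auto simp: A_def)
  have total: "\<exists>r. (v, r) \<in> G" if "v \<in> E" for v
  proof -
    obtain c where c: "\<And>x r t. (x, r) \<in> G \<Longrightarrow> r + t * c \<le> q (x + t *\<^sub>R v)"
      using hahn_banach_one_step[OF q_add q_scale E G(1-3) \<open>v \<in> E\<close>] by metis
    define H where "H = {u + t *\<^sub>R (v, c) | u t. u \<in> G}"
    have inH: "u + t *\<^sub>R (v, c) \<in> H" if "u \<in> G" for u t
      using that unfolding H_def by blast
    have "subspace H"
    proof (rule subspaceI)
      show "0 \<in> H"
        using inH[OF subspace_0[OF G(1)], of 0] by (simp del: scaleR_Pair)
      show "a + b \<in> H" if ab: "a \<in> H" "b \<in> H" for a b
      proof -
        obtain u t u' t' where "a = u + t *\<^sub>R (v, c)" "b = u' + t' *\<^sub>R (v, c)" "u \<in> G" "u' \<in> G"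
          using ab unfolding H_def by blast
        then have "a + b = (u + u') + (t + t') *\<^sub>R (v, c)" "u + u' \<in> G"
          by (auto simp: algebra_simps subspace_add[OF G(1)] simp del: scaleR_Pair)
        then show ?thesis using inH by metis
      qed
      show "s *\<^sub>R a \<in> H" if a: "a \<in> H" for s a
      proof -
        obtain u t where "a = u + t *\<^sub>R (v, c)" "u \<in> G"
          using a unfolding H_def by blast
        then have "s *\<^sub>R a = s *\<^sub>R u + (s * t) *\<^sub>R (v, c)" "s *\<^sub>R u \<in> G"
          by (auto simp: scaleR_add_right subspace_scale[OF G(1)] simp del: scaleR_Pair)
        then show ?thesis using inH by metis
      qed
    qed
    moreover have "fst ` H \<subseteq> E"
      using G(2) \<open>v \<in> E\<close> E by (force simp: H_def intro: subspace_add subspace_scale)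
    moreover have "\<forall>(x, r)\<in>H. r \<le> q x"
      using c by (auto simp: H_def)
    moreover have "G \<subseteq> H"
      using inH[of _ 0] by (auto simp del: scaleR_Pair)
    ultimately have "H = G"
      using maximal G(4) by (auto simp: A_def)
    moreover have "(v, c) \<in> H"
      using inH[OF subspace_0[OF G(1)], of 1] by simp
    ultimately show ?thesis by blast
  qed
  have zero: "q 0 = 0"
    using q_scale[of 2 0] subspace_0[OF E] by simp
  have unique: "r = s" if "(x, r) \<in> G" "(x, s) \<in> G" for x r s
  proof -
    have "(0, r - s) \<in> G" "(0, s - r) \<in> G"
      using subspace_diff[OF G(1) that] subspace_diff[OF G(1) that(2,1)] by simp_all
    from this[THEN G(3)] show ?thesis using zero by simp
  qed
  define g where "g x = (THE r. (x, r) \<in> G)" for x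
  have g_eq: "g x = r" if "(x, r) \<in> G" for x r
    unfolding g_def by (rule the_equality) (use that unique in blast)+
  have g_in: "(x, g x) \<in> G" if "x \<in> E" for x
    using total[OF that] g_eq by auto
  show thesis
  proof (rule that[of g])
    show "g (x + y) = g x + g y" if "x \<in> E" "y \<in> E" for x y
      using subspace_add[OF G(1) g_in[OF that(1)] g_in[OF that(2)]] by (auto intro: g_eq)
    show "g (r *\<^sub>R x) = r * g x" if "x \<in> E" for r x
      using subspace_scale[OF G(1) g_in[OF that]] by (auto intro: g_eq)
    show "g x = r" if "(x, r) \<in> M" for x r
      using that G(4) by (auto intro: g_eq)
    show "g x \<le> q x" if "x \<in> E" for x
      using G(3) g_in[OF that] .
  qed
qed

text \<open>
  The usual complexification: extend the real part to \<open>h\<close> and put \<open>g x = h x - \<i> h (\<i> x)\<close>. Rotating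
  \<open>x\<close> so that \<open>g x\<close> becomes real turns the one-sided bound on \<open>h\<close> into a bound on \<open>|g|\<close>.
\<close>

theorem hahn_banach_complex:
  fixes q :: "'v::complex_vector \<Rightarrow> real" and f :: "'v \<Rightarrow> complex"
  assumes q_add: "\<And>x y. x \<in> E \<Longrightarrow> y \<in> E \<Longrightarrow> q (x + y) \<le> q x + q y"
    and q_scale: "\<And>c x. x \<in> E \<Longrightarrow> q (c *\<^sub>C x) = norm c * q x"
    and E: "complex_vector.subspace E" and M: "complex_vector.subspace M" "M \<subseteq> E"
    and f_add: "\<And>x y. x \<in> M \<Longrightarrow> y \<in> M \<Longrightarrow> f (x + y) = f x + f y"
    and f_scale: "\<And>c x. x \<in> M \<Longrightarrow> f (c *\<^sub>C x) = c * f x"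
    and f_le: "\<And>x. x \<in> M \<Longrightarrow> norm (f x) \<le> q x"
  obtains g where "\<And>x y. x \<in> E \<Longrightarrow> y \<in> E \<Longrightarrow> g (x + y) = g x + g y"
    "\<And>c x. x \<in> E \<Longrightarrow> g (c *\<^sub>C x) = c * g x"
    "\<And>x. x \<in> M \<Longrightarrow> g x = f x"
    "\<And>x. x \<in> E \<Longrightarrow> norm (g x) \<le> q x"
proof -
  note Es = complex_vector.subspace_0[OF E] complex_vector.subspace_add[OF E]
    complex_vector.subspace_scale[OF E]
  note Ms = complex_vector.subspace_0[OF M(1)] complex_vector.subspace_add[OF M(1)]
    complex_vector.subspace_scale[OF M(1)]
  define G where "G = (\<lambda>x. (x, Re (f x))) ` M"
  have f0: "f 0 = 0"
    using f_scale[of 0 0] Ms(1) by simp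
  have "subspace G"
  proof (rule subspaceI)
    show "0 \<in> G" using f0 Ms(1) by (force simp: G_def zero_prod_def)
    show "u + v \<in> G" if uv: "u \<in> G" "v \<in> G" for u v
    proof -
      obtain x y where xy: "x \<in> M" "y \<in> M" "u = (x, Re (f x))" "v = (y, Re (f y))"
        using uv by (auto simp: G_def)
      then have "u + v = (x + y, Re (f (x + y)))" by (simp add: f_add)
      then show ?thesis using Ms(2)[OF xy(1,2)] unfolding G_def by blast
    qed
    show "r *\<^sub>R u \<in> G" if u: "u \<in> G" for r u
    proof -
      obtain x where x: "x \<in> M" "u = (x, Re (f x))"
        using u by (auto simp: G_def)
      then have "r *\<^sub>R u = (complex_of_real r *\<^sub>C x, Re (f (complex_of_real r *\<^sub>C x)))"
        by (simp add: f_scale scaleR_scaleC)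
      then show ?thesis using Ms(3)[OF x(1)] unfolding G_def by blast
    qed
  qed
  moreover have "subspace E"
    by (rule subspaceI) (use Es in \<open>simp_all add: scaleR_scaleC\<close>)
  moreover have "q (r *\<^sub>R x) = r * q x" if "0 < r" "x \<in> E" for r x
    using q_scale[OF that(2), of "complex_of_real r"] that(1) by (simp add: scaleR_scaleC)
  moreover have "fst ` G \<subseteq> E" using M(2) by (auto simp: G_def)
  moreover have "r \<le> q x" if "(x, r) \<in> G" for x r
  proof -
    have "x \<in> M" "r = Re (f x)" using that by (auto simp: G_def)
    then show ?thesis using f_le[of x] complex_Re_le_cmod[of "f x"] by simp
  qed
  ultimately obtain h where h_add: "\<And>x y. x \<in> E \<Longrightarrow> y \<in> E \<Longrightarrow> h (x + y) = h x + h y"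
    and h_scale: "\<And>r x. x \<in> E \<Longrightarrow> h (r *\<^sub>R x) = r * h x"
    and h_G: "\<And>x r. (x, r) \<in> G \<Longrightarrow> h x = r"
    and h_le: "\<And>x. x \<in> E \<Longrightarrow> h x \<le> q x"
    using hahn_banach_real[OF q_add, of E G] by blast
  have h_M: "h x = Re (f x)" if "x \<in> M" for x
    using that by (intro h_G) (auto simp: G_def)
  define g where "g x = Complex (h x) (- h (\<i> *\<^sub>C x))" for x
  have g_add: "g (x + y) = g x + g y" if "x \<in> E" "y \<in> E" for x y
    using that Es by (simp add: g_def h_add scaleC_add_right complex_eq_iff)
  have g_scale: "g (c *\<^sub>C x) = c * g x" if x: "x \<in> E" for c x
  proof -
    have split: "h (d *\<^sub>C x) = Re d * h x + Im d * h (\<i> *\<^sub>C x)" for d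
    proof -
      have "d *\<^sub>C x = Re d *\<^sub>R x + Im d *\<^sub>R \<i> *\<^sub>C x"
        by (simp add: scaleR_scaleC scaleC_scaleC flip: scaleC_add_left)
          (metis complex_eq mult.commute)
      moreover have "Re d *\<^sub>R x \<in> E" "Im d *\<^sub>R \<i> *\<^sub>C x \<in> E"
        using Es(3) x by (simp_all add: scaleR_scaleC)
      ultimately show ?thesis
        using h_add h_scale[OF x] h_scale[OF Es(3)[OF x]] by metis
    qed
    show ?thesis
      unfolding g_def scaleC_scaleC split[of c] split[of "\<i> * c"]
      by (simp add: complex_eq_iff)
  qed
  show thesis
  proof (rule that[of g])
    show "g x = f x" if "x \<in> M" for x
      using that Ms by (simp add: g_def h_M f_scale complex_eq_iff)
    show "norm (g x) \<le> q x" if x: "x \<in> E" for x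
    proof -
      define c where "c = cnj (sgn (g x))"
      have "c * g x = norm (g x)"
        using complex_norm_square[of "g x"]
        by (cases "g x = 0") (simp_all add: c_def sgn_eq field_simps power2_eq_square)
      then have "norm (g x) = h (c *\<^sub>C x)"
        using g_scale[OF x, of c] by (simp add: g_def complex_eq_iff)
      also have "\<dots> \<le> norm c * q x"
        using h_le[of "c *\<^sub>C x"] Es(3)[OF x] q_scale[OF x] by simp
      also have "\<dots> \<le> q x"
      proof -
        have "q x \<ge> 0"
          using q_add[OF x Es(3)[OF x, of "- 1"]] q_scale[OF x, of "- 1"] q_scale[OF x, of 0]
          by simp
        moreover have "norm c \<le> 1" by (simp add: c_def norm_sgn)
        ultimately show ?thesis by (simp add: mult_left_le_one_le)
      qed
      finally show ?thesis .
    qed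
  qed (use g_add g_scale in auto)
qed

corollary seminorm_norming_functional:
  fixes q :: "'v::complex_vector \<Rightarrow> real"
  assumes q_add: "\<And>x y. q (x + y) \<le> q x + q y"
    and q_scale: "\<And>c x. q (c *\<^sub>C x) = norm c * q x"
  obtains g where "\<And>x y. g (x + y) = g x + g y" "\<And>c x. g (c *\<^sub>C x) = c * g x"
    "\<And>x. norm (g x) \<le> q x" "norm (g v) = q v"
proof -
  have q_nonneg: "0 \<le> q x" for x
    using q_add[of x "(-1) *\<^sub>C x"] q_scale[of "-1" x] q_scale[of 0 x] by simp
  show thesis
  proof (cases "v = 0")
    case True
    then have "q v = 0" using q_scale[of 0 v] by simp
    then show thesis
      using that[of "\<lambda>x. 0"] q_nonneg by simp
  next
    case False
    \<comment> \<open>Extend \<open>c v \<mapsto> c q(v)\<close> from the line through \<open>v\<close>.\<close>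
    define M where "M = range (\<lambda>c. c *\<^sub>C v)"
    define f where "f x = (THE c. x = c *\<^sub>C v) * q v" for x
    have f: "f (c *\<^sub>C v) = c * q v" for c
      using False by (simp add: f_def)
    have M: "complex_vector.subspace M"
      unfolding M_def
      by (rule complex_vector.subspaceI)
        (auto intro: image_eqI[where x = 0] simp: scaleC_scaleC simp flip: scaleC_add_left)
    have f_add: "f (x + y) = f x + f y" if xy: "x \<in> M" "y \<in> M" for x y
    proof -
      obtain c d where "x = c *\<^sub>C v" "y = d *\<^sub>C v"
        using xy unfolding M_def by blast
      then have "f (x + y) = f ((c + d) *\<^sub>C v)" by (simp add: scaleC_add_left)
      then show ?thesis
        using \<open>x = _\<close> \<open>y = _\<close> by (simp only: f) (simp add: algebra_simps)
    qed
    have f_scale: "f (c *\<^sub>C x) = c * f x" if "x \<in> M" for c x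
      using that f by (auto simp: M_def scaleC_scaleC simp del: complex_vector.scale_scale)
    have f_le: "norm (f x) \<le> q x" if x: "x \<in> M" for x
    proof -
      obtain c where "x = c *\<^sub>C v"
        using x unfolding M_def by blast
      then show ?thesis by (simp add: f q_scale norm_mult q_nonneg)
    qed
    obtain g where g: "\<And>x y. g (x + y) = g x + g y" "\<And>c x. g (c *\<^sub>C x) = c * g x"
      "\<And>x. x \<in> M \<Longrightarrow> g x = f x" "\<And>x. norm (g x) \<le> q x"
    proof (rule hahn_banach_complex[of UNIV q M f])
      fix g
      assume "\<And>x y. x \<in> UNIV \<Longrightarrow> y \<in> UNIV \<Longrightarrow> g (x + y) = g x + g y"
        "\<And>c x. x \<in> UNIV \<Longrightarrow> g (c *\<^sub>C x) = c * g x"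
        "\<And>x. x \<in> M \<Longrightarrow> g x = f x" "\<And>x. x \<in> UNIV \<Longrightarrow> norm (g x) \<le> q x"
      then show thesis by (intro that[of g]) simp_all
    qed (simp_all add: q_add q_scale M f_add f_scale f_le)
    have "g v = q v"
      using g(3)[of v] f[of 1] rangeI[of "\<lambda>c. c *\<^sub>C v" 1] by (simp add: M_def)
    then show thesis
      using that[of g] g q_nonneg[of v] by simp
  qed
qed

section \<open>Bounded operators and the bidual\<close>

lemma norming_functional:
  fixes y :: "'b::complex_normed_vector"
  obtains \<phi> :: "'b cdual" where "norm \<phi> \<le> 1" "norm (\<phi> y) = norm y"
proof -
  obtain g :: "'b \<Rightarrow> complex" where g: "\<And>x y. g (x + y) = g x + g y" "\<And>c x. g (c *\<^sub>C x) = c * g x"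
    "\<And>x. norm (g x) \<le> norm x" "norm (g y) = norm y"
    using seminorm_norming_functional[of norm y, OF norm_triangle_ineq norm_scaleC] by blast
  have "bounded_clinear g"
    by (rule bounded_clinear_intro[where K = 1]) (simp_all add: g scaleC_complex_def)
  then have \<phi>: "cblinfun_apply (CBlinfun g) = g"
    by (simp add: CBlinfun_inverse)
  have "norm (CBlinfun g) \<le> 1"
    by (rule norm_cblinfun_le) (simp_all add: \<phi> g)
  then show thesis
    using that[of "CBlinfun g"] g(4) by (simp add: \<phi>)
qed

lemma norm_le_if_dual_bound:
  fixes y :: "'b::complex_normed_vector"
  assumes "0 \<le> C" and "\<And>\<phi> :: 'b cdual. norm (cblinfun_apply \<phi> y) \<le> C * norm \<phi>"
  shows "norm y \<le> C"
proof -
  obtain \<phi> :: "'b cdual" where "norm \<phi> \<le> 1" "norm (\<phi> y) = norm y"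
    by (rule norming_functional)
  then show ?thesis
    using assms(2)[of \<phi>] mult_left_le[OF _ \<open>0 \<le> C\<close>, of "norm \<phi>"] by simp
qed

lemma eq_if_dual_eq:
  fixes x y :: "'b::complex_normed_vector"
  assumes "\<And>\<phi> :: 'b cdual. cblinfun_apply \<phi> x = cblinfun_apply \<phi> y"
  shows "x = y"
proof -
  obtain \<phi> :: "'b cdual" where "norm (\<phi> (x - y)) = norm (x - y)"
    by (rule norming_functional)
  moreover have "\<phi> (x - y) = \<phi> x - \<phi> y"
    using cblinfun_apply[of \<phi>]
    by (simp add: bounded_clinear_def linear_diff bounded_linear.linear)
  ultimately show ?thesis using assms by simp
qed

lemma cblinfun_bounded_linear: "bounded_linear (cblinfun_apply T)"
  using cblinfun_apply[of T] by (simp add: bounded_clinear_def)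

lemma cblinfun_apply_simps [simp]:
  fixes T :: "'a::complex_normed_vector \<Rightarrow>\<^sub>C\<^sub>L 'b::complex_normed_vector"
  shows "T (x + y) = T x + T y" "T (x - y) = T x - T y" "T (c *\<^sub>C x) = c *\<^sub>C T x" "T 0 = 0"
  using cblinfun_bounded_linear[of T] cblinfun_apply[of T]
  by (simp_all add: bounded_clinear_def linear_add linear_diff linear_0 bounded_linear.linear)

lemmas cblinfun_arith_apply [simp] = plus_cblinfun.rep_eq minus_cblinfun.rep_eq
  scaleC_cblinfun.rep_eq zero_cblinfun.rep_eq

lemma scaleC_complex_mult [simp]: "c *\<^sub>C (z :: complex) = c * z"
  by (simp add: scaleC_complex_def)

lemma bounded_linear_apply_at:
  "bounded_linear (\<lambda>T :: 'a::complex_normed_vector \<Rightarrow>\<^sub>C\<^sub>L 'b::complex_normed_vector. T x)"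
  by (rule bounded_clinear_imp_bounded_linear, rule bounded_clinear_intro[where K = "norm x"])
    (simp_all add: norm_cblinfun_apply_le)

lift_definition bidual_embedding :: "'b::complex_normed_vector \<Rightarrow> 'b cdual cdual"
  is "\<lambda>y \<phi>. cblinfun_apply \<phi> y"
  by (rule bounded_clinear_intro) (simp, simp, rule norm_cblinfun_apply_le)

lemma norm_bidual_embedding_le: "norm (bidual_embedding y) \<le> norm y"
proof (rule norm_cblinfun_le)
  show "norm (bidual_embedding y \<phi>) \<le> norm y * norm \<phi>" for \<phi>
    using norm_cblinfun_apply_le[of \<phi> y] by (simp add: bidual_embedding.rep_eq mult.commute)
qed simp

section \<open>Sequence spaces\<close>

text \<open>
  The graph of \<open>x\<^sup>p\<close> lies above its tangent at \<open>1\<close>. This is the only form in which convexity of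
  \<open>x\<^sup>p\<close> enters below.
\<close>

lemma powr_tangent_le:
  fixes x p :: real
  assumes "1 \<le> p" "0 \<le> x"
  shows "p * x - (p - 1) \<le> x powr p"
proof (cases "x = 0")
  case False
  then have "x \<le> 1 / p * x powr p + (1 - 1 / p)"
    using Youngs_inequality_0[of "1 / p" "1 - 1 / p" "x powr p" 1] assms by (simp add: powr_powr)
  then have "p * x \<le> p * (1 / p * x powr p + (1 - 1 / p))"
    using assms(1) by (intro mult_left_mono) auto
  then show ?thesis using assms(1) by (simp add: algebra_simps)
qed (use assms in simp)

text \<open>
  Jensen's inequality for \<open>x\<^sup>p\<close> at the points \<open>t\<^sub>i / w\<^sub>i\<close>: summing the tangent inequality with
  weights \<open>w\<^sub>i\<close>, after scaling to \<open>\<Sum> t\<^sub>i = 1\<close>, gives \<open>p - (p - 1) \<Sum> w\<^sub>i \<ge> 1\<close> on the left. The weights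
  may therefore sum to less than \<open>1\<close>, which allows finite parts of an infinite family.
\<close>

lemma sum_powr_le_weighted:
  fixes t w :: "'i \<Rightarrow> real"
  assumes p: "1 \<le> p" and F: "finite F"
    and w: "\<And>i. i \<in> F \<Longrightarrow> 0 < w i" "sum w F \<le> 1" and t: "\<And>i. i \<in> F \<Longrightarrow> 0 \<le> t i"
  shows "sum t F powr p \<le> (\<Sum>i\<in>F. w i powr (1 - p) * t i powr p)"
proof (cases "sum t F = 0")
  case True
  then show ?thesis by (simp add: sum_nonneg)
next
  case False
  define T where "T = sum t F"
  have T: "0 < T" using False sum_nonneg[of F t] t by (simp add: T_def)
  have "1 \<le> p - (p - 1) * sum w F"
    using mult_left_mono[OF w(2), of "p - 1"] p by simp
  also have "\<dots> = (\<Sum>i\<in>F. w i * (p * (t i / (w i * T)) - (p - 1)))"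
  proof -
    have "(\<Sum>i\<in>F. w i * (p * (t i / (w i * T)) - (p - 1))) = (\<Sum>i\<in>F. p / T * t i - (p - 1) * w i)"
    proof (rule sum.cong[OF refl])
      fix i assume "i \<in> F"
      then show "w i * (p * (t i / (w i * T)) - (p - 1)) = p / T * t i - (p - 1) * w i"
        using w(1)[of i] T by (simp add: field_simps)
    qed
    also have "\<dots> = p / T * T - (p - 1) * sum w F"
      by (simp only: sum_subtractf sum_distrib_left[symmetric] T_def)
    finally show ?thesis using T by simp
  qed
  also have "\<dots> \<le> (\<Sum>i\<in>F. w i * (t i / (w i * T)) powr p)"
    using w(1) t T p by (intro sum_mono mult_left_mono powr_tangent_le) (auto simp: less_imp_le)
  also have "\<dots> = (\<Sum>i\<in>F. w i powr (1 - p) * t i powr p) / T powr p"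
    unfolding sum_divide_distrib
  proof (rule sum.cong[OF refl])
    fix i assume "i \<in> F"
    then show "w i * (t i / (w i * T)) powr p = w i powr (1 - p) * t i powr p / T powr p"
      using w(1)[of i] t[of i] T
      by (simp add: powr_divide powr_mult powr_diff)
  qed
  finally show ?thesis
    using T by (simp add: field_simps T_def)
qed

lemma lp_norm_nonneg: "0 \<le> lp_norm p y"
  by (simp add: lp_norm_def)

text \<open>
  A bound on all partial sums gives membership in \<open>\<ell>\<^sub>p\<close> together with a bound on the norm; all
  estimates of \<open>\<ell>\<^sub>p\<close> norms from above go through this criterion.
\<close>

lemma lp_normI:
  assumes "0 < p" "0 \<le> C" and "\<And>N. (\<Sum>n<N. norm (y n) powr p) \<le> C powr p"
  shows "y \<in> lp_seq p" "lp_norm p y \<le> C"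
proof -
  have s: "summable (\<lambda>n. norm (y n) powr p)"
    by (rule summableI_nonneg_bounded[where x = "C powr p"]) (use assms(3) in auto)
  then show "y \<in> lp_seq p" by (simp add: lp_seq_def)
  have "(\<Sum>n. norm (y n) powr p) \<le> C powr p"
    using s assms(3) by (rule suminf_le_const)
  then have "lp_norm p y \<le> (C powr p) powr (1 / p)"
    unfolding lp_norm_def using \<open>0 < p\<close> by (intro powr_mono2 suminf_nonneg[OF s]) auto
  then show "lp_norm p y \<le> C"
    using assms(1,2) by (simp add: powr_powr)
qed

lemma lp_norm_powr:
  assumes "0 < p" "y \<in> lp_seq p"
  shows "lp_norm p y powr p = (\<Sum>n. norm (y n) powr p)"
  using assms suminf_nonneg[of "\<lambda>n. norm (y n) powr p"]
  by (simp add: lp_norm_def powr_powr lp_seq_def)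

lemma sum_powr_le_lp_norm:
  assumes "0 < p" "y \<in> lp_seq p" "finite F"
  shows "(\<Sum>n\<in>F. norm (y n) powr p) \<le> lp_norm p y powr p"
  using assms by (simp add: lp_norm_powr lp_seq_def sum_le_suminf)

lemma norm_le_lp_norm:
  assumes "0 < p" "y \<in> lp_seq p"
  shows "norm (y n) \<le> lp_norm p y"
proof -
  have "norm (y n) powr p \<le> lp_norm p y powr p"
    using sum_powr_le_lp_norm[OF assms, of "{n}"] by simp
  then show ?thesis
    using assms(1) lp_norm_nonneg[of p y] powr_less_mono2[of p "lp_norm p y" "norm (y n)"] by linarith
qed

lemma lp_norm_dominated:
  assumes "0 < p" "0 \<le> c" "y \<in> lp_seq p" and "\<And>n. norm (x n) \<le> c * norm (y n)"
  shows "x \<in> lp_seq p" "lp_norm p x \<le> c * lp_norm p y"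
proof -
  have "(\<Sum>n<N. norm (x n) powr p) \<le> (c * lp_norm p y) powr p" for N
  proof -
    have "(\<Sum>n<N. norm (x n) powr p) \<le> (\<Sum>n<N. (c * norm (y n)) powr p)"
      using assms(1,4) by (intro sum_mono powr_mono2) auto
    also have "\<dots> = c powr p * (\<Sum>n<N. norm (y n) powr p)"
      using assms(2) by (simp add: powr_mult sum_distrib_left)
    also have "\<dots> \<le> c powr p * lp_norm p y powr p"
      by (intro mult_left_mono sum_powr_le_lp_norm assms) auto
    finally show ?thesis
      using assms(2) by (simp add: powr_mult lp_norm_nonneg)
  qed
  moreover have "0 \<le> c * lp_norm p y" using assms(2) by (simp add: lp_norm_nonneg)
  ultimately show "x \<in> lp_seq p" "lp_norm p x \<le> c * lp_norm p y"
    using lp_normI[OF assms(1), of "c * lp_norm p y" x] by auto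
qed

lemma lp_zero: "0 < p \<Longrightarrow> (\<lambda>n. 0) \<in> lp_seq p" "0 < p \<Longrightarrow> lp_norm p (\<lambda>n. 0) = 0"
  by (simp_all add: lp_seq_def lp_norm_def)

lemma lp_norm_scaleC:
  fixes y :: "nat \<Rightarrow> 'a::complex_normed_vector"
  assumes "0 < p" "y \<in> lp_seq p"
  shows "(\<lambda>n. c *\<^sub>C y n) \<in> lp_seq p" "lp_norm p (\<lambda>n. c *\<^sub>C y n) = norm c * lp_norm p y"
proof -
  show c: "(\<lambda>n. c *\<^sub>C y n) \<in> lp_seq p"
    using lp_norm_dominated(1)[OF assms(1) norm_ge_zero assms(2), of "\<lambda>n. c *\<^sub>C y n" c]
    by (simp add: norm_scaleC)
  have "(\<Sum>n. (norm c * norm (y n)) powr p) = norm c powr p * (\<Sum>n. norm (y n) powr p)"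
    using assms by (simp add: powr_mult suminf_mult lp_seq_def)
  then show "lp_norm p (\<lambda>n. c *\<^sub>C y n) = norm c * lp_norm p y"
    using assms suminf_nonneg[of "\<lambda>n. norm (y n) powr p"]
    by (simp add: lp_norm_def norm_scaleC powr_mult powr_powr lp_seq_def)
qed

text \<open>
  For \<open>a > \<parallel>u\<parallel>\<^sub>p\<close> and \<open>b > \<parallel>v\<parallel>\<^sub>p\<close>, the weighted inequality with weights \<open>a / (a + b)\<close> and
  \<open>b / (a + b)\<close> bounds \<open>\<Sum> \<parallel>u\<^sub>n + v\<^sub>n\<parallel>\<^sup>p\<close> by \<open>(a + b)\<^sup>p\<close>. Strict bounds avoid the case of zero norms.
\<close>

theorem minkowski:
  fixes u v :: "nat \<Rightarrow> 'a::real_normed_vector"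
  assumes p: "1 \<le> p" and u: "u \<in> lp_seq p" and v: "v \<in> lp_seq p"
  shows "(\<lambda>n. u n + v n) \<in> lp_seq p" "lp_norm p (\<lambda>n. u n + v n) \<le> lp_norm p u + lp_norm p v"
proof -
  have bound: "(\<lambda>n. u n + v n) \<in> lp_seq p \<and> lp_norm p (\<lambda>n. u n + v n) \<le> a + b"
    if a: "lp_norm p u < a" and b: "lp_norm p v < b" for a b
  proof -
    have pos: "0 < a" "0 < b"
      using a b lp_norm_nonneg[of p u] lp_norm_nonneg[of p v] by linarith+
    have weight: "(a' / (a + b)) powr (1 - p) * a' powr p = (a + b) powr (p - 1) * a'"
      if "0 < a'" for a'
    proof -
      have "a' powr (1 - p) * a' powr p = a'"
        using that by (simp flip: powr_add)
      moreover have "(a + b) powr (1 - p) = inverse ((a + b) powr (p - 1))"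
        using powr_minus[of "a + b" "p - 1"] by simp
      moreover have "(a' / (a + b)) powr (1 - p) = a' powr (1 - p) / (a + b) powr (1 - p)"
        using that pos by (simp add: powr_divide)
      ultimately show ?thesis
        by (simp add: divide_inverse mult.commute)
    qed
    have "(\<Sum>n<N. norm (u n + v n) powr p) \<le> (a + b) powr p" for N
    proof -
      have "norm (u n + v n) powr p \<le>
          (a / (a + b)) powr (1 - p) * norm (u n) powr p + (b / (a + b)) powr (1 - p) * norm (v n) powr p" for n
      proof -
        have "norm (u n + v n) powr p \<le> (norm (u n) + norm (v n)) powr p"
          using p by (intro powr_mono2 norm_triangle_ineq) auto
        also have "\<dots> = (\<Sum>i\<in>UNIV. if i then norm (u n) else norm (v n)) powr p"
          by (simp add: UNIV_bool add.commute)
        also have "\<dots> \<le> (\<Sum>i\<in>UNIV. (if i then a / (a + b) else b / (a + b)) powr (1 - p) *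
            (if i then norm (u n) else norm (v n)) powr p)"
          using p pos by (intro sum_powr_le_weighted) (auto simp: UNIV_bool field_simps)
        finally show ?thesis by (simp add: UNIV_bool add.commute)
      qed
      then have "(\<Sum>n<N. norm (u n + v n) powr p) \<le>
          (a / (a + b)) powr (1 - p) * (\<Sum>n<N. norm (u n) powr p) +
          (b / (a + b)) powr (1 - p) * (\<Sum>n<N. norm (v n) powr p)"
        unfolding sum_distrib_left sum.distrib[symmetric] by (rule sum_mono)
      also have "\<dots> \<le> (a / (a + b)) powr (1 - p) * a powr p + (b / (a + b)) powr (1 - p) * b powr p"
      proof (intro add_mono mult_left_mono)
        show "(\<Sum>n<N. norm (u n) powr p) \<le> a powr p"
          using sum_powr_le_lp_norm[OF _ u, of "{..<N}"] powr_mono2[of p "lp_norm p u" a] a p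
            lp_norm_nonneg[of p u] by simp
        show "(\<Sum>n<N. norm (v n) powr p) \<le> b powr p"
          using sum_powr_le_lp_norm[OF _ v, of "{..<N}"] powr_mono2[of p "lp_norm p v" b] b p
            lp_norm_nonneg[of p v] by simp
      qed auto
      also have "\<dots> = (a + b) powr (p - 1) * (a + b)"
        using weight pos by (simp add: distrib_left)
      also have "\<dots> = (a + b) powr p"
        using pos by (simp add: powr_diff)
      finally show ?thesis .
    qed
    then show ?thesis
      using lp_normI[of p "a + b" "\<lambda>n. u n + v n"] p pos by auto
  qed
  show "(\<lambda>n. u n + v n) \<in> lp_seq p"
    using bound[of "lp_norm p u + 1" "lp_norm p v + 1"] by simp
  show "lp_norm p (\<lambda>n. u n + v n) \<le> lp_norm p u + lp_norm p v"
  proof (rule field_le_epsilon)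
    fix e :: real assume "0 < e"
    then show "lp_norm p (\<lambda>n. u n + v n) \<le> lp_norm p u + lp_norm p v + e"
      using bound[of "lp_norm p u + e / 2" "lp_norm p v + e / 2"] by simp
  qed
qed

section \<open>Coefficient balls\<close>

text \<open>
  The unit ball of the dual of \<open>\<ell>\<^sub>p\<close>, described by the pairing instead of the conjugate exponent, so
  that \<open>p = 1\<close> needs no separate treatment: it is the unit ball of \<open>\<ell>\<^sub>\<infinity>\<close> in that case. The modulus
  on \<open>a n\<close> absorbs the phases of the sequences it is tested on.
\<close>

definition dual_ball :: "real \<Rightarrow> (nat \<Rightarrow> complex) set"
  where "dual_ball p = {a. \<forall>t N. (\<forall>n. 0 \<le> t n) \<longrightarrow>
    (\<Sum>n<N. norm (a n) * t n) \<le> (\<Sum>n<N. t n powr p) powr (1 / p)}"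

lemma dual_ballD:
  "a \<in> dual_ball p \<Longrightarrow> (\<And>n. 0 \<le> t n) \<Longrightarrow> (\<Sum>n<N. norm (a n) * t n) \<le> (\<Sum>n<N. t n powr p) powr (1 / p)"
  by (simp add: dual_ball_def)

lemma dual_ball_norm_le_1:
  assumes "a \<in> dual_ball p"
  shows "norm (a n) \<le> 1"
proof -
  have "(\<Sum>m<Suc n. norm (a m) * (if m = n then 1 else 0)) \<le>
      (\<Sum>m<Suc n. (if m = n then 1 else 0) powr p) powr (1 / p)"
    by (rule dual_ballD[OF assms]) simp
  also have "(\<Sum>m<Suc n. norm (a m) * (if m = n then 1 else 0)) = norm (a n)"
    by (simp add: if_distrib sum.delta cong: if_cong)
  also have "(\<Sum>m<Suc n. (if m = n then 1 else 0) powr p) = (1 :: real)"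
  proof -
    have "(\<Sum>m<Suc n. (if m = n then 1 else 0 :: real) powr p) = (\<Sum>m<Suc n. if m = n then 1 else 0)"
      by (intro sum.cong) auto
    then show ?thesis by simp
  qed
  finally show ?thesis by simp
qed

lemma dual_ball_pairing_norm:
  fixes y :: "nat \<Rightarrow> 'a::real_normed_vector"
  assumes p: "0 < p" and a: "a \<in> dual_ball p" and y: "y \<in> lp_seq p"
  shows "summable (\<lambda>n. norm (a n) * norm (y n))"
    "(\<Sum>n. norm (a n) * norm (y n)) \<le> lp_norm p y"
proof -
  have partial: "(\<Sum>n<N. norm (a n) * norm (y n)) \<le> lp_norm p y" for N
  proof -
    have "(\<Sum>n<N. norm (a n) * norm (y n)) \<le> (\<Sum>n<N. norm (y n) powr p) powr (1 / p)"
      by (rule dual_ballD[OF a]) simp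
    also have "\<dots> \<le> (lp_norm p y powr p) powr (1 / p)"
      using p by (intro powr_mono2 sum_powr_le_lp_norm y sum_nonneg) auto
    finally show ?thesis using p by (simp add: powr_powr lp_norm_nonneg)
  qed
  show s: "summable (\<lambda>n. norm (a n) * norm (y n))"
    by (rule summableI_nonneg_bounded[OF _ partial]) simp
  show "(\<Sum>n. norm (a n) * norm (y n)) \<le> lp_norm p y"
    using s partial by (rule suminf_le_const)
qed

lemma dual_ball_pairing:
  fixes y :: "nat \<Rightarrow> 'a::cbanach"
  assumes p: "0 < p" and a: "a \<in> dual_ball p" and y: "y \<in> lp_seq p"
  shows "summable (\<lambda>n. a n *\<^sub>C y n)" "norm (\<Sum>n. a n *\<^sub>C y n) \<le> lp_norm p y"
proof -
  note s = dual_ball_pairing_norm[OF assms]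
  show "summable (\<lambda>n. a n *\<^sub>C y n)"
    using s(1) by (intro summable_norm_cancel[where f = "\<lambda>n. a n *\<^sub>C y n"]) (simp add: norm_scaleC)
  show "norm (\<Sum>n. a n *\<^sub>C y n) \<le> lp_norm p y"
    using summable_norm[of "\<lambda>n. a n *\<^sub>C y n"] s by (simp add: norm_scaleC)
qed

text \<open>
  Hoelder's inequality, from Young's inequality for the normalized sequences if \<open>p > 1\<close> and from
  \<open>|a\<^sub>n| \<le> 1\<close> if \<open>p = 1\<close>.
\<close>

lemma conjugate_ball_subset_dual_ball:
  assumes p: "1 \<le> p"
  shows "conjugate_ball p \<subseteq> dual_ball p"
proof
  fix a assume a: "a \<in> conjugate_ball p"
  have "(\<Sum>n<N. norm (a n) * t n) \<le> (\<Sum>n<N. t n powr p) powr (1 / p)"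
    if t: "\<And>n. 0 \<le> t n" for t and N :: nat
  proof (cases "p = 1")
    case True
    then have "norm (a n) * t n \<le> t n" for n
      using a t[of n] by (simp add: conjugate_ball_def mult_left_le_one_le)
    then have "(\<Sum>n<N. norm (a n) * t n) \<le> (\<Sum>n<N. t n)"
      by (intro sum_mono)
    then show ?thesis using True t by (simp add: sum_nonneg)
  next
    case False
    define q where "q = p / (p - 1)"
    have pq: "1 < p" "1 < q" "1 / p + 1 / q = 1"
      using p False by (auto simp: q_def field_simps)
    have aq: "a \<in> lp_seq q" "lp_norm q a \<le> 1"
      using a False by (auto simp: conjugate_ball_def q_def)
    define T where "T = (\<Sum>n<N. t n powr p) powr (1 / p)"
    have Tp: "T powr p = (\<Sum>n<N. t n powr p)"
      using pq by (simp add: T_def powr_powr sum_nonneg)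
    show ?thesis
    proof (cases "T = 0")
      case True
      then have "(\<Sum>n<N. t n powr p) = 0" using Tp by simp
      then have "\<forall>n<N. t n = 0" by (simp add: sum_nonneg_eq_0_iff)
      then show ?thesis by simp
    next
      case False
      then have T: "0 < T" by (simp add: T_def)
      have "norm (a n) * t n / T \<le> t n powr p / T powr p / p + norm (a n) powr q / q" for n
        using Youngs_inequality[OF pq, of "t n / T" "norm (a n)"] t[of n] T
        by (simp add: powr_divide mult.commute)
      then have "(\<Sum>n<N. norm (a n) * t n / T) \<le>
          (\<Sum>n<N. t n powr p / T powr p / p + norm (a n) powr q / q)"
        by (intro sum_mono)
      also have "\<dots> = (\<Sum>n<N. t n powr p) / T powr p / p + (\<Sum>n<N. norm (a n) powr q) / q"
        by (simp add: sum.distrib sum_divide_distrib)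
      also have "\<dots> \<le> 1 / p + 1 / q"
      proof (intro add_mono divide_right_mono)
        show "(\<Sum>n<N. t n powr p) / T powr p \<le> 1" using T by (simp add: Tp)
        have "lp_norm q a powr q \<le> 1 powr q"
          using aq(2) pq by (intro powr_mono2 lp_norm_nonneg) auto
        then show "(\<Sum>n<N. norm (a n) powr q) \<le> 1"
          using sum_powr_le_lp_norm[of q a "{..<N}"] aq(1) pq by simp
      qed (use pq in auto)
      finally have "(\<Sum>n<N. norm (a n) * t n) / T \<le> 1"
        using pq by (simp add: sum_divide_distrib)
      then show ?thesis using T by (simp add: T_def)
    qed
  qed
  then show "a \<in> dual_ball p" by (simp add: dual_ball_def)
qed

text \<open>
  Testing with \<open>t\<^sub>n = |a\<^sub>n|\<^sup>q\<^sup>-\<^sup>1\<close> gives \<open>S \<le> S\<^sup>1\<^sup>/\<^sup>p\<close> for the partial sums \<open>S\<close> of \<open>\<Sum> |a\<^sub>n|\<^sup>q\<close>, hence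
  \<open>S \<le> 1\<close>. The case \<open>p = 1\<close> is excluded: there the conjugate ball consists of null sequences
  and is smaller.
\<close>

lemma dual_ball_subset_conjugate_ball:
  assumes p: "1 < p"
  shows "dual_ball p \<subseteq> conjugate_ball p"
proof
  fix a assume a: "a \<in> dual_ball p"
  define q where "q = p / (p - 1)"
  have q: "1 < q" "(q - 1) * p = q"
    using p by (auto simp: q_def field_simps)
  have "(\<Sum>n<N. norm (a n) powr q) \<le> 1 powr q" for N
  proof -
    define S where "S = (\<Sum>n<N. norm (a n) powr q)"
    have "S = (\<Sum>n<N. norm (a n) * norm (a n) powr (q - 1))"
      unfolding S_def
    proof (rule sum.cong[OF refl])
      fix n show "norm (a n) powr q = norm (a n) * norm (a n) powr (q - 1)"
        using powr_mult_base[of "norm (a n)" "q - 1"] by simp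
    qed
    also have "\<dots> \<le> (\<Sum>n<N. (norm (a n) powr (q - 1)) powr p) powr (1 / p)"
      by (rule dual_ballD[OF a]) simp
    finally have "S \<le> S powr (1 / p)"
      by (simp add: powr_powr q S_def)
    moreover have "S powr (1 / p) < S powr 1" if "1 < S"
      using that p by (intro powr_less_mono) auto
    ultimately have "S \<le> 1" by (cases "1 < S") auto
    then show ?thesis by (simp add: S_def)
  qed
  then have "a \<in> lp_seq q" "lp_norm q a \<le> 1"
    using lp_normI[of q 1 a] q by auto
  then show "a \<in> conjugate_ball p"
    using p by (simp add: conjugate_ball_def q_def)
qed

text \<open>
  The Abel-Dini argument: for the tails \<open>R\<^sub>n = \<Sum>\<^sub>k\<^sub>\<ge>\<^sub>n t\<^sub>k\<close> the terms \<open>t\<^sub>n / \<surd>R\<^sub>n\<close> are at most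
  \<open>2 (\<surd>R\<^sub>n - \<surd>R\<^sub>n\<^sub>+\<^sub>1)\<close>, so they sum to at most \<open>2 \<surd>R\<^sub>0\<close> although \<open>1 / \<surd>R\<^sub>n\<close> diverges. A small multiple
  of these weights is added to \<open>1\<close>.
\<close>

lemma diverging_weights:
  fixes t :: "nat \<Rightarrow> real"
  assumes t: "\<And>n. 0 \<le> t n" "summable t" and e: "0 < e"
  obtains c where "\<And>n. 1 \<le> c n" "filterlim c at_top sequentially"
    "summable (\<lambda>n. c n * t n)" "(\<Sum>n. c n * t n) \<le> (\<Sum>n. t n) + e"
proof -
  define R where "R n = (\<Sum>k. t (k + n))" for n
  have tail: "summable (\<lambda>k. t (k + n))" for n
    using t(2) by (simp add: summable_iff_shift)
  have R_nonneg: "0 \<le> R n" for n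
    unfolding R_def by (rule suminf_nonneg[OF tail]) (rule t)
  have R_Suc: "R n = t n + R (Suc n)" for n
    using suminf_split_head[OF tail[of n]] by (simp add: R_def)
  have R0: "R 0 = suminf t" by (simp add: R_def)
  have R_lim: "R \<longlonglongrightarrow> 0"
    unfolding R_def using suminf_exist_split2[OF t(2)] .
  define d where "d = e / (2 * sqrt (R 0) + 1)"
  have d: "0 < d" "d * (2 * sqrt (R 0)) \<le> e"
  proof -
    define s where "s = 2 * sqrt (R 0) + 1"
    have s: "0 < s" "2 * sqrt (R 0) \<le> s" using R_nonneg[of 0] by (simp_all add: s_def add_nonneg_pos)
    then show "0 < d" using e by (simp add: d_def s_def)
    have "d * (2 * sqrt (R 0)) \<le> d * s"
      using s \<open>0 < d\<close> by (intro mult_left_mono) auto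
    also have "\<dots> = e" using s by (simp add: d_def s_def)
    finally show "d * (2 * sqrt (R 0)) \<le> e" .
  qed
  \<comment> \<open>The summand \<open>1 / (n + 1)\<close> keeps the square root positive when the tails vanish eventually.\<close>
  define r where "r n = sqrt (R n + inverse (real (Suc n)))" for n
  have r_pos: "0 < r n" for n
    using R_nonneg[of n] by (simp add: r_def add_nonneg_pos)
  have "r \<longlonglongrightarrow> sqrt (0 + 0)"
    unfolding r_def by (intro tendsto_intros R_lim LIMSEQ_inverse_real_of_nat)
  then have "filterlim r (at_right 0) sequentially"
    using r_pos by (simp add: filterlim_at order_less_imp_not_eq2)
  then have inv: "filterlim (\<lambda>n. inverse (r n)) at_top sequentially"
    by (rule filterlim_compose[OF filterlim_inverse_at_top_right])
  define c where "c n = 1 + d * inverse (r n)" for n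
  have lim: "filterlim c at_top sequentially"
    unfolding c_def
    by (intro filterlim_tendsto_add_at_top[OF tendsto_const] filterlim_tendsto_pos_mult_at_top[OF tendsto_const] d inv)
  have term_le: "t n * inverse (r n) \<le> 2 * (sqrt (R n) - sqrt (R (Suc n)))" for n
  proof (cases "R n = 0")
    case True
    then have "t n = 0" "R (Suc n) = 0" using R_Suc[of n] t(1)[of n] R_nonneg[of "Suc n"] by linarith+
    then show ?thesis using True by simp
  next
    case False
    define u v where "u = sqrt (R n)" and "v = sqrt (R (Suc n))"
    have u: "0 < u" "v \<le> u" "0 \<le> v"
      using False R_nonneg[of n] R_nonneg[of "Suc n"] R_Suc[of n] t(1)[of n]
      by (auto simp: u_def v_def)
    have tn: "t n = (u - v) * (u + v)"
      using R_Suc[of n] R_nonneg[of n] R_nonneg[of "Suc n"]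
      by (simp add: u_def v_def algebra_simps)
    have "u \<le> r n" by (simp add: u_def r_def)
    then have "t n * inverse (r n) \<le> t n * inverse u"
      using u t(1)[of n] by (intro mult_left_mono le_imp_inverse_le) auto
    also have "\<dots> \<le> 2 * (u - v)"
    proof -
      have "(u - v) * (u + v) \<le> (u - v) * (2 * u)"
        using u by (intro mult_left_mono) auto
      then show ?thesis using u by (simp add: tn field_simps)
    qed
    finally show ?thesis by (simp add: u_def v_def)
  qed
  have partial: "(\<Sum>n<N. c n * t n) \<le> (\<Sum>n. t n) + e" for N
  proof -
    have "(\<Sum>n<N. c n * t n) = (\<Sum>n<N. t n) + d * (\<Sum>n<N. t n * inverse (r n))"
      by (simp add: c_def algebra_simps sum.distrib sum_distrib_left)
    also have "\<dots> \<le> (\<Sum>n. t n) + d * (\<Sum>n<N. 2 * (sqrt (R n) - sqrt (R (Suc n))))"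
      using d by (intro add_mono mult_left_mono sum_mono term_le sum_le_suminf t) auto
    also have "(\<Sum>n<N. 2 * (sqrt (R n) - sqrt (R (Suc n)))) = 2 * (sqrt (R 0) - sqrt (R N))"
      using sum_lessThan_telescope'[of "\<lambda>n. sqrt (R n)" N]
      by (simp only: sum_distrib_left[symmetric])
    also have "d * (2 * (sqrt (R 0) - sqrt (R N))) \<le> d * (2 * sqrt (R 0))"
      using d R_nonneg[of N] by (intro mult_left_mono) auto
    finally show ?thesis using d by linarith
  qed
  have c1: "1 \<le> c n" for n
    using d r_pos[of n] by (simp add: c_def less_imp_le)
  have nonneg: "0 \<le> c n * t n" for n
    using c1[of n] t(1)[of n] by simp
  have "summable (\<lambda>n. c n * t n)"
    by (rule summableI_nonneg_bounded[OF nonneg partial])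
  then show thesis
    using that[OF c1 lim] partial suminf_le_const by metis
qed

text \<open>
  For \<open>p = 1\<close> the coefficients are only bounded and have to become null sequences. Dividing them by
  weights that tend to infinity achieves this, and multiplying \<open>y\<close> by the same weights costs as
  little as desired.
\<close>

lemma subset_p_hull_if_dual_ball:
  fixes y :: "nat \<Rightarrow> 'a::cbanach"
  assumes p: "1 \<le> p" and y: "y \<in> lp_seq p" and e: "0 < e"
    and K: "\<And>k. k \<in> K \<Longrightarrow> \<exists>a\<in>dual_ball p. k = (\<Sum>n. a n *\<^sub>C y n)"
  obtains y' where "y' \<in> lp_seq p" "lp_norm p y' \<le> lp_norm p y + e" "K \<subseteq> p_hull p y'"
proof (cases "p = 1")
  case False
  then have "K \<subseteq> p_hull p y"
    using K dual_ball_subset_conjugate_ball[of p] p unfolding p_hull_def by fastforce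
  then show thesis using that[of y] y e by simp
next
  case True
  have "summable (\<lambda>n. norm (y n))" using y True by (simp add: lp_seq_def)
  then obtain c where c: "\<And>n. 1 \<le> c n" "filterlim c at_top sequentially"
    "summable (\<lambda>n. c n * norm (y n))" "(\<Sum>n. c n * norm (y n)) \<le> (\<Sum>n. norm (y n)) + e"
    using diverging_weights[of "\<lambda>n. norm (y n)" e] e by auto
  have cpos: "0 < c n" for n using c(1)[of n] by simp
  define y' where "y' n = complex_of_real (c n) *\<^sub>C y n" for n
  have norm_y': "norm (y' n) = c n * norm (y n)" for n
    using cpos[of n] by (simp add: y'_def norm_scaleC)
  have lp: "y' \<in> lp_seq p"
    using c(3) cpos by (simp add: True lp_seq_def norm_y')
  have le: "lp_norm p y' \<le> lp_norm p y + e"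
    using c(4) suminf_nonneg[OF c(3)] suminf_nonneg[OF \<open>summable (\<lambda>n. norm (y n))\<close>] cpos
    by (simp add: True lp_norm_def norm_y' less_imp_le)
  have "K \<subseteq> p_hull p y'"
  proof
    fix k assume "k \<in> K"
    then obtain a where a: "a \<in> dual_ball p" "k = (\<Sum>n. a n *\<^sub>C y n)" using K by blast
    define b where "b n = a n / complex_of_real (c n)" for n
    have norm_b: "norm (b n) \<le> inverse (c n)" for n
      using dual_ball_norm_le_1[OF a(1), of n] cpos[of n]
      by (simp add: b_def norm_divide inverse_eq_divide divide_right_mono)
    have "(\<lambda>n. inverse (c n)) \<longlonglongrightarrow> 0"
      using c(2) by (rule tendsto_inverse_0_at_top)
    then have "b \<longlonglongrightarrow> 0"
      by (rule Lim_null_comparison[rotated]) (simp add: norm_b)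
    moreover have "norm (b n) \<le> 1" for n
      using norm_b[of n] c(1)[of n] cpos[of n] le_imp_inverse_le[of 1 "c n"] by simp
    ultimately have "b \<in> conjugate_ball p" by (simp add: conjugate_ball_def True)
    moreover have "b n *\<^sub>C y' n = a n *\<^sub>C y n" for n
      using cpos[of n] by (simp add: b_def y'_def scaleC_scaleC)
    ultimately show "k \<in> p_hull p y'"
      using a(2) unfolding p_hull_def by (auto intro!: exI[of _ b])
  qed
  then show thesis using that lp le by blast
qed

section \<open>Sums of \<open>\<ell>\<^sub>p\<close> seminorms\<close>

lemma le_if_powr_le:
  fixes x y p :: real
  assumes "0 < p" "0 \<le> y" "x powr p \<le> y powr p"
  shows "x \<le> y"
  using powr_less_mono2[of p y x] assms by linarith

text \<open>
  The concatenation of the sequences \<open>z i\<close>, enumerated by the pairing function, where \<open>z i\<close> is scaled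
  so that \<open>\<parallel>glue p w z\<parallel>\<^sub>p\<^sup>p = \<Sum> w\<^sub>i\<^sup>1\<^sup>-\<^sup>p \<parallel>z\<^sub>i\<parallel>\<^sub>p\<^sup>p\<close>.
\<close>

definition glue :: "real \<Rightarrow> (nat \<Rightarrow> real) \<Rightarrow> (nat \<Rightarrow> nat \<Rightarrow> 'a::real_vector) \<Rightarrow> nat \<Rightarrow> 'a"
  where "glue p w z k = (case prod_decode k of (i, n) \<Rightarrow> w i powr ((1 - p) / p) *\<^sub>R z i n)"

lemma norm_glue_powr:
  fixes z :: "nat \<Rightarrow> nat \<Rightarrow> 'a::real_normed_vector"
  assumes "0 < p"
  shows "norm (glue p w z k) powr p =
    (case prod_decode k of (i, n) \<Rightarrow> w i powr (1 - p) * norm (z i n) powr p)"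
  using assms by (simp add: glue_def powr_mult powr_powr split: prod.split)

text \<open>
  With weights proportional to the bounds \<open>s i\<close>, the sum \<open>\<Sum> w\<^sub>i\<^sup>1\<^sup>-\<^sup>p s\<^sub>i\<^sup>p\<close> collapses to
  \<open>S\<^sup>p\<^sup>-\<^sup>1 \<Sum> s\<^sub>i = S\<^sup>p\<close>. This is the equality case of the weighted inequality, which is why nothing is
  lost when seminorms are combined.
\<close>

lemma glue_in_lp:
  fixes z :: "nat \<Rightarrow> nat \<Rightarrow> 'a::real_normed_vector"
  assumes p: "1 \<le> p" and z: "\<And>i. z i \<in> lp_seq p" "\<And>i. lp_norm p (z i) \<le> s i"
    and s: "\<And>i. 0 < s i" "summable s"
  shows "glue p (\<lambda>i. s i / suminf s) z \<in> lp_seq p"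
    "lp_norm p (glue p (\<lambda>i. s i / suminf s) z) \<le> suminf s"
proof -
  define S w where "S = suminf s" and "w i = s i / S" for i
  have S: "0 < S" using s by (simp add: S_def suminf_pos)
  have w: "0 < w i" for i using s(1)[of i] S by (simp add: w_def)
  have weight: "w i powr (1 - p) * s i powr p = S powr (p - 1) * s i" for i
  proof -
    have "s i powr (1 - p) * s i powr p = s i"
      using s(1)[of i] by (simp flip: powr_add)
    moreover have "S powr (1 - p) = inverse (S powr (p - 1))"
      using powr_minus[of S "p - 1"] by simp
    moreover have "w i powr (1 - p) = s i powr (1 - p) / S powr (1 - p)"
      using s(1)[of i] S by (simp add: w_def powr_divide)
    ultimately show ?thesis
      by (simp add: divide_inverse mult.commute)
  qed
  define g where "g = (\<lambda>(i, n). w i powr (1 - p) * norm (z i n) powr p)"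
  have partial: "(\<Sum>k<N. norm (glue p w z k) powr p) \<le> S powr p" for N
  proof -
    obtain I J where IJ: "fst ` prod_decode ` {..<N} \<subseteq> {..<I}" "snd ` prod_decode ` {..<N} \<subseteq> {..<J}"
      using finite_nat_iff_bounded by (metis finite_imageI finite_lessThan)
    then have sub: "prod_decode ` {..<N} \<subseteq> {..<I} \<times> {..<J}"
      by (auto simp: image_subset_iff mem_Times_iff)
    have "(\<Sum>k<N. norm (glue p w z k) powr p) = (\<Sum>k<N. g (prod_decode k))"
      using p by (simp add: norm_glue_powr g_def)
    also have "\<dots> = sum g (prod_decode ` {..<N})"
      by (simp add: sum.reindex[OF inj_prod_decode])
    also have "\<dots> \<le> sum g ({..<I} \<times> {..<J})"
      using sub by (intro sum_mono2) (auto simp: g_def)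
    also have "\<dots> = (\<Sum>i<I. w i powr (1 - p) * (\<Sum>n<J. norm (z i n) powr p))"
      by (simp add: g_def sum.cartesian_product[symmetric] sum_distrib_left)
    also have "\<dots> \<le> (\<Sum>i<I. w i powr (1 - p) * s i powr p)"
    proof (intro sum_mono mult_left_mono)
      show "(\<Sum>n<J. norm (z i n) powr p) \<le> s i powr p" for i
        using sum_powr_le_lp_norm[OF _ z(1), of "{..<J}" i] p
          powr_mono2[OF _ lp_norm_nonneg z(2), of p i] by simp
    qed auto
    also have "\<dots> = S powr (p - 1) * (\<Sum>i<I. s i)"
      by (simp add: weight sum_distrib_left)
    also have "\<dots> \<le> S powr (p - 1) * S"
      unfolding S_def using s by (intro mult_left_mono sum_le_suminf) (auto intro: less_imp_le)
    also have "\<dots> = S powr p" using S by (simp add: powr_diff)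
    finally show ?thesis .
  qed
  have "glue p w z \<in> lp_seq p" "lp_norm p (glue p w z) \<le> S"
    using lp_normI[of p S "glue p w z"] partial p S by auto
  then show "glue p (\<lambda>i. s i / suminf s) z \<in> lp_seq p"
    "lp_norm p (glue p (\<lambda>i. s i / suminf s) z) \<le> suminf s"
    unfolding w_def[abs_def] S_def by auto
qed

text \<open>
  The weighted inequality with \<open>t i = \<parallel>x\<^sub>i\<parallel>\<^sub>p\<close> bounds the sum by \<open>\<Sum> w\<^sub>i\<^sup>1\<^sup>-\<^sup>p \<parallel>x\<^sub>i\<parallel>\<^sub>p\<^sup>p\<close>, which is a limit of
  partial sums of the glued sequence.
\<close>

lemma sum_lp_norm_le_glue:
  fixes x :: "nat \<Rightarrow> nat \<Rightarrow> 'a::real_normed_vector"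
  assumes p: "1 \<le> p" and w: "\<And>i. 0 < w i" "sum w {..<M} \<le> 1"
    and x: "\<And>i. x i \<in> lp_seq p" and gx: "glue p w x \<in> lp_seq p"
  shows "(\<Sum>i<M. lp_norm p (x i)) \<le> lp_norm p (glue p w x)"
proof (rule le_if_powr_le[of p])
  have "(\<Sum>i<M. lp_norm p (x i)) powr p \<le> (\<Sum>i<M. w i powr (1 - p) * lp_norm p (x i) powr p)"
    using p w by (intro sum_powr_le_weighted) (auto simp: lp_norm_nonneg)
  also have "\<dots> \<le> lp_norm p (glue p w x) powr p"
  proof (rule LIMSEQ_le_const2)
    show "(\<lambda>m. \<Sum>i<M. w i powr (1 - p) * (\<Sum>n<m. norm (x i n) powr p))
        \<longlonglongrightarrow> (\<Sum>i<M. w i powr (1 - p) * lp_norm p (x i) powr p)"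
    proof (intro tendsto_intros)
      show "(\<lambda>m. \<Sum>n<m. norm (x i n) powr p) \<longlonglongrightarrow> lp_norm p (x i) powr p" for i
        using x[of i] p by (simp add: lp_norm_powr lp_seq_def summable_LIMSEQ)
    qed
    have "(\<Sum>i<M. w i powr (1 - p) * (\<Sum>n<m. norm (x i n) powr p)) \<le> lp_norm p (glue p w x) powr p" for m
    proof -
      have "(\<Sum>i<M. w i powr (1 - p) * (\<Sum>n<m. norm (x i n) powr p)) =
          (\<Sum>(i, n)\<in>{..<M} \<times> {..<m}. w i powr (1 - p) * norm (x i n) powr p)"
        by (simp add: sum.cartesian_product[symmetric] sum_distrib_left)
      also have "\<dots> = (\<Sum>u\<in>{..<M} \<times> {..<m}. norm (glue p w x (prod_encode u)) powr p)"
        using p by (intro sum.cong) (auto simp: norm_glue_powr)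
      also have "\<dots> = (\<Sum>k\<in>prod_encode ` ({..<M} \<times> {..<m}). norm (glue p w x k) powr p)"
        by (simp add: sum.reindex[OF inj_prod_encode])
      also have "\<dots> \<le> lp_norm p (glue p w x) powr p"
        using p gx by (intro sum_powr_le_lp_norm) auto
      finally show ?thesis .
    qed
    then show "\<exists>N. \<forall>m\<ge>N. (\<Sum>i<M. w i powr (1 - p) * (\<Sum>n<m. norm (x i n) powr p)) \<le> lp_norm p (glue p w x) powr p"
      by blast
  qed
  finally show "(\<Sum>i<M. lp_norm p (x i)) powr p \<le> lp_norm p (glue p w x) powr p" .
qed (use p in \<open>auto simp: lp_norm_nonneg\<close>)

lemma lp_bounded_linear:
  assumes "bounded_linear L" "0 < p" "y \<in> lp_seq p"
  shows "(\<lambda>n. L (y n)) \<in> lp_seq p"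
  by (rule lp_norm_dominated(1)[OF assms(2) onorm_pos_le[OF assms(1)] assms(3)])
    (rule onorm[OF assms(1)])

text \<open>
  Domination by a sum of \<open>\<ell>\<^sub>p\<close> seminorms can be replaced by domination by a single one, at the price
  of exactly the sum of the norms. In this way the partial results of the iteration are put
  together.
\<close>

lemma combine_lp_seminorms:
  fixes z :: "nat \<Rightarrow> nat \<Rightarrow> 'a::real_normed_vector"
  assumes p: "1 \<le> p" and z: "\<And>i. z i \<in> lp_seq p" "\<And>i. lp_norm p (z i) \<le> s i"
    and s: "\<And>i. 0 < s i" "summable s"
  obtains u where "u \<in> lp_seq p" "lp_norm p u \<le> suminf s"
    "\<And>(L :: 'a \<Rightarrow> complex) M. bounded_linear L \<Longrightarrow>
      (\<Sum>i<M. lp_norm p (\<lambda>n. L (z i n))) \<le> lp_norm p (\<lambda>n. L (u n))"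
proof -
  \<comment> \<open>The choice of weights for which gluing preserves the total norm.\<close>
  define w where "w i = s i / suminf s" for i
  define u where "u = glue p w z"
  have u: "u \<in> lp_seq p" "lp_norm p u \<le> suminf s"
    using glue_in_lp[OF p z s] by (simp_all add: u_def w_def[abs_def])
  have S: "0 < suminf s" using s by (simp add: suminf_pos)
  have "(\<Sum>i<M. lp_norm p (\<lambda>n. L (z i n))) \<le> lp_norm p (\<lambda>n. L (u n))"
    if L: "bounded_linear L" for L :: "'a \<Rightarrow> complex" and M
  proof -
    have Lu: "(\<lambda>n. L (u n)) = glue p w (\<lambda>i n. L (z i n))"
      by (auto simp: u_def glue_def fun_eq_iff linear_scale bounded_linear.linear[OF L] split: prod.split)
    have "sum s {..<M} \<le> suminf s"
      using s by (intro sum_le_suminf) (auto intro: less_imp_le)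
    then have "sum w {..<M} \<le> 1"
      using S by (simp add: w_def sum_divide_distrib[symmetric])
    then show ?thesis
      using lp_bounded_linear[OF L _ u(1)] lp_bounded_linear[OF L _ z(1)] p s S
      unfolding Lu by (intro sum_lp_norm_le_glue) (auto simp: w_def)
  qed
  with u show thesis by (rule that)
qed

text \<open>
  The remaining members of the family are zero, with bounds \<open>e / 2\<^sup>i\<^sup>+\<^sup>1\<close> that keep all weights
  positive.
\<close>

lemma combine_two_lp_seminorms:
  fixes u v :: "nat \<Rightarrow> 'a::real_normed_vector"
  assumes p: "1 \<le> p" and uv: "u \<in> lp_seq p" "v \<in> lp_seq p" and e: "0 < e"
  obtains x where "x \<in> lp_seq p" "lp_norm p x \<le> lp_norm p u + lp_norm p v + e"
    "\<And>L :: 'a \<Rightarrow> complex. bounded_linear L \<Longrightarrow>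
      lp_norm p (\<lambda>n. L (u n)) + lp_norm p (\<lambda>n. L (v n)) \<le> lp_norm p (\<lambda>n. L (x n))"
proof -
  define z where "z i = (if i = 0 then u else if i = 1 then v else (\<lambda>n. 0))" for i :: nat
  define s where "s i = e * (1 / 2) ^ Suc i + lp_norm p (z i)" for i
  have z0: "lp_norm p (z i) = 0" if "i \<notin> {..<2}" for i
    using that p by (auto simp: z_def lp_zero)
  have "(\<lambda>i. lp_norm p (z i)) sums (\<Sum>i<2. lp_norm p (z i))"
    by (rule sums_finite) (use z0 in auto)
  moreover have "(\<lambda>i. e * (1 / 2) ^ Suc i) sums (e * 1)"
    by (rule sums_mult[OF power_half_series])
  ultimately have s_sums: "s sums (e * 1 + (lp_norm p u + lp_norm p v))"
    unfolding s_def by (intro sums_add) (simp_all add: z_def numeral_2_eq_2)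
  have "z i \<in> lp_seq p" "lp_norm p (z i) \<le> s i" "0 < s i" for i
    using uv e p by (auto simp: z_def s_def lp_zero lp_norm_nonneg intro: add_pos_nonneg)
  then obtain x where x: "x \<in> lp_seq p" "lp_norm p x \<le> suminf s"
    "\<And>(L :: 'a \<Rightarrow> complex) M. bounded_linear L \<Longrightarrow>
      (\<Sum>i<M. lp_norm p (\<lambda>n. L (z i n))) \<le> lp_norm p (\<lambda>n. L (x n))"
    using combine_lp_seminorms[OF p, of z s] sums_summable[OF s_sums] by blast
  show thesis
  proof (rule that[OF x(1)])
    show "lp_norm p x \<le> lp_norm p u + lp_norm p v + e"
      using x(2) sums_unique[OF s_sums] by simp
    show "lp_norm p (\<lambda>n. L (u n)) + lp_norm p (\<lambda>n. L (v n)) \<le> lp_norm p (\<lambda>n. L (x n))"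
      if "bounded_linear L" for L :: "'a \<Rightarrow> complex"
      using x(3)[OF that, of 2] by (simp add: z_def numeral_2_eq_2)
  qed
qed

section \<open>Coefficients from domination\<close>

text \<open>
  The Hahn-Banach theorem is applied to spaces of sequences. Their linear structure is the pointwise
  one; their norms are not part of the type.
\<close>

instantiation "fun" :: (type, real_vector) real_vector
begin

definition scaleR_fun :: "real \<Rightarrow> ('a \<Rightarrow> 'b) \<Rightarrow> 'a \<Rightarrow> 'b"
  where "scaleR_fun r f = (\<lambda>x. r *\<^sub>R f x)"

instance
  by standard (simp_all add: scaleR_fun_def fun_eq_iff algebra_simps)

end

instantiation "fun" :: (type, complex_vector) complex_vector
begin

definition scaleC_fun :: "complex \<Rightarrow> ('a \<Rightarrow> 'b) \<Rightarrow> 'a \<Rightarrow> 'b"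
  where "scaleC_fun c f = (\<lambda>x. c *\<^sub>C f x)"

instance
  by standard (simp_all add: scaleC_fun_def scaleR_fun_def fun_eq_iff scaleC_add_right
      scaleC_add_left scaleR_scaleC)

end

lemma lp_bidual_embedding:
  assumes "0 < p" "y \<in> lp_seq p"
  shows "(\<lambda>n. bidual_embedding (y n)) \<in> lp_seq p"
    "lp_norm p (\<lambda>n. bidual_embedding (y n)) \<le> lp_norm p y"
  using lp_norm_dominated[OF assms(1) zero_le_one assms(2), of "\<lambda>n. bidual_embedding (y n)"]
  by (simp_all add: norm_bidual_embedding_le)

lemma lp_norm_apply_le:
  fixes z :: "nat \<Rightarrow> 'a::complex_normed_vector \<Rightarrow>\<^sub>C\<^sub>L 'b::complex_normed_vector"
  assumes "0 < p" "z \<in> lp_seq p"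
  shows "(\<lambda>n. z n x) \<in> lp_seq p" "lp_norm p (\<lambda>n. z n x) \<le> norm x * lp_norm p z"
proof -
  have "norm (z n x) \<le> norm x * norm (z n)" for n
    using norm_cblinfun_apply_le[of "z n" x] by (simp add: mult.commute)
  from lp_norm_dominated[OF assms(1) norm_ge_zero assms(2) this]
  show "(\<lambda>n. z n x) \<in> lp_seq p" "lp_norm p (\<lambda>n. z n x) \<le> norm x * lp_norm p z" .
qed

lemma subspace_lp_seq:
  fixes p :: real
  assumes "1 \<le> p"
  shows "complex_vector.subspace (lp_seq p :: (nat \<Rightarrow> 'a::complex_normed_vector) set)"
  using assms minkowski(1)[OF assms] lp_norm_scaleC(1)[of p]
  by (intro complex_vector.subspaceI) (auto simp: plus_fun_def zero_fun_def scaleC_fun_def lp_zero)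

definition lp_tail :: "nat \<Rightarrow> (nat \<Rightarrow> 'a::zero) \<Rightarrow> nat \<Rightarrow> 'a"
  where "lp_tail N x n = (if n < N then 0 else x n)"

lemma lp_tail_in_lp:
  assumes "0 < p" "x \<in> lp_seq p"
  shows "lp_tail N x \<in> lp_seq p"
  by (rule lp_norm_dominated(1)[OF assms(1) zero_le_one assms(2)]) (simp add: lp_tail_def)

lemma lp_norm_tail_tendsto:
  assumes "0 < p" "x \<in> lp_seq p"
  shows "(\<lambda>N. lp_norm p (lp_tail N x)) \<longlonglongrightarrow> 0"
proof -
  define f where "f n = norm (x n) powr p" for n
  have f_nonneg: "0 \<le> f n" for n by (simp add: f_def)
  have f: "summable f" using assms by (simp add: lp_seq_def f_def[abs_def])
  have "(\<Sum>n. norm (lp_tail N x n) powr p) = (\<Sum>n. f (n + N))" for N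
  proof -
    have "(\<Sum>n. norm (lp_tail N x n) powr p) = (\<Sum>n. norm (lp_tail N x (n + N)) powr p) +
        (\<Sum>n<N. norm (lp_tail N x n) powr p)"
      using lp_tail_in_lp[OF assms, of N] by (intro suminf_split_initial_segment) (simp add: lp_seq_def)
    then show ?thesis by (simp add: lp_tail_def f_def)
  qed
  then have "lp_norm p (lp_tail N x) = (\<Sum>n. f (n + N)) powr (1 / p)" for N
    by (simp add: lp_norm_def)
  moreover have "(\<lambda>N. (\<Sum>n. f (n + N)) powr (1 / p)) \<longlonglongrightarrow> 0 powr (1 / p)"
    using assms(1) f
    by (intro tendsto_powr' suminf_exist_split2 tendsto_const)
      (auto simp: summable_iff_shift f_nonneg intro!: always_eventually suminf_nonneg)
  ultimately show ?thesis by simp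
qed

text \<open>
  The inequality by which a sequence in the bidual witnesses quasi \<open>p\<close>-nuclearity, for one point at
  a time.
\<close>

definition dominated :: "real \<Rightarrow> (nat \<Rightarrow> 'b::complex_normed_vector cdual cdual) \<Rightarrow> 'b \<Rightarrow> bool"
  where "dominated p z k \<longleftrightarrow> (\<forall>\<phi> :: 'b cdual. norm (cblinfun_apply \<phi> k) \<le> lp_norm p (\<lambda>n. z n \<phi>))"

text \<open>
  The dual of \<open>\<ell>\<^sub>p\<close>: a functional of norm at most \<open>1\<close> is determined by its values at the unit
  vectors, since truncations of a sequence converge to it in \<open>\<ell>\<^sub>p\<close>.
\<close>

lemma lp_functional_coefficients:
  fixes G :: "(nat \<Rightarrow> complex) \<Rightarrow> complex"
  assumes p: "1 \<le> p"
    and G_add: "\<And>x y. x \<in> lp_seq p \<Longrightarrow> y \<in> lp_seq p \<Longrightarrow> G (\<lambda>n. x n + y n) = G x + G y"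
    and G_scale: "\<And>c x. x \<in> lp_seq p \<Longrightarrow> G (\<lambda>n. c * x n) = c * G x"
    and G_le: "\<And>x. x \<in> lp_seq p \<Longrightarrow> norm (G x) \<le> lp_norm p x"
  obtains a where "a \<in> dual_ball p" "\<And>x. x \<in> lp_seq p \<Longrightarrow> G x = (\<Sum>n. a n * x n)"
proof -
  define unit where "unit n = (\<lambda>m. if m = n then 1 else 0 :: complex)" for n :: nat
  define a where "a n = G (unit n)" for n
  define trunc where "trunc N x = (\<lambda>n. if n < N then x n else 0 :: complex)" for N :: nat and x
  have finite_lp: "x \<in> lp_seq p" if "\<And>n. N \<le> n \<Longrightarrow> x n = 0" for N and x :: "nat \<Rightarrow> complex"
    unfolding lp_seq_def mem_Collect_eq
    by (rule summable_finite[of "{..<N}"]) (use that in \<open>auto simp: not_less\<close>)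
  have unit_lp: "unit n \<in> lp_seq p" for n
    by (rule finite_lp[of "Suc n"]) (simp add: unit_def)
  have trunc_lp: "trunc N x \<in> lp_seq p" for N x
    by (rule finite_lp[of N]) (simp add: trunc_def)
  have G_trunc: "G (trunc N x) = (\<Sum>n<N. a n * x n)" for N x
  proof (induction N)
    case 0
    then show ?case using G_scale[OF unit_lp[of 0], of 0] by (simp add: trunc_def)
  next
    case (Suc N)
    have "trunc (Suc N) x = (\<lambda>n. trunc N x n + x N * unit N n)"
      by (auto simp: trunc_def unit_def fun_eq_iff less_Suc_eq)
    moreover have "(\<lambda>n. x N * unit N n) \<in> lp_seq p"
      by (rule finite_lp[of "Suc N"]) (simp add: unit_def)
    ultimately show ?case
      using Suc by (simp add: G_add[OF trunc_lp] G_scale[OF unit_lp] a_def)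
  qed
  have "a \<in> dual_ball p"
    unfolding dual_ball_def
  proof (intro CollectI allI impI)
    fix t :: "nat \<Rightarrow> real" and N :: nat assume t: "\<forall>n. 0 \<le> t n"
    define x where "x n = cnj (sgn (a n)) * t n" for n
    have ax: "a n * x n = complex_of_real (norm (a n) * t n)" for n
      using complex_norm_square[of "a n"]
      by (cases "a n = 0") (simp_all add: x_def sgn_eq field_simps power2_eq_square)
    have norm_x: "norm (x n) \<le> t n" for n
      using t by (simp add: x_def norm_mult norm_sgn)
    have "G (trunc N x) = complex_of_real (\<Sum>n<N. norm (a n) * t n)"
      by (simp add: G_trunc ax)
    then have "(\<Sum>n<N. norm (a n) * t n) = norm (G (trunc N x))"
      using t by (simp only: norm_of_real) (simp add: sum_nonneg)
    also have "\<dots> \<le> lp_norm p (trunc N x)"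
      by (rule G_le[OF trunc_lp])
    also have "\<dots> = (\<Sum>n<N. norm (x n) powr p) powr (1 / p)"
    proof -
      have "(\<Sum>n. norm (trunc N x n) powr p) = (\<Sum>n<N. norm (trunc N x n) powr p)"
        by (rule suminf_finite) (auto simp: trunc_def)
      then show ?thesis by (simp add: lp_norm_def trunc_def)
    qed
    also have "\<dots> \<le> (\<Sum>n<N. t n powr p) powr (1 / p)"
      using p norm_x by (intro powr_mono2 sum_mono sum_nonneg) auto
    finally show "(\<Sum>n<N. norm (a n) * t n) \<le> (\<Sum>n<N. t n powr p) powr (1 / p)" .
  qed
  moreover have "G x = (\<Sum>n. a n * x n)" if x: "x \<in> lp_seq p" for x
  proof -
    have "norm (G x - (\<Sum>n<N. a n * x n)) \<le> lp_norm p (lp_tail N x)" for N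
    proof -
      have "x = (\<lambda>n. trunc N x n + lp_tail N x n)"
        by (auto simp: trunc_def lp_tail_def)
      then have "G x = G (trunc N x) + G (lp_tail N x)"
        using G_add[OF trunc_lp[of N x] lp_tail_in_lp[OF _ x, of N]] p by simp
      then show ?thesis
        using G_le[OF lp_tail_in_lp[OF _ x, of N]] p by (simp add: G_trunc)
    qed
    then have "(\<lambda>N. G x - (\<Sum>n<N. a n * x n)) \<longlonglongrightarrow> 0"
      using lp_norm_tail_tendsto[OF _ x] p by (intro Lim_null_comparison[OF _ lp_norm_tail_tendsto[OF _ x]]) auto
    from tendsto_diff[OF tendsto_const[of "G x"] this] have "(\<lambda>N. \<Sum>n<N. a n * x n) \<longlonglongrightarrow> G x"
      by simp
    then show ?thesis
      by (simp add: sums_def[symmetric] sums_iff)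
  qed
  ultimately show thesis by (rule that)
qed

text \<open>
  By domination, the value \<open>\<phi> k\<close> depends only on the sequence \<open>(z\<^sub>n \<phi>)\<close> and is bounded by its norm.
  So \<open>(z\<^sub>n \<phi>) \<mapsto> \<phi> k\<close> is a functional of norm at most \<open>1\<close> on a subspace of \<open>\<ell>\<^sub>p\<close>; it extends to
  \<open>\<ell>\<^sub>p\<close>, and the extension has coefficients.
\<close>

lemma dominated_coefficients:
  fixes z :: "nat \<Rightarrow> 'b::complex_normed_vector cdual cdual"
  assumes p: "1 \<le> p" and z: "z \<in> lp_seq p" and k: "dominated p z k"
  obtains a where "a \<in> dual_ball p" "\<And>\<phi> :: 'b cdual. cblinfun_apply \<phi> k = (\<Sum>n. a n * z n \<phi>)"
proof -
  define ev :: "'b cdual \<Rightarrow> nat \<Rightarrow> complex" where "ev \<phi> = (\<lambda>n. z n \<phi>)" for \<phi>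
  define f :: "(nat \<Rightarrow> complex) \<Rightarrow> complex" where "f x = cblinfun_apply (SOME \<phi>. x = ev \<phi>) k" for x
  have ev_lp: "ev \<phi> \<in> lp_seq p" for \<phi>
    using lp_norm_apply_le(1)[OF _ z] p by (simp add: ev_def)
  have ev_arith: "ev (\<phi> + \<psi>) = ev \<phi> + ev \<psi>" "ev (c *\<^sub>C \<phi>) = c *\<^sub>C ev \<phi>" "ev 0 = 0" for \<phi> \<psi> c
    by (simp_all add: ev_def fun_eq_iff scaleC_fun_def)
  have f_ev: "f (ev \<phi>) = \<phi> k" for \<phi> :: "'b cdual"
  proof -
    \<comment> \<open>Functionals with the same sequence have a difference that is dominated by zero.\<close>
    define \<psi> where "\<psi> = (SOME \<psi>. ev \<phi> = ev \<psi>)"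
    have "ev \<phi> = ev \<psi>" unfolding \<psi>_def by (rule someI) (rule refl)
    then have "z n (\<phi> - \<psi>) = 0" for n by (simp add: ev_def fun_eq_iff)
    then have "norm ((\<phi> - \<psi>) k) \<le> 0"
      using k[unfolded dominated_def, rule_format, of "\<phi> - \<psi>"] p by (simp only: lp_zero)
    then show ?thesis by (simp add: f_def \<psi>_def)
  qed
  obtain G where G: "\<And>x y. x \<in> lp_seq p \<Longrightarrow> y \<in> lp_seq p \<Longrightarrow> G (x + y) = G x + G y"
    "\<And>c x. x \<in> lp_seq p \<Longrightarrow> G (c *\<^sub>C x) = c * G x"
    "\<And>x. x \<in> range ev \<Longrightarrow> G x = f x" "\<And>x. x \<in> lp_seq p \<Longrightarrow> norm (G x) \<le> lp_norm p x"
  proof (rule hahn_banach_complex[of "lp_seq p" "lp_norm p" "range ev" f])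
    show "complex_vector.subspace (range ev)"
    proof (rule complex_vector.subspaceI)
      show "0 \<in> range ev" using ev_arith(3) by (metis rangeI)
      show "x + y \<in> range ev" if "x \<in> range ev" "y \<in> range ev" for x y
        using that by (auto simp flip: ev_arith(1))
      show "c *\<^sub>C x \<in> range ev" if "x \<in> range ev" for c x
        using that by (auto simp flip: ev_arith(2))
    qed
    show "f (x + y) = f x + f y" if "x \<in> range ev" "y \<in> range ev" for x y
      using that by (auto simp: f_ev simp flip: ev_arith(1))
    show "f (c *\<^sub>C x) = c * f x" if "x \<in> range ev" for c x
      using that by (auto simp: f_ev simp flip: ev_arith(2))
    show "norm (f x) \<le> lp_norm p x" if x: "x \<in> range ev" for x
    proof -
      obtain \<phi> where "x = ev \<phi>" using x by blast
      moreover have "norm (\<phi> k) \<le> lp_norm p (ev \<phi>)"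
        using k by (simp add: dominated_def ev_def)
      ultimately show ?thesis by (simp add: f_ev)
    qed
    show "lp_norm p (c *\<^sub>C x) = norm c * lp_norm p x" if "x \<in> lp_seq p" for c and x :: "nat \<Rightarrow> complex"
      using lp_norm_scaleC(2)[OF _ that] p by (simp add: scaleC_fun_def)
    show "lp_norm p (x + y) \<le> lp_norm p x + lp_norm p y"
      if "x \<in> lp_seq p" "y \<in> lp_seq p" for x y :: "nat \<Rightarrow> complex"
      using minkowski(2)[OF p that] by (simp add: plus_fun_def)
  qed (use subspace_lp_seq[OF p] ev_lp in auto)
  obtain a where a: "a \<in> dual_ball p" "\<And>x. x \<in> lp_seq p \<Longrightarrow> G x = (\<Sum>n. a n * x n)"
    using lp_functional_coefficients[OF p, of G] G(1,2,4)
    by (auto simp: plus_fun_def scaleC_fun_def)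
  have "\<phi> k = (\<Sum>n. a n * z n \<phi>)" for \<phi> :: "'b cdual"
    using a(2)[OF ev_lp[of \<phi>]] G(3)[of "ev \<phi>"] by (simp add: f_ev) (simp add: ev_def)
  with a(1) show thesis by (rule that)
qed

section \<open>Descent from the bidual for finitely many points\<close>

text \<open>
  The vector is rotated so that the value of \<open>T\<close> at it is real, because these values are going to
  be added up without cancellation.
\<close>

lemma exists_almost_norming_vector:
  fixes T :: "'a::complex_normed_vector cdual"
  assumes "0 < e"
  obtains v where "norm v \<le> 1" "\<exists>r\<ge>norm T - e. T v = complex_of_real r"
proof -
  have "\<exists>v. norm v \<le> 1 \<and> norm T - e \<le> norm (T v)"
  proof (rule ccontr)
    assume "\<nexists>v. norm v \<le> 1 \<and> norm T - e \<le> norm (T v)"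
    then have less: "norm (T v) < norm T - e" if "norm v \<le> 1" for v
      using that by (meson not_le)
    then have nonneg: "0 \<le> norm T - e"
      using less[of 0] by simp
    have "norm (T x) \<le> (norm T - e) * norm x" for x
    proof (cases "x = 0")
      case False
      define c where "c = complex_of_real (inverse (norm x))"
      have "norm (T (c *\<^sub>C x)) < norm T - e"
        using False by (intro less) (simp add: c_def norm_scaleC norm_inverse)
      then have "inverse (norm x) * norm (T x) < norm T - e"
        by (simp add: c_def norm_mult norm_inverse)
      then show ?thesis using False by (simp add: field_simps)
    qed simp
    then have "norm T \<le> norm T - e"
      using nonneg by (intro norm_cblinfun_le)
    then show False using assms by simp
  qed
  then obtain v where v: "norm v \<le> 1" "norm T - e \<le> norm (T v)" by blast
  define c where "c = cnj (sgn (T v))"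
  have "T (c *\<^sub>C v) = complex_of_real (norm (T v))"
    using complex_norm_square[of "T v"]
    by (cases "T v = 0") (simp_all add: c_def sgn_eq field_simps power2_eq_square)
  moreover have "norm (c *\<^sub>C v) \<le> 1"
    using v(1) by (auto simp: c_def norm_scaleC norm_sgn)
  ultimately show thesis using that[of "c *\<^sub>C v"] v(2) by blast
qed

text \<open>
  A functional \<open>y \<mapsto> \<Sum> \<psi>\<^sub>n y\<^sub>n\<close> of norm at most \<open>1\<close> on \<open>\<ell>\<^sub>p(X)\<close> has its sequence of norms in the
  dual ball: test it on multiples \<open>t\<^sub>n v\<^sub>n\<close> of almost norming vectors. The bound can then be applied to
  vectors of the bidual, for which the functional itself has no direct meaning.
\<close>

lemma norms_in_dual_ball:
  fixes \<psi> :: "nat \<Rightarrow> 'a::complex_normed_vector cdual"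
  assumes p: "1 \<le> p"
    and bound: "\<And>N y. norm (\<Sum>n<N. \<psi> n (y n)) \<le> (\<Sum>n<N. norm (y n) powr p) powr (1 / p)"
  shows "(\<lambda>n. complex_of_real (norm (\<psi> n))) \<in> dual_ball p"
  unfolding dual_ball_def
proof (intro CollectI allI impI)
  fix t :: "nat \<Rightarrow> real" and N :: nat assume t: "\<forall>n. 0 \<le> t n"
  have main: "(\<Sum>n<N. norm (\<psi> n) * t n) \<le> (\<Sum>n<N. t n powr p) powr (1 / p) + e * (\<Sum>n<N. t n)"
    if e: "0 < e" for e
  proof -
    have "\<forall>n. \<exists>v. norm v \<le> 1 \<and> (\<exists>r\<ge>norm (\<psi> n) - e. \<psi> n v = complex_of_real r)"
      using exists_almost_norming_vector[OF e] by metis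
    then obtain v r where v: "\<And>n. norm (v n) \<le> 1" "\<And>n. norm (\<psi> n) - e \<le> r n"
      "\<And>n. \<psi> n (v n) = complex_of_real (r n)"
      by metis
    define y where "y n = complex_of_real (t n) *\<^sub>C v n" for n
    have "(\<Sum>n<N. norm (\<psi> n) * t n) - e * (\<Sum>n<N. t n) = (\<Sum>n<N. t n * (norm (\<psi> n) - e))"
      by (simp add: sum_distrib_left sum_subtractf algebra_simps)
    also have "\<dots> \<le> (\<Sum>n<N. t n * r n)"
      using v(2) t by (intro sum_mono mult_left_mono) auto
    also have "\<dots> \<le> norm (complex_of_real (\<Sum>n<N. t n * r n))"
      by (simp only: norm_of_real abs_ge_self)
    also have "complex_of_real (\<Sum>n<N. t n * r n) = (\<Sum>n<N. \<psi> n (y n))"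
      by (simp add: y_def v(3))
    also have "norm \<dots> \<le> (\<Sum>n<N. norm (y n) powr p) powr (1 / p)"
      by (rule bound)
    also have "\<dots> \<le> (\<Sum>n<N. t n powr p) powr (1 / p)"
    proof -
      have "norm (y n) \<le> t n" for n
        using t v(1)[of n] mult_left_le[of "norm (v n)" "t n"] by (simp add: y_def norm_scaleC)
      then show ?thesis
        using p by (intro powr_mono2 sum_mono sum_nonneg) auto
    qed
    finally show ?thesis by simp
  qed
  define S where "S = (\<Sum>n<N. t n)"
  have S: "0 \<le> S" using t by (simp add: S_def sum_nonneg)
  have "(\<Sum>n<N. norm (\<psi> n) * t n) \<le> (\<Sum>n<N. t n powr p) powr (1 / p)"
  proof (rule field_le_epsilon)
    fix d :: real assume d: "0 < d"
    have "d / (S + 1) * S \<le> d"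
      using d S by (simp add: field_simps)
    then show "(\<Sum>n<N. norm (\<psi> n) * t n) \<le> (\<Sum>n<N. t n powr p) powr (1 / p) + d"
      using main[of "d / (S + 1)"] d S unfolding S_def[symmetric] by simp
  qed
  then show "(\<Sum>n<N. norm (complex_of_real (norm (\<psi> n))) * t n) \<le> (\<Sum>n<N. t n powr p) powr (1 / p)"
    by simp
qed

lemma dual_combination_bound:
  fixes y :: "nat \<Rightarrow> 'b::cbanach"
  assumes "1 \<le> p" "a \<in> dual_ball p" "y \<in> lp_seq p"
  shows "norm (cblinfun_apply \<phi> (\<Sum>n. a n *\<^sub>C y n)) \<le> lp_norm p (\<lambda>n. cblinfun_apply \<phi> (y n))"
    and "cblinfun_apply \<phi> (\<Sum>n. a n *\<^sub>C y n) = (\<Sum>n. a n * \<phi> (y n))"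
proof -
  have p: "0 < p" using assms(1) by simp
  show eq: "cblinfun_apply \<phi> (\<Sum>n. a n *\<^sub>C y n) = (\<Sum>n. a n * \<phi> (y n))"
    using bounded_linear.suminf[OF cblinfun_bounded_linear dual_ball_pairing(1)[OF p assms(2,3)], of \<phi>]
    by simp
  have "(\<lambda>n. \<phi> (y n)) \<in> lp_seq p"
    by (rule lp_bounded_linear[OF cblinfun_bounded_linear p assms(3)])
  from dual_ball_pairing(2)[OF p assms(2) this]
  show "norm (cblinfun_apply \<phi> (\<Sum>n. a n *\<^sub>C y n)) \<le> lp_norm p (\<lambda>n. cblinfun_apply \<phi> (y n))"
    by (simp add: eq)
qed

text \<open>
  Minimizing a jointly sublinear and homogeneous cost over an auxiliary variable gives a seminorm.
\<close>

lemma INF_seminorm: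
  fixes cost :: "'v::complex_vector \<Rightarrow> 'u::complex_vector \<Rightarrow> real"
  assumes U: "complex_vector.subspace U"
    and nonneg: "\<And>w y. y \<in> U \<Longrightarrow> 0 \<le> cost w y"
    and add: "\<And>w w' y y'. y \<in> U \<Longrightarrow> y' \<in> U \<Longrightarrow> cost (w + w') (y + y') \<le> cost w y + cost w' y'"
    and scale: "\<And>c w y. y \<in> U \<Longrightarrow> cost (c *\<^sub>C w) (c *\<^sub>C y) = norm c * cost w y"
  shows "(INF y\<in>U. cost (w + w') y) \<le> (INF y\<in>U. cost w y) + (INF y\<in>U. cost w' y)"
    "(INF y\<in>U. cost (c *\<^sub>C w) y) = norm c * (INF y\<in>U. cost w y)"
proof -
  define q where "q w = (INF y\<in>U. cost w y)" for w
  have ne: "U \<noteq> {}" using complex_vector.subspace_0[OF U] by auto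
  have q_le: "q w \<le> cost w y" if "y \<in> U" for w y
    unfolding q_def using nonneg by (intro cINF_lower[OF _ that] bdd_belowI2[where m = 0]) auto
  have q_near: "\<exists>y\<in>U. cost w y < q w + e" if e: "0 < e" for w e
    using cINF_less_iff[OF ne bdd_belowI2[where m = 0], of "cost w" "q w + e"] nonneg e
    by (auto simp: q_def)
  have q_nonneg: "0 \<le> q w" for w
    unfolding q_def using nonneg by (intro cINF_greatest ne) auto
  have "q (w + w') \<le> q w + q w'" for w w'
  proof (rule field_le_epsilon)
    fix e :: real assume "0 < e"
    then obtain y y' where y: "y \<in> U" "y' \<in> U" "cost w y < q w + e / 2" "cost w' y' < q w' + e / 2"
      using q_near[of "e / 2"] by (meson half_gt_zero)
    have "q (w + w') \<le> cost (w + w') (y + y')"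
      using y by (intro q_le complex_vector.subspace_add[OF U])
    also have "\<dots> \<le> cost w y + cost w' y'" by (rule add[OF y(1,2)])
    finally show "q (w + w') \<le> q w + q w' + e" using y by simp
  qed
  then show "(INF y\<in>U. cost (w + w') y) \<le> (INF y\<in>U. cost w y) + (INF y\<in>U. cost w' y)"
    by (simp add: q_def)
  have scale_le: "q (c *\<^sub>C w) \<le> norm c * q w" for c w
  proof (rule field_le_epsilon)
    fix e :: real assume e: "0 < e"
    define d where "d = e / (norm c + 1)"
    have d: "0 < d" "norm c * d \<le> e"
    proof -
      have "0 < norm c + 1" by (simp add: add_nonneg_pos)
      then show "0 < d" "norm c * d \<le> e" using e by (simp_all add: d_def field_simps)
    qed
    obtain y where y: "y \<in> U" "cost w y < q w + d" using q_near[OF d(1)] by blast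
    have "q (c *\<^sub>C w) \<le> norm c * cost w y"
      using q_le[OF complex_vector.subspace_scale[OF U y(1)]] scale[OF y(1)] by metis
    also have "\<dots> \<le> norm c * (q w + d)" using y(2) by (intro mult_left_mono) auto
    finally show "q (c *\<^sub>C w) \<le> norm c * q w + e" using d by (simp add: algebra_simps)
  qed
  have "q (c *\<^sub>C w) = norm c * q w"
  proof (cases "c = 0")
    case True
    then show ?thesis using scale_le[of 0 w] q_nonneg[of 0] by simp
  next
    case False
    have "norm c * q w = norm c * q (inverse c *\<^sub>C c *\<^sub>C w)"
      using False by simp
    also have "\<dots> \<le> norm c * (norm (inverse c) * q (c *\<^sub>C w))"
      by (intro mult_left_mono scale_le) auto
    also have "\<dots> = q (c *\<^sub>C w)" using False by (simp add: norm_inverse)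
    finally show ?thesis using scale_le[of c w] by simp
  qed
  then show "(INF y\<in>U. cost (c *\<^sub>C w) y) = norm c * (INF y\<in>U. cost w y)"
    by (simp add: q_def)
qed

text \<open>
  Let \<open>q w\<close> be the infimum over \<open>y\<close> of \<open>\<parallel>y\<parallel>\<^sub>p + c \<Sum>\<^sub>j \<parallel>w\<^sub>j - \<Sum>\<^sub>n A\<^sub>j\<^sub>n y\<^sub>n\<parallel>\<close>, a seminorm on tuples in \<open>Y\<close>. It
  has a norming functional at \<open>k\<close>, which consists of functionals \<open>\<Phi>\<^sub>j\<close> on \<open>Y\<close>. Choosing \<open>w\<close> so that
  the penalty vanishes shows that \<open>\<psi>\<^sub>n = \<Sum>\<^sub>j A\<^sub>j\<^sub>n \<Phi>\<^sub>j\<close> has norm at most \<open>1\<close> as a functional on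
  \<open>\<ell>\<^sub>p(Y)\<close>, hence \<open>q k = |\<Sum>\<^sub>j \<Phi>\<^sub>j(k\<^sub>j)| = |\<Sum>\<^sub>n z\<^sub>n(\<psi>\<^sub>n)| \<le> \<parallel>z\<parallel>\<^sub>p\<close>. An almost optimal \<open>y\<close> is as required.
\<close>

lemma finite_approximation:
  fixes z :: "nat \<Rightarrow> 'b::cbanach cdual cdual" and k :: "nat \<Rightarrow> 'b"
  assumes p: "1 \<le> p" and z: "z \<in> lp_seq p" and A: "\<And>j. j < m \<Longrightarrow> A j \<in> dual_ball p"
    and k: "\<And>j \<phi>. j < m \<Longrightarrow> cblinfun_apply \<phi> (k j) = (\<Sum>n. A j n * z n \<phi>)"
    and e: "0 < e"
  obtains y where "y \<in> lp_seq p" "lp_norm p y \<le> lp_norm p z + e"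
    "(\<Sum>j<m. norm (k j - (\<Sum>n. A j n *\<^sub>C y n))) \<le> e"
proof -
  have p0: "0 < p" using p by simp
  \<comment> \<open>A total cost below \<open>\<parallel>z\<parallel>\<^sub>p + e\<close> then leaves at most \<open>e\<close> for the error.\<close>
  define c where "c = (lp_norm p z + e) / e"
  have c: "0 < c" using e lp_norm_nonneg[of p z] by (simp add: c_def add_nonneg_pos)
  define comb where "comb y j = (\<Sum>n. A j n *\<^sub>C y n)" for y :: "nat \<Rightarrow> 'b" and j
  define cost where "cost w y = lp_norm p y + c * (\<Sum>j<m. norm (w j - comb y j))" for w y :: "nat \<Rightarrow> 'b"
  define q where "q w = (INF y\<in>lp_seq p. cost w y)" for w
  have comb_add: "comb (y + y') j = comb y j + comb y' j"
    if "y \<in> lp_seq p" "y' \<in> lp_seq p" "j < m" for y y' j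
    using suminf_add[OF dual_ball_pairing(1)[OF p0 A that(1)] dual_ball_pairing(1)[OF p0 A that(2)]] that
    by (simp add: comb_def scaleC_add_right)
  have comb_scale: "comb (d *\<^sub>C y) j = d *\<^sub>C comb y j" if "y \<in> lp_seq p" "j < m" for d y j
    using bounded_linear.suminf[OF bounded_linear_scaleC_right dual_ball_pairing(1)[OF p0 A that(1)], of j d] that
    by (simp add: comb_def scaleC_fun_def scaleC_scaleC mult.commute)
  have cost_nonneg: "0 \<le> cost w y" for w y
    using c by (simp add: cost_def lp_norm_nonneg sum_nonneg)
  have q_props: "q (w + w') \<le> q w + q w'" "q (d *\<^sub>C w) = norm d * q w" for w w' d
  proof -
    have add: "cost (w + w') (y + y') \<le> cost w y + cost w' y'"
      if y: "y \<in> lp_seq p" "y' \<in> lp_seq p" for w w' y y'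
    proof -
      have "(\<Sum>j<m. norm ((w + w') j - comb (y + y') j)) \<le>
          (\<Sum>j<m. norm (w j - comb y j) + norm (w' j - comb y' j))"
      proof (rule sum_mono)
        fix j assume "j \<in> {..<m}"
        then have "(w + w') j - comb (y + y') j = (w j - comb y j) + (w' j - comb y' j)"
          using comb_add[OF y] by simp
        then show "norm ((w + w') j - comb (y + y') j) \<le> norm (w j - comb y j) + norm (w' j - comb y' j)"
          by (simp only: norm_triangle_ineq)
      qed
      then have "c * (\<Sum>j<m. norm ((w + w') j - comb (y + y') j)) \<le>
          c * (\<Sum>j<m. norm (w j - comb y j)) + c * (\<Sum>j<m. norm (w' j - comb y' j))"
        using c by (simp add: sum.distrib flip: distrib_left)
      moreover have "lp_norm p (y + y') \<le> lp_norm p y + lp_norm p y'"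
        using minkowski(2)[OF p y] by (simp add: plus_fun_def)
      ultimately show ?thesis unfolding cost_def by linarith
    qed
    have scale: "cost (d *\<^sub>C w) (d *\<^sub>C y) = norm d * cost w y" if y: "y \<in> lp_seq p" for d w y
    proof -
      have "(\<Sum>j<m. norm ((d *\<^sub>C w) j - comb (d *\<^sub>C y) j)) = (\<Sum>j<m. norm d * norm (w j - comb y j))"
        using comb_scale[OF y] by (intro sum.cong)
          (simp_all add: scaleC_fun_def norm_scaleC flip: complex_vector.scale_right_diff_distrib)
      moreover have "lp_norm p (d *\<^sub>C y) = norm d * lp_norm p y"
        using lp_norm_scaleC(2)[OF p0 y] by (simp add: scaleC_fun_def)
      ultimately show ?thesis
        unfolding cost_def by (simp add: distrib_left mult.left_commute flip: sum_distrib_left)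
    qed
    show "q (w + w') \<le> q w + q w'" "q (d *\<^sub>C w) = norm d * q w"
      unfolding q_def
      using INF_seminorm[of "lp_seq p" cost, OF subspace_lp_seq[OF p] cost_nonneg add scale] by blast+
  qed
  have q_le_cost: "q w \<le> cost w y" if "y \<in> lp_seq p" for w y
    unfolding q_def using cost_nonneg by (intro cINF_lower[OF _ that] bdd_belowI2[where m = 0])
  have zero_lp: "(\<lambda>n. 0 :: 'b) \<in> lp_seq p" using p0 by (rule lp_zero)
  have q_le_sum: "q w \<le> c * (\<Sum>j<m. norm (w j))" for w
    using q_le_cost[OF zero_lp, of w] p0 by (simp add: cost_def comb_def lp_zero)
  have q_le_lp: "q w \<le> lp_norm p y" if "y \<in> lp_seq p" "\<And>j. j < m \<Longrightarrow> w j = comb y j" for w y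
    using q_le_cost[OF that(1), of w] that(2) by (simp add: cost_def)

  obtain g where g: "\<And>x y. g (x + y) = g x + g y" "\<And>c x. g (c *\<^sub>C x) = c * g x"
    "\<And>x. norm (g x) \<le> q x" "norm (g k) = q k"
    using seminorm_norming_functional[of q k, OF q_props] by blast
  have g0: "g 0 = 0" using g(2)[of 0 0] by simp
  define single where "single j v = (\<lambda>i. if i = j then v else 0 :: 'b)" for j :: nat and v
  define \<Phi> where "\<Phi> j = CBlinfun (\<lambda>v. if j < m then g (single j v) else 0)" for j
  have \<Phi>: "\<Phi> j v = g (single j v)" if "j < m" for j v
  proof -
    have "bounded_clinear (\<lambda>v. g (single j v))"
    proof (rule bounded_clinear_intro)
      have "single j (v + w) = single j v + single j w" "single j (d *\<^sub>C v) = d *\<^sub>C single j v" for v w d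
        by (auto simp: single_def fun_eq_iff scaleC_fun_def)
      then show "g (single j (v + w)) = g (single j v) + g (single j w)"
        "g (single j (d *\<^sub>C v)) = d *\<^sub>C g (single j v)" for v w d
        by (simp_all add: g(1,2))
      fix v
      have "norm (g (single j v)) \<le> c * (\<Sum>i<m. norm (single j v i))"
        by (rule order_trans[OF g(3) q_le_sum])
      also have "(\<Sum>i<m. norm (single j v i)) = (\<Sum>i<m. if i = j then norm v else 0)"
        by (intro sum.cong) (auto simp: single_def)
      also have "\<dots> = norm v" using that by simp
      finally show "norm (g (single j v)) \<le> norm v * c" by (simp add: mult.commute)
    qed
    then show ?thesis using that by (simp add: \<Phi>_def CBlinfun_inverse)
  qed
  have g_trunc: "g (\<lambda>i. if i < N then w i else 0) = (\<Sum>j<N. \<Phi> j (w j))" if "N \<le> m" for N w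
    using that
  proof (induction N)
    case 0
    then show ?case using g0 by (simp add: zero_fun_def)
  next
    case (Suc N)
    have "(\<lambda>i. if i < Suc N then w i else 0) = (\<lambda>i. if i < N then w i else 0) + single N (w N)"
      by (auto simp: fun_eq_iff single_def less_Suc_eq)
    then show ?case using Suc by (simp add: g(1) \<Phi>)
  qed
  have g_eq: "g w = (\<Sum>j<m. \<Phi> j (w j))" for w
  proof -
    \<comment> \<open>Coordinates from \<open>m\<close> on cost nothing, so \<open>g\<close> vanishes on them.\<close>
    define w' where "w' = (\<lambda>i. if i < m then 0 else w i)"
    have "norm (g w') \<le> c * (\<Sum>j<m. norm (w' j))"
      by (rule order_trans[OF g(3) q_le_sum])
    then have "g w' = 0" by (simp add: w'_def)
    moreover have "w = (\<lambda>i. if i < m then w i else 0) + w'"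
      by (auto simp: w'_def fun_eq_iff)
    ultimately show ?thesis using g(1) g_trunc[of m w] by (metis add.right_neutral order_refl)
  qed
  define \<psi> where "\<psi> n = (\<Sum>j<m. A j n *\<^sub>C \<Phi> j)" for n
  have \<psi>: "\<psi> n v = (\<Sum>j<m. A j n * \<Phi> j v)" for n v
    unfolding \<psi>_def using linear_sum[OF bounded_linear.linear[OF bounded_linear_apply_at]]
    by (simp add: linear_sum[OF bounded_linear.linear[OF bounded_linear_apply_at]])
  have "(\<lambda>n. complex_of_real (norm (\<psi> n))) \<in> dual_ball p"
  proof (rule norms_in_dual_ball[OF p])
    fix N and y :: "nat \<Rightarrow> 'b"
    define y' where "y' n = (if n < N then y n else 0)" for n
    have y'_lp: "y' \<in> lp_seq p"
      unfolding lp_seq_def mem_Collect_eq by (rule summable_finite[of "{..<N}"]) (auto simp: y'_def)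
    have comb_y': "comb y' j = (\<Sum>n<N. A j n *\<^sub>C y n)" for j
    proof -
      have "comb y' j = (\<Sum>n<N. A j n *\<^sub>C y' n)"
        unfolding comb_def by (rule suminf_finite) (auto simp: y'_def)
      then show ?thesis by (simp add: y'_def)
    qed
    have "(\<Sum>n<N. \<psi> n (y n)) = (\<Sum>j<m. \<Sum>n<N. A j n * \<Phi> j (y n))"
      unfolding \<psi> by (rule sum.swap)
    also have "\<dots> = g (comb y')"
      by (simp add: g_eq comb_y' linear_sum[OF bounded_linear.linear[OF cblinfun_bounded_linear]])
    finally have "norm (\<Sum>n<N. \<psi> n (y n)) \<le> q (comb y')" by (simp add: g(3))
    also have "\<dots> \<le> lp_norm p y'" by (rule q_le_lp[OF y'_lp]) simp
    also have "\<dots> = (\<Sum>n<N. norm (y n) powr p) powr (1 / p)"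
    proof -
      have "(\<Sum>n. norm (y' n) powr p) = (\<Sum>n<N. norm (y' n) powr p)"
        by (rule suminf_finite) (auto simp: y'_def)
      then show ?thesis by (simp add: lp_norm_def y'_def)
    qed
    finally show "norm (\<Sum>n<N. \<psi> n (y n)) \<le> (\<Sum>n<N. norm (y n) powr p) powr (1 / p)" .
  qed
  note pairing = dual_ball_pairing_norm[OF p0 this z, simplified]
  have "g k = (\<Sum>j<m. \<Sum>n. A j n * z n (\<Phi> j))"
    by (simp add: g_eq k)
  also have "\<dots> = (\<Sum>n. \<Sum>j<m. A j n * z n (\<Phi> j))"
  proof (rule suminf_sum[symmetric])
    fix j assume "j \<in> {..<m}"
    then show "summable (\<lambda>n. A j n * z n (\<Phi> j))"
      using dual_ball_pairing(1)[OF p0 A lp_norm_apply_le(1)[OF p0 z], of j "\<Phi> j"] by simp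
  qed
  also have "\<dots> = (\<Sum>n. z n (\<psi> n))"
    by (simp add: \<psi>_def linear_sum[OF bounded_linear.linear[OF cblinfun_bounded_linear]])
  finally have "norm (g k) = norm (\<Sum>n. z n (\<psi> n))" by simp
  also have "\<dots> \<le> (\<Sum>n. norm (\<psi> n) * norm (z n))"
  proof (rule norm_suminf_le)
    show "norm (z n (\<psi> n)) \<le> norm (\<psi> n) * norm (z n)" for n
      using norm_cblinfun_apply_le[of "z n" "\<psi> n"] by (simp add: mult.commute)
  qed (rule pairing(1))
  also have "\<dots> \<le> lp_norm p z" by (rule pairing(2))
  finally have "q k \<le> lp_norm p z" using g(4) by simp
  then have "(INF y\<in>lp_seq p. cost k y) < lp_norm p z + e"
    using e by (simp add: q_def)
  moreover have "(lp_seq p :: (nat \<Rightarrow> 'b) set) \<noteq> {}" using zero_lp by blast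
  ultimately obtain y where y: "y \<in> lp_seq p" "cost k y < lp_norm p z + e"
    using cINF_less_iff[OF _ bdd_belowI2[where m = 0], of "lp_seq p" "cost k"] cost_nonneg by auto
  define err where "err = (\<Sum>j<m. norm (k j - comb y j))"
  have "0 \<le> c * err" using c by (simp add: err_def sum_nonneg)
  then have le: "lp_norm p y \<le> lp_norm p z + e" "c * err \<le> lp_norm p z + e"
    using y(2) lp_norm_nonneg[of p y] unfolding cost_def err_def[symmetric] by linarith+
  have "c * err \<le> c * e" using le(2) e by (simp add: c_def)
  then have "err \<le> e" using c by simp
  then show thesis using that[OF y(1) le(1)] by (simp add: err_def comb_def)
qed

section \<open>Descent from the bidual for dominated sets\<close>

text \<open>
  The first \<open>N\<close> coordinates lie in a bounded set of finite dimension. Rounding real and imaginary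
  parts to multiples of \<open>e / 2\<close> leaves finitely many cells, and \<open>F\<close> picks a point in each nonempty
  one.
\<close>

lemma finite_sup_net:
  fixes a :: "'k \<Rightarrow> nat \<Rightarrow> complex"
  assumes bound: "\<And>k n. k \<in> D \<Longrightarrow> norm (a k n) \<le> 1" and e: "0 < e"
  obtains F where "finite F" "F \<subseteq> D" "\<And>k. k \<in> D \<Longrightarrow> \<exists>k'\<in>F. \<forall>n<N. norm (a k n - a k' n) \<le> e"
proof -
  define h where "h = e / 2"
  have h: "0 < h" using e by (simp add: h_def)
  define B where "B = \<lfloor>1 / h\<rfloor> + 1"
  define cell where "cell k = (\<lambda>n\<in>{..<N}. (\<lfloor>Re (a k n) / h\<rfloor>, \<lfloor>Im (a k n) / h\<rfloor>))" for k
  have floor_range: "\<lfloor>x / h\<rfloor> \<in> {- B..B}" if "\<bar>x\<bar> \<le> 1" for x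
  proof -
    have "x / h \<le> 1 / h" "- (1 / h) \<le> x / h"
      using that h by (auto simp: field_simps)
    then show ?thesis unfolding B_def by simp linarith
  qed
  have "cell ` D \<subseteq> PiE {..<N} (\<lambda>_. {- B..B} \<times> {- B..B})"
  proof clarify
    fix k assume k: "k \<in> D"
    have "\<bar>Re (a k n)\<bar> \<le> 1" "\<bar>Im (a k n)\<bar> \<le> 1" for n
      using bound[OF k, of n] abs_Re_le_cmod[of "a k n"] abs_Im_le_cmod[of "a k n"] by linarith+
    then show "cell k \<in> PiE {..<N} (\<lambda>_. {- B..B} \<times> {- B..B})"
      using floor_range unfolding cell_def by (intro restrict_PiE_iff[THEN iffD2]) blast
  qed
  then have fin: "finite (cell ` D)"
    by (rule finite_subset) (intro finite_PiE finite_lessThan finite_cartesian_product finite_atLeastAtMost_int)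
  then obtain F where F: "F \<subseteq> D" "finite F" "cell ` F = cell ` D"
    using finite_subset_image[OF fin subset_refl] by metis
  have close: "\<bar>x - y\<bar> \<le> h" if "\<lfloor>x / h\<rfloor> = \<lfloor>y / h\<rfloor>" for x y
  proof -
    have "\<bar>x / h - y / h\<bar> \<le> 1" using that by linarith
    then have "\<bar>(x - y) / h\<bar> \<le> 1" by (simp add: diff_divide_distrib)
    then show ?thesis using h by (simp add: field_simps)
  qed
  have "\<exists>k'\<in>F. \<forall>n<N. norm (a k n - a k' n) \<le> e" if "k \<in> D" for k
  proof -
    obtain k' where k': "k' \<in> F" "cell k = cell k'" using F(3) \<open>k \<in> D\<close> by (metis imageE imageI)
    have "norm (a k n - a k' n) \<le> e" if "n < N" for n
    proof -
      have "\<lfloor>Re (a k n) / h\<rfloor> = \<lfloor>Re (a k' n) / h\<rfloor>" "\<lfloor>Im (a k n) / h\<rfloor> = \<lfloor>Im (a k' n) / h\<rfloor>"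
        using fun_cong[OF k'(2), of n] that by (simp_all add: cell_def)
      from close[OF this(1)] close[OF this(2)] show ?thesis
        using cmod_le[of "a k n - a k' n"] by (simp add: h_def)
    qed
    then show ?thesis using k'(1) by blast
  qed
  with F show thesis using that by blast
qed

lemma lp_norm_finite_support_le:
  assumes p: "1 \<le> p" and r: "\<And>n. m \<le> n \<Longrightarrow> r n = 0"
  shows "r \<in> lp_seq p" "lp_norm p r \<le> (\<Sum>n<m. norm (r n))"
proof -
  define S where "S = (\<Sum>n<m. norm (r n))"
  have S: "0 \<le> S" by (simp add: S_def sum_nonneg)
  have partial: "(\<Sum>n<N. norm (r n)) \<le> S" for N
  proof -
    have "(\<Sum>n<N. norm (r n)) \<le> (\<Sum>n<max m N. norm (r n))"
      by (intro sum_mono2) auto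
    also have "\<dots> = S"
      unfolding S_def using r by (intro sum.mono_neutral_right) (auto simp: not_less)
    finally show ?thesis .
  qed
  have "(\<Sum>n<N. norm (r n) powr p) \<le> S powr p" for N
  proof -
    have "norm (r n) \<le> S" for n
      using partial[of "Suc n"] sum_nonneg[of "{..<n}" "\<lambda>n. norm (r n)"] by simp
    then have "norm (r n) * norm (r n) powr (p - 1) \<le> norm (r n) * S powr (p - 1)" for n
      using p by (intro mult_left_mono powr_mono2) auto
    then have "norm (r n) powr p \<le> norm (r n) * S powr (p - 1)" for n
      by (simp add: powr_mult_base)
    then have "(\<Sum>n<N. norm (r n) powr p) \<le> (\<Sum>n<N. norm (r n)) * S powr (p - 1)"
      unfolding sum_distrib_right by (rule sum_mono)
    also have "\<dots> \<le> S * S powr (p - 1)"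
      using partial by (intro mult_right_mono) auto
    finally show ?thesis using S by (simp add: powr_mult_base)
  qed
  then show "r \<in> lp_seq p" "lp_norm p r \<le> (\<Sum>n<m. norm (r n))"
    using lp_normI[of p S r] p S by (auto simp: S_def)
qed

text \<open>
  The first \<open>N\<close> terms are small because the coefficients are close, the others because the tail of
  \<open>x\<close> is paired with two elements of the dual ball.
\<close>

lemma dual_ball_difference_bound:
  assumes p: "1 \<le> p" and ab: "a \<in> dual_ball p" "b \<in> dual_ball p"
    and x: "x \<in> lp_seq p" and close: "\<And>n. n < N \<Longrightarrow> norm (a n - b n) \<le> h"
  shows "norm ((\<Sum>n. a n * x n) - (\<Sum>n. b n * x n)) \<le>
    h * real N * lp_norm p x + 2 * lp_norm p (lp_tail N x)"
proof -
  have p0: "0 < p" using p by simp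
  note tail = lp_tail_in_lp[OF p0 x, of N]
  have split: "(\<Sum>n. d n * x n) = (\<Sum>n<N. d n * x n) + (\<Sum>n. d n * lp_tail N x n)"
    if d: "d \<in> dual_ball p" for d
  proof -
    have "(\<Sum>n. d n * x n) = (\<Sum>n. d (n + N) * x (n + N)) + (\<Sum>n<N. d n * x n)"
      using dual_ball_pairing(1)[OF p0 d x] by (intro suminf_split_initial_segment) simp
    moreover have "(\<Sum>n. d n * lp_tail N x n) = (\<Sum>n. d (n + N) * lp_tail N x (n + N)) +
        (\<Sum>n<N. d n * lp_tail N x n)"
      using dual_ball_pairing(1)[OF p0 d tail] by (intro suminf_split_initial_segment) simp
    ultimately show ?thesis by (simp add: lp_tail_def)
  qed
  have "norm (\<Sum>n<N. (a n - b n) * x n) \<le> (\<Sum>n<N. h * lp_norm p x)"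
  proof (rule order_trans[OF norm_sum sum_mono])
    fix n assume "n \<in> {..<N}"
    then show "norm ((a n - b n) * x n) \<le> h * lp_norm p x"
      using close[of n] norm_le_lp_norm[OF p0 x, of n]
      by (auto simp: norm_mult intro: mult_mono order_trans[OF norm_ge_zero])
  qed
  moreover have "norm (\<Sum>n. a n * lp_tail N x n) \<le> lp_norm p (lp_tail N x)"
    "norm (\<Sum>n. b n * lp_tail N x n) \<le> lp_norm p (lp_tail N x)"
    using dual_ball_pairing(2)[OF p0 ab(1) tail] dual_ball_pairing(2)[OF p0 ab(2) tail] by simp_all
  moreover have "(\<Sum>n. a n * x n) - (\<Sum>n. b n * x n) = (\<Sum>n<N. (a n - b n) * x n) +
      ((\<Sum>n. a n * lp_tail N x n) - (\<Sum>n. b n * lp_tail N x n))"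
    by (simp add: split[OF ab(1)] split[OF ab(2)] left_diff_distrib sum_subtractf)
  ultimately show ?thesis
    using norm_triangle_ineq[of "\<Sum>n<N. (a n - b n) * x n"
        "(\<Sum>n. a n * lp_tail N x n) - (\<Sum>n. b n * lp_tail N x n)"]
      norm_triangle_ineq4[of "\<Sum>n. a n * lp_tail N x n" "\<Sum>n. b n * lp_tail N x n"]
    by (simp add: mult.commute mult.left_commute)
qed

text \<open>
  Every dominated point \<open>k\<close> is close in its first coefficients to one of finitely many points
  \<open>\<kappa>\<^sub>j\<close>, for which \<open>finite_approximation\<close> provides \<open>y\<close>. Subtract \<open>b = \<Sum>\<^sub>n (A\<^sub>j)\<^sub>n y\<^sub>n\<close>, where \<open>A\<^sub>j\<close> are the
  coefficients of \<open>\<kappa>\<^sub>j\<close>. The remainder \<open>k - b = (k - \<kappa>\<^sub>j) + r\<^sub>j\<close> is dominated by three small sequences: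
  a multiple of \<open>z\<close> for the close coefficients, a tail of \<open>z\<close>, and the sequence of the finitely
  many errors \<open>r\<^sub>j\<close>, which lie in \<open>Y\<close>.
\<close>

lemma domination_step:
  fixes z :: "nat \<Rightarrow> 'b::cbanach cdual cdual"
  assumes p: "1 \<le> p" and z: "z \<in> lp_seq p" and e: "0 < e"
  obtains y z' where "y \<in> lp_seq p" "lp_norm p y \<le> lp_norm p z + e" "z' \<in> lp_seq p" "lp_norm p z' \<le> e"
    "\<And>k. dominated p z k \<Longrightarrow> \<exists>k'. dominated p z' k' \<and>
      (\<forall>\<phi> :: 'b cdual. norm (cblinfun_apply \<phi> (k - k')) \<le> lp_norm p (\<lambda>n. cblinfun_apply \<phi> (y n)))"
proof -
  have p0: "0 < p" using p by simp
  \<comment> \<open>The remainder is assembled from pieces of size \<open>d\<close>, \<open>2 d\<close> and \<open>d\<close>, and each of the two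
    combinations adds another \<open>d\<close>.\<close>
  define d where "d = e / 10"
  have d: "0 < d" using e by (simp add: d_def)
  obtain N where N: "lp_norm p (lp_tail N z) < d"
    using order_tendstoD(2)[OF lp_norm_tail_tendsto[OF p0 z] d] by (auto simp: eventually_sequentially)
  define h where "h = d / (real N * lp_norm p z + 1)"
  have h: "0 < h" "h * real N * lp_norm p z \<le> d"
  proof -
    have nn: "0 \<le> real N * lp_norm p z" by (simp add: lp_norm_nonneg)
    then show "0 < h" using d by (simp add: h_def add_nonneg_pos)
    have "h * (real N * lp_norm p z) \<le> h * (real N * lp_norm p z + 1)"
      using \<open>0 < h\<close> by (intro mult_left_mono) auto
    also have "\<dots> = d" using nn by (simp add: h_def)
    finally show "h * real N * lp_norm p z \<le> d" by (simp add: mult.assoc)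
  qed
  define D where "D = {k. dominated p z k}"
  have "\<forall>k\<in>D. \<exists>a\<in>dual_ball p. \<forall>\<phi>. cblinfun_apply \<phi> k = (\<Sum>n. a n * z n \<phi>)"
  proof
    fix k assume "k \<in> D"
    then show "\<exists>a\<in>dual_ball p. \<forall>\<phi>. cblinfun_apply \<phi> k = (\<Sum>n. a n * z n \<phi>)"
      using dominated_coefficients[OF p z, of k] unfolding D_def by blast
  qed
  then obtain \<alpha> where \<alpha>: "\<And>k. k \<in> D \<Longrightarrow> \<alpha> k \<in> dual_ball p"
    "\<And>k \<phi>. k \<in> D \<Longrightarrow> cblinfun_apply \<phi> k = (\<Sum>n. \<alpha> k n * z n \<phi>)"
    by metis
  obtain F where F: "finite F" "F \<subseteq> D" "\<And>k. k \<in> D \<Longrightarrow> \<exists>k'\<in>F. \<forall>n<N. norm (\<alpha> k n - \<alpha> k' n) \<le> h"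
    using finite_sup_net[of D \<alpha> h N] dual_ball_norm_le_1[OF \<alpha>(1)] h(1) by blast
  obtain m \<kappa> where \<kappa>: "F = \<kappa> ` {i::nat. i < m}"
    using finite_imp_nat_seg_image_inj_on[OF F(1)] by blast
  have \<kappa>_D: "\<kappa> j \<in> D" if "j < m" for j using that F(2) \<kappa> by blast
  obtain y where y: "y \<in> lp_seq p" "lp_norm p y \<le> lp_norm p z + d"
    "(\<Sum>j<m. norm (\<kappa> j - (\<Sum>n. \<alpha> (\<kappa> j) n *\<^sub>C y n))) \<le> d"
  proof (rule finite_approximation[OF p z])
    show "\<alpha> (\<kappa> j) \<in> dual_ball p" if "j < m" for j
      by (rule \<alpha>(1)[OF \<kappa>_D[OF that]])
    show "cblinfun_apply \<phi> (\<kappa> j) = (\<Sum>n. \<alpha> (\<kappa> j) n * z n \<phi>)" if "j < m" for j \<phi>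
      by (rule \<alpha>(2)[OF \<kappa>_D[OF that]])
  qed (use d in blast)+
  define r where "r j = (if j < m then \<kappa> j - (\<Sum>n. \<alpha> (\<kappa> j) n *\<^sub>C y n) else 0)" for j
  have r: "r \<in> lp_seq p" "lp_norm p r \<le> d"
  proof -
    have "r n = 0" if "m \<le> n" for n using that by (simp add: r_def)
    note * = lp_norm_finite_support_le[OF p, of m r, OF this]
    show "r \<in> lp_seq p" by (rule *(1))
    have "(\<Sum>n<m. norm (r n)) \<le> d" using y(3) by (simp add: r_def)
    then show "lp_norm p r \<le> d" using *(2) by linarith
  qed
  define u v where "u n = complex_of_real (h * real N) *\<^sub>C z n"
    and "v n = complex_of_real 2 *\<^sub>C lp_tail N z n" for n
  have u: "u \<in> lp_seq p" "lp_norm p u \<le> d"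
    using lp_norm_scaleC[OF p0 z, of "complex_of_real (h * real N)"] h
    unfolding u_def[abs_def] by (simp_all add: norm_mult)
  have v: "v \<in> lp_seq p" "lp_norm p v \<le> 2 * d"
    using lp_norm_scaleC[OF p0 lp_tail_in_lp[OF p0 z, of N], of "complex_of_real 2"] N
    unfolding v_def[abs_def] by simp_all
  obtain x where x: "x \<in> lp_seq p" "lp_norm p x \<le> lp_norm p u + lp_norm p v + d"
    "\<And>L :: 'b cdual cdual \<Rightarrow> complex. bounded_linear L \<Longrightarrow>
      lp_norm p (\<lambda>n. L (u n)) + lp_norm p (\<lambda>n. L (v n)) \<le> lp_norm p (\<lambda>n. L (x n))"
    using combine_two_lp_seminorms[OF p u(1) v(1) d] by blast
  \<comment> \<open>All errors \<open>r j\<close> together form one sequence, whose \<open>j\<close>-th member dominates \<open>r j\<close>.\<close>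
  define s where "s n = bidual_embedding (r n)" for n
  have s: "s \<in> lp_seq p" "lp_norm p s \<le> d"
    using lp_bidual_embedding[OF p0 r(1)] r(2) unfolding s_def[abs_def] by auto
  obtain z' where z': "z' \<in> lp_seq p" "lp_norm p z' \<le> lp_norm p x + lp_norm p s + d"
    "\<And>L :: 'b cdual cdual \<Rightarrow> complex. bounded_linear L \<Longrightarrow>
      lp_norm p (\<lambda>n. L (x n)) + lp_norm p (\<lambda>n. L (s n)) \<le> lp_norm p (\<lambda>n. L (z' n))"
    using combine_two_lp_seminorms[OF p x(1) s(1) d] by blast
  have split: "\<exists>k'. dominated p z' k' \<and>
      (\<forall>\<phi> :: 'b cdual. norm (cblinfun_apply \<phi> (k - k')) \<le> lp_norm p (\<lambda>n. cblinfun_apply \<phi> (y n)))"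
    if "dominated p z k" for k
  proof -
    have k: "k \<in> D" using that by (simp add: D_def)
    obtain j where j: "j < m" "\<And>n. n < N \<Longrightarrow> norm (\<alpha> k n - \<alpha> (\<kappa> j) n) \<le> h"
      using F(3)[OF k] \<kappa> by blast
    define b where "b = (\<Sum>n. \<alpha> (\<kappa> j) n *\<^sub>C y n)"
    have "norm (\<phi> (k - b)) \<le> lp_norm p (\<lambda>n. z' n \<phi>)" for \<phi> :: "'b cdual"
    proof -
      have "\<phi> (k - b) = (\<phi> k - \<phi> (\<kappa> j)) + \<phi> (r j)"
        using j(1) by (simp add: r_def b_def)
      then have "norm (\<phi> (k - b)) \<le> norm (\<phi> k - \<phi> (\<kappa> j)) + norm (\<phi> (r j))"
        by (simp only: norm_triangle_ineq)
      also have "norm (\<phi> k - \<phi> (\<kappa> j)) \<le>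
          h * real N * lp_norm p (\<lambda>n. z n \<phi>) + 2 * lp_norm p (lp_tail N (\<lambda>n. z n \<phi>))"
        unfolding \<alpha>(2)[OF k] \<alpha>(2)[OF \<kappa>_D[OF j(1)]]
        by (rule dual_ball_difference_bound[OF p \<alpha>(1)[OF k] \<alpha>(1)[OF \<kappa>_D[OF j(1)]]
              lp_norm_apply_le(1)[OF p0 z] j(2)])
      also have "h * real N * lp_norm p (\<lambda>n. z n \<phi>) = lp_norm p (\<lambda>n. u n \<phi>)"
        using lp_norm_scaleC(2)[OF p0 lp_norm_apply_le(1)[OF p0 z], of "complex_of_real (h * real N)" \<phi>] h
        by (simp add: u_def norm_mult)
      also have "2 * lp_norm p (lp_tail N (\<lambda>n. z n \<phi>)) = lp_norm p (\<lambda>n. v n \<phi>)"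
      proof -
        have "lp_tail N (\<lambda>n. z n \<phi>) = (\<lambda>n. lp_tail N z n \<phi>)"
          by (auto simp: lp_tail_def)
        then show ?thesis
          using lp_norm_scaleC(2)[OF p0 lp_norm_apply_le(1)[OF p0 lp_tail_in_lp[OF p0 z, of N]], of "complex_of_real 2" \<phi>]
          by (simp add: v_def)
      qed
      also have "norm (\<phi> (r j)) \<le> lp_norm p (\<lambda>n. s n \<phi>)"
        using norm_le_lp_norm[OF p0 lp_norm_apply_le(1)[OF p0 s(1)], of j \<phi>]
        by (simp add: s_def bidual_embedding.rep_eq)
      finally show ?thesis
        using x(3)[OF bounded_linear_apply_at[of \<phi>]] z'(3)[OF bounded_linear_apply_at[of \<phi>]] by linarith
    qed
    then have "dominated p z' (k - b)" by (simp add: dominated_def)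
    moreover have "norm (cblinfun_apply \<phi> (k - (k - b))) \<le> lp_norm p (\<lambda>n. cblinfun_apply \<phi> (y n))" for \<phi> :: "'b cdual"
      using dual_combination_bound(1)[OF p \<alpha>(1)[OF \<kappa>_D[OF j(1)]] y(1), where \<phi> = \<phi>] by (simp add: b_def)
    ultimately show ?thesis by blast
  qed
  have "lp_norm p y \<le> lp_norm p z + e" using y(2) e by (simp add: d_def)
  moreover have "lp_norm p z' \<le> e" using z'(2) x(2) u(2) v(2) s(2) e by (simp add: d_def)
  ultimately show thesis using that[OF y(1) _ z'(1) _ split] by blast
qed

lemma dominated_norm_le:
  fixes z :: "nat \<Rightarrow> 'b::complex_normed_vector cdual cdual" and \<phi> :: "'b cdual"
  assumes "1 \<le> p" "z \<in> lp_seq p" "dominated p z k"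
  shows "norm (cblinfun_apply \<phi> k) \<le> norm \<phi> * lp_norm p z"
  using assms(1,3) order_trans[OF _ lp_norm_apply_le(2)[OF _ assms(2)]] by (simp add: dominated_def)

text \<open>
  Apply \<open>domination_step\<close> repeatedly, with the new sequence in the bidual as input and errors
  \<open>\<epsilon>\<^sub>i\<close> that sum to \<open>e / 2\<close>. The sequences \<open>y\<^sub>i\<close> in \<open>Y\<close> have norms at most \<open>\<parallel>z\<parallel>\<^sub>p + \<epsilon>\<^sub>0\<close> and
  \<open>\<epsilon>\<^sub>i\<^sub>-\<^sub>1 + \<epsilon>\<^sub>i\<close>, in total \<open>\<parallel>z\<parallel>\<^sub>p + e\<close>.
\<close>

lemma dominated_iterate:
  fixes z :: "nat \<Rightarrow> 'b::cbanach cdual cdual"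
  assumes p: "1 \<le> p" and z: "z \<in> lp_seq p" and e: "0 < e"
  obtains u :: "nat \<Rightarrow> 'b" where "u \<in> lp_seq p" "lp_norm p u \<le> lp_norm p z + e"
    "\<And>k. dominated p z k \<Longrightarrow> dominated p (\<lambda>n. bidual_embedding (u n)) k"
proof -
  have p0: "0 < p" using p by simp
  \<comment> \<open>The relation between input \<open>w\<close>, \<open>d\<close> and output \<open>y\<close>, \<open>w'\<close> of one domination step.\<close>
  define R where "R w d y w' \<longleftrightarrow> y \<in> lp_seq p \<and> lp_norm p y \<le> lp_norm p w + d \<and> w' \<in> lp_seq p \<and>
      lp_norm p w' \<le> d \<and> (\<forall>k. dominated p w k \<longrightarrow> (\<exists>k'. dominated p w' k' \<and>
        (\<forall>\<phi> :: 'b cdual. norm (cblinfun_apply \<phi> (k - k')) \<le> lp_norm p (\<lambda>n. cblinfun_apply \<phi> (y n)))))"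
    for w w' :: "nat \<Rightarrow> 'b cdual cdual" and d y
  have "\<exists>y w'. R w d y w'" if "w \<in> lp_seq p" "0 < d" for w d
    using domination_step[OF p that] unfolding R_def by metis
  then obtain Y W where YW: "\<And>w d. w \<in> lp_seq p \<Longrightarrow> 0 < d \<Longrightarrow> R w d (Y w d) (W w d)"
    by metis
  define \<epsilon> where "\<epsilon> i = e / 2 * (1 / 2) ^ Suc i" for i :: nat
  have \<epsilon>_pos: "0 < \<epsilon> i" for i using e by (simp add: \<epsilon>_def)
  have \<epsilon>_sums: "\<epsilon> sums (e / 2)"
    using sums_mult[OF power_half_series, of "e / 2"] by (simp add: \<epsilon>_def[abs_def])
  define zs where "zs = rec_nat z (\<lambda>i w. W w (\<epsilon> i))"
  have zs_simps: "zs 0 = z" "zs (Suc i) = W (zs i) (\<epsilon> i)" for i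
    by (simp_all add: zs_def)
  have zs_lp: "zs i \<in> lp_seq p" for i
  proof (induction i)
    case (Suc i)
    then show ?case using YW[OF Suc \<epsilon>_pos] by (simp add: zs_simps R_def)
  qed (simp add: zs_simps z)
  define ys where "ys i = Y (zs i) (\<epsilon> i)" for i
  have step: "R (zs i) (\<epsilon> i) (ys i) (zs (Suc i))" for i
    using YW[OF zs_lp \<epsilon>_pos] by (simp add: ys_def zs_simps)
  define s where "s i = (case i of 0 \<Rightarrow> lp_norm p z | Suc j \<Rightarrow> \<epsilon> j) + \<epsilon> i" for i
  have zs_norm: "lp_norm p (zs (Suc i)) \<le> \<epsilon> i" for i
    using step[of i] by (simp add: R_def)
  have ys: "ys i \<in> lp_seq p" "lp_norm p (ys i) \<le> s i" for i
    using step[of i] zs_norm[of "i - 1"] by (auto simp: R_def s_def zs_simps split: nat.split)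
  have s_pos: "0 < s i" for i
    using \<epsilon>_pos lp_norm_nonneg[of p z] by (auto simp: s_def add_nonneg_pos add_pos_pos split: nat.split)
  have "(\<lambda>i. case i of 0 \<Rightarrow> lp_norm p z | Suc j \<Rightarrow> \<epsilon> j) sums (e / 2 + lp_norm p z)"
    using sums_Suc[of "\<lambda>i. case i of 0 \<Rightarrow> lp_norm p z | Suc j \<Rightarrow> \<epsilon> j"] \<epsilon>_sums by simp
  then have s_sums: "s sums (e / 2 + lp_norm p z + e / 2)"
    unfolding s_def by (intro sums_add \<epsilon>_sums)
  obtain u where u: "u \<in> lp_seq p" "lp_norm p u \<le> suminf s"
    "\<And>(L :: 'b \<Rightarrow> complex) M. bounded_linear L \<Longrightarrow>
      (\<Sum>i<M. lp_norm p (\<lambda>n. L (ys i n))) \<le> lp_norm p (\<lambda>n. L (u n))"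
    using combine_lp_seminorms[OF p ys s_pos sums_summable[OF s_sums]] by blast
  have "dominated p (\<lambda>n. bidual_embedding (u n)) k" if k: "dominated p z k" for k
  proof -
    have "\<exists>ks. \<forall>i. dominated p (zs i) (ks i) \<and> (i = 0 \<longrightarrow> ks i = k) \<and>
        (\<forall>\<phi> :: 'b cdual. norm (\<phi> (ks i - ks (Suc i))) \<le> lp_norm p (\<lambda>n. \<phi> (ys i n)))"
    proof -
      have "\<exists>ks. \<forall>i. (dominated p (zs i) (ks i) \<and> (i = 0 \<longrightarrow> ks i = k)) \<and>
        (\<forall>\<phi> :: 'b cdual. norm (\<phi> (ks i - ks (Suc i))) \<le> lp_norm p (\<lambda>n. \<phi> (ys i n)))"
      proof (rule dependent_nat_choice)
        show "\<exists>k'. dominated p (zs 0) k' \<and> (0 = 0 \<longrightarrow> k' = k)"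
          using k by (simp add: zs_simps)
        fix k' i assume "dominated p (zs i) k' \<and> (i = 0 \<longrightarrow> k' = k)"
        then show "\<exists>k''. (dominated p (zs (Suc i)) k'' \<and> (Suc i = 0 \<longrightarrow> k'' = k)) \<and>
            (\<forall>\<phi> :: 'b cdual. norm (\<phi> (k' - k'')) \<le> lp_norm p (\<lambda>n. \<phi> (ys i n)))"
          using step[of i] unfolding R_def by auto
      qed
      then show ?thesis by simp
    qed
    then obtain ks where ks: "\<And>i. dominated p (zs i) (ks i)" "ks 0 = k"
      "\<And>i (\<phi> :: 'b cdual). norm (\<phi> (ks i - ks (Suc i))) \<le> lp_norm p (\<lambda>n. \<phi> (ys i n))"
      by blast
    have "norm (\<phi> k) \<le> lp_norm p (\<lambda>n. \<phi> (u n))" for \<phi> :: "'b cdual"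
    proof (rule LIMSEQ_le_const)
      show "(\<lambda>M. lp_norm p (\<lambda>n. \<phi> (u n)) + norm \<phi> * \<epsilon> M) \<longlonglongrightarrow> lp_norm p (\<lambda>n. \<phi> (u n))"
        using tendsto_add[OF tendsto_const tendsto_mult[OF tendsto_const
              summable_LIMSEQ_zero[OF sums_summable[OF \<epsilon>_sums]]],
            of "lp_norm p (\<lambda>n. \<phi> (u n))" "norm \<phi>"] by simp
      have telescope: "norm (\<phi> k) \<le> (\<Sum>i<M. lp_norm p (\<lambda>n. \<phi> (ys i n))) + norm (\<phi> (ks M))" for M
      proof (induction M)
        case (Suc M)
        have "norm (\<phi> (ks M)) \<le> norm (\<phi> (ks M - ks (Suc M))) + norm (\<phi> (ks (Suc M)))"
          using norm_triangle_ineq[of "\<phi> (ks M - ks (Suc M))" "\<phi> (ks (Suc M))"] by simp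
        then show ?case using Suc ks(3)[of \<phi> M] by simp
      qed (simp add: ks(2))
      have "norm (\<phi> k) \<le> lp_norm p (\<lambda>n. \<phi> (u n)) + norm \<phi> * \<epsilon> M" for M
      proof -
        have "norm (\<phi> (ks (Suc M))) \<le> norm \<phi> * lp_norm p (zs (Suc M))"
          by (rule dominated_norm_le[OF p zs_lp ks(1)])
        also have "\<dots> \<le> norm \<phi> * \<epsilon> M"
          by (intro mult_left_mono zs_norm) simp
        finally show ?thesis
          using telescope[of "Suc M"] u(3)[OF cblinfun_bounded_linear[of \<phi>], of "Suc M"] by linarith
      qed
      then show "\<exists>N. \<forall>M\<ge>N. norm (\<phi> k) \<le> lp_norm p (\<lambda>n. \<phi> (u n)) + norm \<phi> * \<epsilon> M" by blast
    qed
    then show ?thesis by (simp add: dominated_def bidual_embedding.rep_eq)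
  qed
  moreover have "lp_norm p u \<le> lp_norm p z + e"
    using u(2) sums_unique[OF s_sums] by simp
  ultimately show thesis using that u(1) by blast
qed

text \<open>
  Once the dominating sequence lies in \<open>Y\<close>, the coefficients of a dominated point represent it as a
  series in \<open>Y\<close>, since functionals separate points.
\<close>

theorem dominated_subset_p_hull:
  fixes z :: "nat \<Rightarrow> 'b::cbanach cdual cdual"
  assumes p: "1 \<le> p" and z: "z \<in> lp_seq p" and e: "0 < e"
    and K: "\<And>k. k \<in> K \<Longrightarrow> dominated p z k"
  obtains y where "y \<in> lp_seq p" "lp_norm p y \<le> lp_norm p z + e" "K \<subseteq> p_hull p y"
proof -
  have p0: "0 < p" using p by simp
  obtain u where u: "u \<in> lp_seq p" "lp_norm p u \<le> lp_norm p z + e / 2"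
    "\<And>k. dominated p z k \<Longrightarrow> dominated p (\<lambda>n. bidual_embedding (u n)) k"
    using dominated_iterate[OF p z, of "e / 2"] e by auto
  have "\<exists>a\<in>dual_ball p. k = (\<Sum>n. a n *\<^sub>C u n)" if k: "k \<in> K" for k
  proof -
    obtain a where a: "a \<in> dual_ball p"
      "\<And>\<phi>. cblinfun_apply \<phi> k = (\<Sum>n. a n * bidual_embedding (u n) \<phi>)"
      using dominated_coefficients[OF p lp_bidual_embedding(1)[OF p0 u(1)] u(3)[OF K[OF k]]] by blast
    have "k = (\<Sum>n. a n *\<^sub>C u n)"
      by (rule eq_if_dual_eq)
        (simp add: a(2) bidual_embedding.rep_eq dual_combination_bound(2)[OF p a(1) u(1)])
    with a(1) show ?thesis by blast
  qed
  then obtain y where "y \<in> lp_seq p" "lp_norm p y \<le> lp_norm p u + e / 2" "K \<subseteq> p_hull p y"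
    using subset_p_hull_if_dual_ball[OF p u(1), of "e / 2" K] e by auto
  then show thesis using that u(2) by simp
qed

section \<open>Relative \<open>p\<close>-compactness and quasi \<open>p\<close>-nuclear operators\<close>

lemma p_hull_imp_dominated:
  fixes y :: "nat \<Rightarrow> 'b::cbanach"
  assumes p: "1 \<le> p" and y: "y \<in> lp_seq p" and k: "k \<in> p_hull p y"
  shows "dominated p (\<lambda>n. bidual_embedding (y n)) k"
proof -
  obtain a where a: "a \<in> dual_ball p" "k = (\<Sum>n. a n *\<^sub>C y n)"
    using k conjugate_ball_subset_dual_ball[OF p] unfolding p_hull_def by blast
  show ?thesis
    using dual_combination_bound(1)[OF p a(1) y]
    by (simp add: dominated_def bidual_embedding.rep_eq a(2))
qed

text \<open>
  The assumption on \<open>S\<close> says \<open>\<parallel>S \<phi>\<parallel> = sup {|\<phi> k| : k \<in> K}\<close>, in a form that makes sense for empty \<open>K\<close>: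
  the Lipschitz image is empty when the domain is the zero space.
\<close>

theorem p_compact_iff_quasi_p_nuclear:
  fixes S :: "'b::cbanach cdual \<Rightarrow>\<^sub>C\<^sub>L 'c::complex_normed_vector" and K :: "'b set"
  assumes p: "1 \<le> p"
    and S: "\<And>\<phi> C. 0 \<le> C \<Longrightarrow> norm (S \<phi>) \<le> C \<longleftrightarrow> (\<forall>k\<in>K. norm (cblinfun_apply \<phi> k) \<le> C)"
  shows "rel_p_compact p K \<longleftrightarrow> S \<in> quasi_p_nuclear p"
    and "rel_p_compact p K \<Longrightarrow> m_p p K = quasi_p_nuclear_norm p S"
proof -
  have p0: "0 < p" using p by simp
  have QN: "QN_dominated p S z \<longleftrightarrow> z \<in> lp_seq p \<and> (\<forall>k\<in>K. dominated p z k)" for z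
    unfolding QN_dominated_def dominated_def using S[OF lp_norm_nonneg] by blast
  have to_QN: "QN_dominated p S (\<lambda>n. bidual_embedding (y n))"
    "lp_norm p (\<lambda>n. bidual_embedding (y n)) \<le> lp_norm p y"
    if "y \<in> lp_seq p" "K \<subseteq> p_hull p y" for y
    using that lp_bidual_embedding[OF p0 that(1)] p_hull_imp_dominated[OF p that(1)]
    by (auto simp: QN)
  have of_QN: "\<exists>y\<in>lp_seq p. lp_norm p y \<le> lp_norm p z + e \<and> K \<subseteq> p_hull p y"
    if "QN_dominated p S z" "0 < e" for z e
    using that dominated_subset_p_hull[OF p, of z e K] unfolding QN by metis
  show iff: "rel_p_compact p K \<longleftrightarrow> S \<in> quasi_p_nuclear p"
    unfolding rel_p_compact_def quasi_p_nuclear_def using to_QN(1) of_QN[OF _ zero_less_one] by blast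
  define A where "A = {lp_norm p y | y. y \<in> lp_seq p \<and> K \<subseteq> p_hull p y}"
  define B where "B = {lp_norm p z | z. QN_dominated p S z}"
  have bdd: "bdd_below A" "bdd_below B"
    unfolding A_def B_def using lp_norm_nonneg by (auto intro!: bdd_belowI[where m = 0])
  assume K: "rel_p_compact p K"
  then have ne: "A \<noteq> {}" "B \<noteq> {}"
    using iff unfolding A_def B_def rel_p_compact_def quasi_p_nuclear_def by blast+
  have "Inf A \<le> Inf B"
  proof (rule cInf_greatest[OF ne(2)])
    fix b assume "b \<in> B"
    then obtain z where z: "QN_dominated p S z" "b = lp_norm p z" by (auto simp: B_def)
    show "Inf A \<le> b"
    proof (rule field_le_epsilon)
      fix e :: real assume "0 < e"
      then obtain y where "y \<in> lp_seq p" "lp_norm p y \<le> b + e" "K \<subseteq> p_hull p y"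
        using of_QN[OF z(1)] z(2) by blast
      then show "Inf A \<le> b + e"
        by (intro cInf_lower2[OF _ _ bdd(1)]) (auto simp: A_def)
    qed
  qed
  moreover have "Inf B \<le> Inf A"
  proof (rule cInf_greatest[OF ne(1)])
    fix a assume "a \<in> A"
    then obtain y where y: "y \<in> lp_seq p" "K \<subseteq> p_hull p y" "a = lp_norm p y" by (auto simp: A_def)
    show "Inf B \<le> a"
      using to_QN[OF y(1,2)] y(3) by (intro cInf_lower2[OF _ _ bdd(2)]) (auto simp: B_def)
  qed
  ultimately show "m_p p K = quasi_p_nuclear_norm p S"
    by (simp add: m_p_def quasi_p_nuclear_norm_def A_def B_def)
qed

section \<open>Linearization and transposition\<close>

lemma HL0_transpose_apply: "HL0_apply (HL0_transpose f \<phi>) x = \<phi> (HL0_apply f x)"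
  by (simp add: HL0_transpose.rep_eq HL0_compose.rep_eq)

text \<open>
  The functional \<open>\<phi> \<mapsto> v (\<phi> \<circ> f)\<close> is an element of the bidual of \<open>Y\<close>. For \<open>v = eval x\<close> it comes from
  the vector \<open>f x\<close> of \<open>Y\<close>, and the \<open>v\<close> for which it comes from \<open>Y\<close> form a closed subspace, because
  \<open>Y\<close> is complete and embedded isometrically in its bidual.
\<close>

lemma bidual_preimage_exists:
  fixes f :: "('a::complex_normed_vector, 'b::cbanach) HL0"
  assumes "v \<in> G0_space"
  shows "\<exists>y. \<forall>\<phi>. cblinfun_apply \<phi> y = v (HL0_transpose f \<phi>)"
proof -
  \<comment> \<open>The functionals whose image in the bidual comes from \<open>Y\<close>.\<close>
  define P where "P = {v. \<exists>y. \<forall>\<phi>. cblinfun_apply \<phi> y = cblinfun_apply v (HL0_transpose f \<phi>)}"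
  have "complex_vector.subspace P"
  proof (rule complex_vector.subspaceI)
    show "0 \<in> P" by (auto simp: P_def intro!: exI[of _ 0])
    show "v + w \<in> P" if vw: "v \<in> P" "w \<in> P" for v w
    proof -
      obtain y y' where "\<forall>\<phi>. cblinfun_apply \<phi> y = v (HL0_transpose f \<phi>)"
        "\<forall>\<phi>. cblinfun_apply \<phi> y' = w (HL0_transpose f \<phi>)"
        using vw unfolding P_def by blast
      then show ?thesis by (auto simp: P_def intro!: exI[of _ "y + y'"])
    qed
    show "c *\<^sub>C v \<in> P" if v: "v \<in> P" for c v
    proof -
      obtain y where "\<forall>\<phi>. cblinfun_apply \<phi> y = v (HL0_transpose f \<phi>)"
        using v unfolding P_def by blast
      then show ?thesis by (auto simp: P_def intro!: exI[of _ "c *\<^sub>C y"])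
    qed
  qed
  moreover have "eval ` ball 0 1 \<subseteq> P"
    by (auto simp: P_def eval.rep_eq HL0_transpose_apply)
  ultimately have "complex_vector.span (eval ` ball 0 1) \<subseteq> P"
    by (intro complex_vector.span_minimal)
  moreover have "closed P"
    unfolding closed_sequential_limits
  proof (intro allI impI, elim conjE)
    fix vs v assume vs: "\<forall>i. vs i \<in> P" and lim: "vs \<longlonglongrightarrow> v"
    obtain y where y: "\<And>i \<phi>. cblinfun_apply \<phi> (y i) = vs i (HL0_transpose f \<phi>)"
      using vs unfolding P_def mem_Collect_eq by metis
    have dist: "norm (y i - y j) \<le> norm (vs i - vs j) * norm (HL0_transpose f)" for i j
    proof (rule norm_le_if_dual_bound)
      fix \<phi> :: "'b cdual"
      have "norm (\<phi> (y i - y j)) = norm ((vs i - vs j) (HL0_transpose f \<phi>))"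
        by (simp add: y)
      also have "\<dots> \<le> norm (vs i - vs j) * (norm (HL0_transpose f) * norm \<phi>)"
        by (rule order_trans[OF norm_cblinfun_apply_le]) (intro mult_left_mono norm_cblinfun_apply_le norm_ge_zero)
      finally show "norm (\<phi> (y i - y j)) \<le> norm (vs i - vs j) * norm (HL0_transpose f) * norm \<phi>"
        by (simp add: mult.assoc)
    qed simp
    have "Cauchy y"
    proof (rule CauchyI)
      fix e :: real assume e: "0 < e"
      define C where "C = norm (HL0_transpose f) + 1"
      have C: "0 < C" by (simp add: C_def add_nonneg_pos)
      obtain M where M: "\<And>i j. i \<ge> M \<Longrightarrow> j \<ge> M \<Longrightarrow> norm (vs i - vs j) < e / C"
        using CauchyD[OF LIMSEQ_imp_Cauchy[OF lim], of "e / C"] e C by auto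
      have "norm (y i - y j) < e" if "i \<ge> M" "j \<ge> M" for i j
      proof -
        have "norm (y i - y j) \<le> norm (vs i - vs j) * C"
          by (rule order_trans[OF dist mult_left_mono]) (simp_all add: C_def)
        also have "\<dots> < e" using M[OF that] C by (simp add: field_simps)
        finally show ?thesis .
      qed
      then show "\<exists>M. \<forall>i\<ge>M. \<forall>j\<ge>M. norm (y i - y j) < e" by blast
    qed
    then obtain l where l: "y \<longlonglongrightarrow> l"
      using Cauchy_convergent convergent_def by blast
    have "\<phi> l = v (HL0_transpose f \<phi>)" for \<phi> :: "'b cdual"
    proof (rule LIMSEQ_unique)
      show "(\<lambda>i. \<phi> (y i)) \<longlonglongrightarrow> \<phi> l"
        by (rule bounded_linear.tendsto[OF cblinfun_bounded_linear l])
      show "(\<lambda>i. \<phi> (y i)) \<longlonglongrightarrow> v (HL0_transpose f \<phi>)"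
        unfolding y by (rule bounded_linear.tendsto[OF bounded_linear_apply_at lim])
    qed
    then show "v \<in> P" unfolding P_def by blast
  qed
  ultimately have "G0_space \<subseteq> P"
    unfolding G0_space_def by (rule closure_minimal)
  then show ?thesis using assms unfolding P_def by blast
qed

text \<open>
  The linear span of the point evaluations is dense in \<open>G\<^sub>0\<close>.
\<close>

lemma G0_operator_ext:
  fixes S T :: "'a::complex_normed_vector G0 \<Rightarrow>\<^sub>C\<^sub>L 'b::complex_normed_vector"
  assumes eq: "\<And>x. x \<in> ball 0 1 \<Longrightarrow> S (\<delta> x) = T (\<delta> x)"
  shows "S u = T u"
proof -
  define Q where "Q = {v \<in> G0_space. S (Abs_G0 v) = T (Abs_G0 v)}"
  have "complex_vector.subspace Q"
  proof (rule complex_vector.subspaceI)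
    show "0 \<in> Q" by (simp add: Q_def G0_space_zero flip: zero_G0_def)
    show "v + w \<in> Q" if "v \<in> Q" "w \<in> Q" for v w
    proof -
      have "Abs_G0 (v + w) = Abs_G0 v + Abs_G0 w"
        using that by (simp add: Q_def plus_G0_def Abs_G0_inverse)
      then show ?thesis using that by (simp add: Q_def G0_space_add)
    qed
    show "c *\<^sub>C v \<in> Q" if "v \<in> Q" for c v
    proof -
      have "Abs_G0 (c *\<^sub>C v) = c *\<^sub>C Abs_G0 v"
        using that by (simp add: Q_def scaleC_G0_def Abs_G0_inverse)
      then show ?thesis using that by (simp add: Q_def G0_space_scaleC)
    qed
  qed
  moreover have "eval ` ball 0 1 \<subseteq> Q"
  proof clarify
    fix x :: 'a assume x: "x \<in> ball 0 1"
    have "Abs_G0 (eval x) = \<delta> x" by (metis \<delta>.rep_eq Rep_G0_inverse)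
    then show "eval x \<in> Q" using eq[OF x] by (simp add: Q_def eval_in_G0_space)
  qed
  ultimately have span: "complex_vector.span (eval ` ball 0 1) \<subseteq> Q"
    by (intro complex_vector.span_minimal)
  obtain a where a: "\<And>n. a n \<in> complex_vector.span (eval ` ball 0 1)" "a \<longlonglongrightarrow> Rep_G0 u"
    using Rep_G0[of u] unfolding G0_space_def closure_sequential by blast
  have aQ: "a n \<in> Q" for n using a(1) span by blast
  have "(\<lambda>n. Abs_G0 (a n)) \<longlonglongrightarrow> u"
  proof (rule LIM_zero_cancel, rule tendsto_norm_zero_cancel)
    have "norm (Abs_G0 (a n) - u) = norm (a n - Rep_G0 u)" for n
      using aQ[of n] by (simp add: norm_G0.rep_eq minus_G0.rep_eq Abs_G0_inverse Q_def)
    then show "(\<lambda>n. norm (Abs_G0 (a n) - u)) \<longlonglongrightarrow> 0"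
      using tendsto_norm_zero[OF LIM_zero[OF a(2)]] by simp
  qed
  then have "(\<lambda>n. S (Abs_G0 (a n))) \<longlonglongrightarrow> S u" "(\<lambda>n. T (Abs_G0 (a n))) \<longlonglongrightarrow> T u"
    by (auto intro: bounded_linear.tendsto[OF cblinfun_bounded_linear])
  moreover have "S (Abs_G0 (a n)) = T (Abs_G0 (a n))" for n
    using aQ[of n] by (simp add: Q_def)
  ultimately show ?thesis using LIMSEQ_unique by simp
qed

text \<open>
  The preimages in \<open>Y\<close> of the functionals \<open>\<phi> \<mapsto> u (\<phi> \<circ> f)\<close> define a bounded operator with the property
  that characterizes the linearization.
\<close>

theorem linearization_dual:
  fixes f :: "('a::complex_normed_vector, 'b::cbanach) HL0"
  shows "cblinfun_apply \<phi> (linearization f u) = Rep_G0 u (HL0_transpose f \<phi>)"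
proof -
  have "\<forall>u :: 'a G0. \<exists>y. \<forall>\<phi>. cblinfun_apply \<phi> y = Rep_G0 u (HL0_transpose f \<phi>)"
    using bidual_preimage_exists Rep_G0 by blast
  then obtain t where t: "\<And>(u :: 'a G0) \<phi>. cblinfun_apply \<phi> (t u) = Rep_G0 u (HL0_transpose f \<phi>)"
    by metis
  have "bounded_clinear t"
  proof (rule bounded_clinear_intro)
    show "t (u + v) = t u + t v" for u v
      by (rule eq_if_dual_eq) (simp add: t plus_G0.rep_eq)
    show "t (c *\<^sub>C u) = c *\<^sub>C t u" for c u
      by (rule eq_if_dual_eq) (simp add: t scaleC_G0.rep_eq)
    show "norm (t u) \<le> norm u * norm (HL0_transpose f)" for u
    proof (rule norm_le_if_dual_bound)
      fix \<phi> :: "'b cdual"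
      have "norm (\<phi> (t u)) \<le> norm (Rep_G0 u) * (norm (HL0_transpose f) * norm \<phi>)"
        unfolding t
        by (rule order_trans[OF norm_cblinfun_apply_le]) (intro mult_left_mono norm_cblinfun_apply_le norm_ge_zero)
      then show "norm (\<phi> (t u)) \<le> norm u * norm (HL0_transpose f) * norm \<phi>"
        by (simp add: norm_G0.rep_eq mult.assoc)
    qed simp
  qed
  then have T: "cblinfun_apply (CBlinfun t) = t" by (simp add: CBlinfun_inverse)
  have T_\<delta>: "CBlinfun t (\<delta> x) = f x" for x
    by (rule eq_if_dual_eq) (simp add: T t \<delta>.rep_eq eval.rep_eq HL0_transpose_apply)
  have "linearization f = CBlinfun t"
    unfolding linearization_def
  proof (rule the_equality)
    show "\<forall>x\<in>ball 0 1. CBlinfun t (\<delta> x) = f x" by (simp add: T_\<delta>)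
    fix S :: "'a G0 \<Rightarrow>\<^sub>C\<^sub>L 'b" assume S: "\<forall>x\<in>ball 0 1. S (\<delta> x) = f x"
    show "S = CBlinfun t"
    proof (rule cblinfun_apply_inject[THEN iffD1], rule ext, rule G0_operator_ext)
      fix x :: 'a assume "x \<in> ball 0 1"
      then show "S (\<delta> x) = CBlinfun t (\<delta> x)" using S by (simp only: T_\<delta>)
    qed
  qed
  then show ?thesis by (simp add: T t)
qed

lemma norm_\<delta>_diff_le:
  assumes "x \<in> ball 0 1" "y \<in> ball 0 1"
  shows "norm (\<delta> x - \<delta> y) \<le> norm (x - y)"
proof -
  have "norm (eval x - eval y) \<le> norm (x - y)"
  proof (rule norm_cblinfun_le)
    fix g :: "('a, complex) HL0"
    show "norm ((eval x - eval y) g) \<le> norm (x - y) * norm g"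
      using Lip_bound[OF HL0_apply assms, of g] by (simp add: eval.rep_eq norm_HL0.rep_eq mult.commute)
  qed simp
  then show ?thesis by (simp add: norm_G0.rep_eq minus_G0.rep_eq \<delta>.rep_eq)
qed

text \<open>
  The upper bound holds since \<open>T\<^sub>f\<^sup>* \<phi>\<close> evaluates elements of \<open>G\<^sub>0\<close> at \<open>\<phi> \<circ> f\<close>, the lower bound since
  the differences \<open>\<delta> x - \<delta> y\<close> have norm at most \<open>\<parallel>x - y\<parallel>\<close>.
\<close>

lemma norm_adjoint_linearization:
  fixes f :: "('a::complex_normed_vector, 'b::cbanach) HL0"
  shows "norm (cadjoint (linearization f) \<phi>) = norm (HL0_transpose f \<phi>)"
proof (rule antisym)
  have apply_eq: "cadjoint (linearization f) \<phi> u = Rep_G0 u (HL0_transpose f \<phi>)" for u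
    by (simp add: cadjoint.rep_eq cblinfun_compose.rep_eq linearization_dual)
  show "norm (cadjoint (linearization f) \<phi>) \<le> norm (HL0_transpose f \<phi>)"
  proof (rule norm_cblinfun_le)
    show "norm (cadjoint (linearization f) \<phi> u) \<le> norm (HL0_transpose f \<phi>) * norm u" for u
      using norm_cblinfun_apply_le[of "Rep_G0 u" "HL0_transpose f \<phi>"]
      by (simp add: apply_eq norm_G0.rep_eq mult.commute)
  qed simp
  show "norm (HL0_transpose f \<phi>) \<le> norm (cadjoint (linearization f) \<phi>)"
    unfolding norm_HL0.rep_eq
  proof (rule Lip_le)
    fix x y :: 'a assume xy: "x \<in> ball 0 1" "y \<in> ball 0 1"
    have "HL0_transpose f \<phi> x - HL0_transpose f \<phi> y = cadjoint (linearization f) \<phi> (\<delta> x - \<delta> y)"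
      by (simp add: apply_eq minus_G0.rep_eq \<delta>.rep_eq eval.rep_eq)
    also have "norm \<dots> \<le> norm (cadjoint (linearization f) \<phi>) * norm (\<delta> x - \<delta> y)"
      by (rule norm_cblinfun_apply_le)
    also have "\<dots> \<le> norm (cadjoint (linearization f) \<phi>) * norm (x - y)"
      by (intro mult_left_mono norm_\<delta>_diff_le xy norm_ge_zero)
    finally show "norm (HL0_transpose f \<phi> x - HL0_transpose f \<phi> y) \<le>
        norm (cadjoint (linearization f) \<phi>) * norm (x - y)" .
  qed simp
qed

lemma norm_adjoint_le_iff:
  fixes T :: "'a::complex_normed_vector \<Rightarrow>\<^sub>C\<^sub>L 'b::complex_normed_vector"
  assumes "0 \<le> C"
  shows "norm (cadjoint T \<phi>) \<le> C \<longleftrightarrow> (\<forall>k\<in>T ` cball 0 1. norm (cblinfun_apply \<phi> k) \<le> C)"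
proof
  assume le: "norm (cadjoint T \<phi>) \<le> C"
  have "norm (\<phi> (T u)) \<le> C" if "norm u \<le> 1" for u
  proof -
    have "norm (\<phi> (T u)) \<le> norm (cadjoint T \<phi>) * norm u"
      using norm_cblinfun_apply_le[of "cadjoint T \<phi>" u]
      by (simp add: cadjoint.rep_eq cblinfun_compose.rep_eq)
    also have "\<dots> \<le> C * 1" using le that assms by (intro mult_mono) auto
    finally show ?thesis by simp
  qed
  then show "\<forall>k\<in>T ` cball 0 1. norm (cblinfun_apply \<phi> k) \<le> C" by simp
next
  assume bound: "\<forall>k\<in>T ` cball 0 1. norm (cblinfun_apply \<phi> k) \<le> C"
  show "norm (cadjoint T \<phi>) \<le> C"
  proof (rule norm_cblinfun_le[OF assms])
    fix u
    show "norm (cadjoint T \<phi> u) \<le> C * norm u"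
    proof (cases "u = 0")
      case False
      define c where "c = complex_of_real (inverse (norm u))"
      have "norm (c *\<^sub>C u) \<le> 1" using False by (simp add: c_def norm_scaleC norm_inverse)
      then have "T (c *\<^sub>C u) \<in> T ` cball 0 1" by (intro imageI) simp
      then have "norm (\<phi> (T (c *\<^sub>C u))) \<le> C" using bound by blast
      then have "inverse (norm u) * norm (\<phi> (T u)) \<le> C"
        by (simp add: c_def norm_mult norm_inverse)
      then show ?thesis
        using False by (simp add: cadjoint.rep_eq cblinfun_compose.rep_eq field_simps)
    qed simp
  qed
qed

lemma norm_transpose_le_iff:
  fixes f :: "('a::complex_normed_vector, 'b::complex_normed_vector) HL0"
  assumes "0 \<le> C"
  shows "norm (HL0_transpose f \<phi>) \<le> C \<longleftrightarrow> (\<forall>k\<in>Lip_image f. norm (cblinfun_apply \<phi> k) \<le> C)"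
proof -
  have slope: "norm (\<phi> ((f x - f y) /\<^sub>R norm (x - y))) =
      norm (HL0_transpose f \<phi> x - HL0_transpose f \<phi> y) / norm (x - y)" for x y
    by (simp add: scaleR_scaleC HL0_transpose_apply norm_mult norm_inverse divide_inverse mult.commute)
  show ?thesis
  proof
    assume le: "norm (HL0_transpose f \<phi>) \<le> C"
    have "norm (\<phi> ((f x - f y) /\<^sub>R norm (x - y))) \<le> C"
      if "x \<in> ball 0 1" "y \<in> ball 0 1" "x \<noteq> y" for x y
    proof -
      have "norm (HL0_transpose f \<phi> x - HL0_transpose f \<phi> y) \<le> norm (HL0_transpose f \<phi>) * norm (x - y)"
        using Lip_bound[OF HL0_apply that(1,2)] by (simp add: norm_HL0.rep_eq)
      also have "\<dots> \<le> C * norm (x - y)" by (intro mult_right_mono le) simp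
      finally show ?thesis using that(3) by (simp add: slope divide_le_eq)
    qed
    then show "\<forall>k\<in>Lip_image f. norm (cblinfun_apply \<phi> k) \<le> C" by (auto simp: Lip_image_def)
  next
    assume bound: "\<forall>k\<in>Lip_image f. norm (cblinfun_apply \<phi> k) \<le> C"
    show "norm (HL0_transpose f \<phi>) \<le> C"
      unfolding norm_HL0.rep_eq
    proof (rule Lip_le[OF assms])
      fix x y :: 'a assume xy: "x \<in> ball 0 1" "y \<in> ball 0 1"
      show "norm (HL0_transpose f \<phi> x - HL0_transpose f \<phi> y) \<le> C * norm (x - y)"
      proof (cases "x = y")
        case False
        then have "norm (\<phi> ((f x - f y) /\<^sub>R norm (x - y))) \<le> C"
          using bound xy unfolding Lip_image_def by blast
        then show ?thesis using False by (simp add: slope divide_le_eq)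
      qed simp
    qed
  qed
qed

section \<open>The equivalence\<close>

theorem proposition2p10:
  fixes p :: real and f :: "('a::cbanach, 'b::cbanach) HL0"
  assumes "1 \<le> p"
  shows "(f \<in> HL0_p_compact p \<longleftrightarrow> linearization f \<in> p_compact_op p) \<and>
    (linearization f \<in> p_compact_op p \<longleftrightarrow> cadjoint (linearization f) \<in> quasi_p_nuclear p) \<and>
    (cadjoint (linearization f) \<in> quasi_p_nuclear p \<longleftrightarrow> HL0_transpose f \<in> quasi_p_nuclear p) \<and>
    (f \<in> HL0_p_compact p \<longrightarrow>
      HL0_p_compact_norm p f = p_compact_op_norm p (linearization f) \<and>
      p_compact_op_norm p (linearization f) = quasi_p_nuclear_norm p (cadjoint (linearization f)) \<and>
      quasi_p_nuclear_norm p (cadjoint (linearization f)) = quasi_p_nuclear_norm p (HL0_transpose f))"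
proof -
  let ?T = "linearization f"
  have "QN_dominated p (cadjoint ?T) = QN_dominated p (HL0_transpose f)"
    by (simp add: QN_dominated_def fun_eq_iff norm_adjoint_linearization)
  then have iii_iv: "cadjoint ?T \<in> quasi_p_nuclear p \<longleftrightarrow> HL0_transpose f \<in> quasi_p_nuclear p"
    "quasi_p_nuclear_norm p (cadjoint ?T) = quasi_p_nuclear_norm p (HL0_transpose f)"
    by (simp_all add: quasi_p_nuclear_def quasi_p_nuclear_norm_def)
  have ii_iii: "?T \<in> p_compact_op p \<longleftrightarrow> cadjoint ?T \<in> quasi_p_nuclear p"
    "?T \<in> p_compact_op p \<Longrightarrow> p_compact_op_norm p ?T = quasi_p_nuclear_norm p (cadjoint ?T)"
    using p_compact_iff_quasi_p_nuclear[OF assms norm_adjoint_le_iff, of ?T]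
    by (simp_all add: p_compact_op_def p_compact_op_norm_def)
  have i_iv: "f \<in> HL0_p_compact p \<longleftrightarrow> HL0_transpose f \<in> quasi_p_nuclear p"
    "f \<in> HL0_p_compact p \<Longrightarrow> HL0_p_compact_norm p f = quasi_p_nuclear_norm p (HL0_transpose f)"
    using p_compact_iff_quasi_p_nuclear[OF assms norm_transpose_le_iff, of f]
    by (simp_all add: HL0_p_compact_def HL0_p_compact_norm_def)
  show ?thesis
    using i_iv ii_iii iii_iv by simp
qed

end
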